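(* For every $\beta>1$ there exists a strongly convex function $\varphi$ satisfying the $\tilde\Delta_2$-condition such that, with $\Phi=\varphi\circ\log$, the class $\mathcal H_\Phi$ contains $\mathcal H_{\Phi_\beta}$ and $$\operatorname{Mult}(\mathcal H_\Phi)=H^\infty,$$ where $\Phi_\beta=\varphi_\beta\circ\log$ and $\varphi_\beta(t)=e^{(\ln t)^\beta}$ for all sufficiently large $t$.
   Context: $\mathbb D$ is the open unit disk, $\mathbb T=\partial\mathbb D$ with normalized Lebesgue measure $m$, $\operatorname{Hol}(\mathbb D)$ is the space of holomorphic functions on $\mathbb D$, $H^\infty$ is the space of bounded holomorphic functions on $\mathbb D$, and $N^+$ is the Smirnov class on $\mathbb D$; functions in $N^+$ have non-tangential boundary values a.e. on $\mathbb T$, denoted by the same letter. A function $\varphi:\mathbb R\to[0,\infty)$ is strongly convex if it is convex, nondecreasing and $\lim_{t\to\infty}\varphi(t)/t=\infty$; one sets $\varphi(-\infty)=0$. With $\Phi=\varphi\circ\log$, the Hardy-Orlicz class is $\mathcal H_\Phi=\{f\in N^+:\int_{\mathbb T}\Phi(|f|)\,dm<\infty\}$. For $X\subset\operatorname{Hol}(\mathbb D)$, $\operatorname{Mult}(X)=\{g\in\operatorname{Hol}(\mathbb D): gf\in X \text{ for all } f\in X\}$. The function $\varphi$ satisfies the $\tilde\Delta_2$-condition if there are constants $M,K\ge0$ and $t_0\in\mathbb R$ such that $\varphi(t+2)\le M\varphi(t)+K$ for all $t\ge t_0$. The function $\varphi_\beta$ is extended to a strongly convex function on $\mathbb R$;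 the class $\mathcal H_{\Phi_\beta}$ depends only on values for large $t$, so the extension is immaterial. *)

theory Defs
  imports "HOL-Complex_Analysis.Complex_Analysis" "HOL-Real_Asymp.Real_Asymp"
begin

text \<open>
  Functions on the open unit disk are total functions of type \<open>complex \<Rightarrow> complex\<close>; membership in
  each of the classes below depends only on the values on \<open>ball 0 1\<close>.
\<close>

definition Hol_disk :: "(complex \<Rightarrow> complex) set" where
  "Hol_disk = {f. f holomorphic_on ball 0 1}"

definition Hinf :: "(complex \<Rightarrow> complex) set" where
  "Hinf = {f \<in> Hol_disk. bounded (f ` ball 0 1)}"

definition circle_measure :: "complex measure" where
  "circle_measure = distr (uniform_measure lborel {0..2*pi}) borel cis"

text \<open>
  Here \<open>k\<close> is the logarithm of the boundary modulus of \<open>h\<close>; it is an arbitrary real-valued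
  integrable function on the circle.
\<close>

definition outer :: "(complex \<Rightarrow> complex) \<Rightarrow> bool" where
  "outer h \<longleftrightarrow> (\<exists>(c::complex) (k :: complex \<Rightarrow> real).
      cmod c = 1 \<and> integrable circle_measure k \<and>
      (\<forall>z\<in>ball 0 1.
        h z = c * exp (\<integral>\<zeta>. (\<zeta> + z) / (\<zeta> - z) * complex_of_real (k \<zeta>) \<partial>circle_measure)))"

text \<open>
  The Smirnov class: quotients of bounded holomorphic functions with outer denominator.  An outer
  function has no zeros in the disk, so the quotient is a genuine one.
\<close>

definition Smirnov :: "(complex \<Rightarrow> complex) set" where
  "Smirnov = {f \<in> Hol_disk.
     \<exists>g\<in>Hinf. \<exists>h\<in>Hinf. outer h \<and> (\<forall>z\<in>ball 0 1. f z = g z / h z)}"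

definition Stolz :: "real \<Rightarrow> complex \<Rightarrow> complex set" where
  "Stolz \<alpha> \<zeta> = {z. cmod z < 1 \<and> cmod (z - \<zeta>) < \<alpha> * (1 - cmod z)}"

definition has_nt_limit :: "(complex \<Rightarrow> complex) \<Rightarrow> complex \<Rightarrow> complex \<Rightarrow> bool" where
  "has_nt_limit f \<zeta> L \<longleftrightarrow> (\<forall>\<alpha>>1. (f \<longlongrightarrow> L) (at \<zeta> within Stolz \<alpha> \<zeta>))"

text \<open>
  The default value \<open>0\<close> is irrelevant for \<open>f \<in> Smirnov\<close>, where the limit exists at almost every
  point of the circle.
\<close>

definition bdry :: "(complex \<Rightarrow> complex) \<Rightarrow> complex \<Rightarrow> complex" where
  "bdry f \<zeta> = (if \<exists>L. has_nt_limit f \<zeta> L then THE L. has_nt_limit f \<zeta> L else 0)"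

definition strongly_convex :: "(real \<Rightarrow> real) \<Rightarrow> bool" where
  "strongly_convex \<phi> \<longleftrightarrow>
     (\<forall>t. 0 \<le> \<phi> t) \<and> convex_on UNIV \<phi> \<and> mono \<phi> \<and> filterlim (\<lambda>t. \<phi> t / t) at_top at_top"

definition tilde_Delta2 :: "(real \<Rightarrow> real) \<Rightarrow> bool" where
  "tilde_Delta2 \<phi> \<longleftrightarrow> (\<exists>M\<ge>0. \<exists>K\<ge>0. \<exists>t0. \<forall>t\<ge>t0. \<phi> (t + 2) \<le> M * \<phi> t + K)"

text \<open>
  \<open>comp_log \<phi>\<close> is \<open>\<phi> \<circ> log\<close> on \<open>[0, \<infinity>)\<close>, with the convention \<open>\<phi>(log 0) = \<phi>(-\<infinity>) = 0\<close>.
\<close>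

definition comp_log :: "(real \<Rightarrow> real) \<Rightarrow> real \<Rightarrow> real" where
  "comp_log \<phi> x = (if x > 0 then \<phi> (ln x) else 0)"

definition Hardy_Orlicz :: "(real \<Rightarrow> real) \<Rightarrow> (complex \<Rightarrow> complex) set" where
  "Hardy_Orlicz \<Phi> =
     {f \<in> Smirnov. (\<integral>\<^sup>+\<zeta>. ennreal (\<Phi> (cmod (bdry f \<zeta>))) \<partial>circle_measure) < \<infinity>}"

definition Mult :: "(complex \<Rightarrow> complex) set \<Rightarrow> (complex \<Rightarrow> complex) set" where
  "Mult X = {g \<in> Hol_disk. \<forall>f\<in>X. (\<lambda>z. g z * f z) \<in> X}"

text \<open>
  The strongly convex functions that equal \<open>exp ((ln t)\<^sup>\<beta>)\<close> for all large \<open>t\<close>.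
  Since the circle has finite measure, all of them give the same Hardy--Orlicz class.
\<close>

definition is_phi_beta :: "real \<Rightarrow> (real \<Rightarrow> real) \<Rightarrow> bool" where
  "is_phi_beta \<beta> \<psi> \<longleftrightarrow>
     strongly_convex \<psi> \<and> (\<forall>\<^sub>F t in at_top. \<psi> t = exp (ln t powr \<beta>))"

lemma convex_on_exp_ln_powr:
  fixes \<beta> :: real
  assumes "\<beta> > 1"
  shows "convex_on {exp 1..} (\<lambda>t. exp (ln t powr \<beta>))"
proof -
  let ?f' = "\<lambda>t::real. exp (ln t powr \<beta>) * (\<beta> * ln t powr (\<beta> - 1) / t)"
  let ?f'' = "\<lambda>t::real. exp (ln t powr \<beta>) * (\<beta> * ln t powr (\<beta> - 1) / t)\<^sup>2
    + exp (ln t powr \<beta>) * ((\<beta> * ((\<beta> - 1) * ln t powr (\<beta> - 2) / t) * t - \<beta> * ln t powr (\<beta> - 1)) / t\<^sup>2)"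
  have pos: "t > 0" "ln t \<ge> 1" if "t \<in> {exp 1..}" for t :: real
  proof -
    show "t > 0" using that exp_gt_zero[of "1::real"] by (simp del: exp_gt_zero)
    then show "ln t \<ge> 1" using that by (simp add: ln_ge_iff)
  qed
  show ?thesis
  proof (rule f''_ge0_imp_convex[where f' = ?f' and f'' = ?f''])
    fix t :: real assume t: "t \<in> {exp 1..}"
    note p = pos[OF t]
    have "t > 1" using p by (metis ln_gt_zero_iff less_le_trans zero_less_one)
    then have D: "((\<lambda>t. ln t powr c) has_real_derivative c * ln t powr (c - 1) / t) (at t)" for c
      using DERIV_fun_powr[OF DERIV_ln_divide[OF p(1)], of c] p by simp
    show D1: "((\<lambda>t. exp (ln t powr \<beta>)) has_real_derivative ?f' t) (at t)"
      by (rule DERIV_fun_exp[OF D])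
    have "((\<lambda>t. \<beta> * ln t powr (\<beta> - 1) / t) has_real_derivative
        (\<beta> * ((\<beta> - 1) * ln t powr (\<beta> - 2) / t) * t - \<beta> * ln t powr (\<beta> - 1)) / t\<^sup>2) (at t)"
      using DERIV_divide[OF DERIV_cmult[OF D[of "\<beta> - 1"], of \<beta>] DERIV_ident] p
      by (simp add: power2_eq_square)
    from DERIV_mult[OF D1 this] show "(?f' has_real_derivative ?f'' t) (at t)"
      by (simp add: power2_eq_square algebra_simps)
    define a where "a = \<beta> * ln t powr (\<beta> - 1)"
    have "ln t powr (\<beta> - 1) \<ge> 1" using p assms by (simp add: ge_one_powr_ge_zero)
    then have a: "a \<ge> 1" unfolding a_def using assms by (metis less_eq_real_def mult_ge1_I)
    then have "a \<le> a\<^sup>2" by (simp add: power2_eq_square)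
    moreover have "\<beta> * ((\<beta> - 1) * ln t powr (\<beta> - 2) / t) * t \<ge> 0" using p assms by simp
    moreover have "?f'' t = exp (ln t powr \<beta>) / t\<^sup>2 *
        (a\<^sup>2 - a + \<beta> * ((\<beta> - 1) * ln t powr (\<beta> - 2) / t) * t)"
      using p unfolding a_def by (simp add: field_simps power2_eq_square)
    ultimately show "?f'' t \<ge> 0" using p by simp
  qed simp
qed

lemma is_phi_beta_exists:
  assumes "\<beta> > 1"
  shows "\<exists>\<psi>. is_phi_beta \<beta> \<psi>"
proof -
  define F where "F = (\<lambda>t::real. exp (ln t powr \<beta>))"
  define \<psi> where "\<psi> = (\<lambda>t. F (max t (exp 1)))"
  have F: "F s \<le> F t" if "exp 1 \<le> s" "s \<le> t" for s t
  proof -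
    have "0 < s" using that exp_gt_zero[of "1::real"] by linarith
    then have "1 \<le> ln s" "ln s \<le> ln t" using that by (auto simp: ln_ge_iff)
    then show ?thesis unfolding F_def using assms by (auto intro: powr_mono2)
  qed
  have cF: "convex_on {exp 1..} F" unfolding F_def by (rule convex_on_exp_ln_powr[OF assms])
  have "convex_on UNIV \<psi>"
  proof (rule convex_onI)
    fix u x y :: real assume u: "0 < u" "u < 1"
    let ?m = "\<lambda>t. max t (exp (1::real))"
    have "(1-u) * x \<le> (1-u) * ?m x" "u * y \<le> u * ?m y"
      "(1-u) * exp 1 \<le> (1-u) * ?m x" "u * exp 1 \<le> u * ?m y"
      using u by (auto intro!: mult_left_mono)
    then have "?m ((1-u) * x + u * y) \<le> (1-u) * ?m x + u * ?m y"
      by (subst max.bounded_iff) (simp add: algebra_simps)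
    then have "\<psi> ((1-u) * x + u * y) \<le> F ((1-u) * ?m x + u * ?m y)"
      unfolding \<psi>_def by (intro F) auto
    also have "\<dots> \<le> (1-u) * \<psi> x + u * \<psi> y"
      unfolding \<psi>_def using convex_onD[OF cF, of u "?m x" "?m y"] u by simp
    finally show "\<psi> ((1-u) *\<^sub>R x + u *\<^sub>R y) \<le> (1-u) * \<psi> x + u * \<psi> y" by simp
  qed simp
  moreover have "mono \<psi>" unfolding \<psi>_def by (intro monoI F) auto
  moreover have "\<forall>t. 0 \<le> \<psi> t" by (simp add: \<psi>_def F_def)
  moreover have ev: "\<forall>\<^sub>F t in at_top. \<psi> t = exp (ln t powr \<beta>)"
    using eventually_ge_at_top[of "exp 1"] by eventually_elim (simp add: \<psi>_def F_def max_def)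
  moreover have "filterlim (\<lambda>t. exp (ln t powr \<beta>) / t) at_top at_top"
    using assms by real_asymp
  then have "filterlim (\<lambda>t. \<psi> t / t) at_top at_top"
    by (rule filterlim_mono_eventually) (use ev in \<open>auto elim: eventually_mono\<close>)
  ultimately show ?thesis unfolding is_phi_beta_def strongly_convex_def by blast
qed

end

theory Submission
  imports Defs
begin

text \<open>
  Take \<open>\<phi>\<close> convex and piecewise linear whose slope right of each knot \<open>t\<^sub>n\<close> equals \<open>\<phi> t\<^sub>n\<close>, with
  \<open>t\<^sub>n\<close> growing so fast that \<open>\<phi>\<close> is dominated by a cubic polynomial, hence by \<open>\<phi>\<^sub>\<beta>\<close> for every
  \<open>\<beta> > 1\<close>.  Then \<open>\<phi> (t + a) \<le> M (\<phi> t + 1)\<close> for fixed \<open>a\<close>, so bounded functions are multipliers, yet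
  \<open>\<phi> (t\<^sub>n + a) \<ge> (1 + a) \<phi> t\<^sub>n\<close>.  If a multiplier \<open>g\<close> is unbounded, then so are its boundary values, by
  the maximum principle in the Smirnov class; placing the values \<open>t\<^sub>n\<close> suitably on small sets where
  \<open>\<bar>g\<bar>\<close> is large yields \<open>k \<ge> 0\<close> with \<open>\<phi> (k)\<close> integrable and \<open>\<phi> (k + ln \<bar>g\<bar>)\<close> not integrable,
  and the outer function with boundary modulus \<open>exp k\<close> contradicts the multiplier property.

  The boundary theory rests on the non-tangential convergence of Poisson integrals at Lebesgue points
  and on the Poisson representation of bounded functions, whose Taylor coefficients are square summable.
\<close>

section \<open>Integration on the circle\<close>

text \<open>The two obvious candidates fail. For a power of t, \<phi> (s + t) \<le> C * (\<phi> s +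
  \<phi> t) on nonnegative arguments makes the class an algebra, so its unbounded members are
  multipliers. For an exponential all multipliers are bounded, but it outgrows every
  \<open>\<phi>\<^sub>\<beta>\<close>. Hence \<open>phi\<close> has polynomial size and exponential
  behaviour only at isolated corners: at a knot the slope jumps from the square root of the value to
  the value itself. Rising from p to p^2 with slope p takes length p - 1, which is the recursion of
  \<open>knot\<close>. The value at a late knot is thus about the square of its position, and the
  linear piece after it costs one more factor, whence the cubic bound. A multiplier is a priori only
  holomorphic. Testing it on the constant 1 places it in the Smirnov class, where a bound on the
  boundary values passes to the disk. This fails for quotients with denominators that are not outer:
  exp ((1 + z) / (1 - z)) is unbounded with boundary modulus 1 almost everywhere.\<close>

lemma cis_measurable [measurable]: "cis \<in> borel_measurable borel"
  by (intro borel_measurable_continuous_onI continuous_intros)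

lemma cnj_measurable [measurable]: "cnj \<in> borel_measurable borel"
  by (intro borel_measurable_continuous_onI continuous_intros)

lemma cis_eq_cisD:
  assumes "cis s = cis t" "s \<in> {0..2*pi}" "t \<in> {0..2*pi}" "s \<noteq> t"
  shows "s \<in> {0, 2*pi}"
proof -
  have "cis (s - t) = 1" using assms(1) by (simp flip: cis_divide)
  then have "cos (s - t) = 1" by (simp add: complex_eq_iff)
  then obtain n :: int where n: "s - t = of_int n * 2 * pi" by (auto simp: cos_one_2pi_int)
  have "n \<noteq> 0" using n assms by auto
  then have "1 \<le> \<bar>real_of_int n\<bar>" by linarith
  then have "1 * (2 * pi) \<le> \<bar>real_of_int n\<bar> * (2 * pi)" by (intro mult_right_mono) auto
  then have "2 * pi \<le> \<bar>s - t\<bar>" unfolding n by (simp add: abs_mult)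
  then show ?thesis using assms by auto
qed

lemma sets_circle [simp, measurable_cong]: "sets circle_measure = sets borel"
  and space_circle [simp]: "space circle_measure = UNIV"
  by (simp_all add: circle_measure_def)

lemma nn_integral_circle:
  assumes [measurable]: "f \<in> borel_measurable borel"
  shows "(\<integral>\<^sup>+\<zeta>. f \<zeta> \<partial>circle_measure)
    = (\<integral>\<^sup>+t. f (cis t) * indicator {0..2*pi} t \<partial>lborel) / ennreal (2*pi)"
  unfolding circle_measure_def
  by (subst nn_integral_distr) (simp_all add: nn_integral_uniform_measure)

lemma emeasure_circle_UNIV [simp]: "emeasure circle_measure UNIV = 1"
proof -
  have "emeasure circle_measure UNIV = (\<integral>\<^sup>+\<zeta>. 1 \<partial>circle_measure)" by simp
  also have "\<dots> = 1" by (subst nn_integral_circle) (auto simp: divide_eq_1_ennreal)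
  finally show ?thesis .
qed

interpretation circle: finite_measure circle_measure
  by (rule finite_measureI) simp

lemma measure_circle_UNIV [simp]: "measure circle_measure UNIV = 1"
  by (simp add: measure_def)

text \<open>
  Pulling a null set of angles back through \<open>cis\<close> needs a Borel set on the circle; it is
  obtained from the measurability of the argument function off the positive real axis.
\<close>

lemma AE_circleI:
  assumes N: "negligible N" and Q: "\<And>t. t \<in> {0<..<2*pi} \<Longrightarrow> t \<notin> N \<Longrightarrow> Q (cis t)"
  shows "AE \<zeta> in circle_measure. Q \<zeta>"
proof -
  have "N \<in> null_sets lebesgue" using N by (simp add: negligible_iff_null_sets)
  then obtain N' where N': "N' \<in> null_sets lborel" "N \<subseteq> N'"
    by (auto simp: null_sets_completion_iff2)
  have [measurable]: "N' \<in> sets borel" using N' by auto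
  have [measurable]: "(\<lambda>\<zeta>. if \<zeta> \<in> - \<real>\<^sub>\<ge>\<^sub>0 then Arg2pi \<zeta> else 0) \<in> borel_measurable borel"
    by (intro borel_measurable_continuous_on_if continuous_on_const)
      (auto intro!: continuous_at_imp_continuous_on continuous_at_Arg2pi closed_nonneg_Reals_complex
        simp: open_Compl[THEN borel_open])
  \<comment> \<open>The implication puts the whole nonnegative real axis into the bad set
    \<open>B\<close>. On the circle this adds only the point 1, whose angles 0 and 2*pi are
    null.\<close>
  define B where "B = {\<zeta>. (\<zeta> \<notin> \<real>\<^sub>\<ge>\<^sub>0 \<longrightarrow> (if \<zeta> \<in> - \<real>\<^sub>\<ge>\<^sub>0 then Arg2pi \<zeta> else 0) \<in> N')} \<union> - sphere 0 1"
  have Bm: "B \<in> sets borel"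
    unfolding B_def using closed_nonneg_Reals_complex[THEN borel_closed] by measurable
  have arg: "Arg2pi (cis t) = t" if "t \<in> {0<..<2*pi}" for t
    using that by (intro Arg2pi_unique[of 1]) (auto simp: cis_conv_exp mult.commute)
  have "Q \<zeta>" if "\<zeta> \<notin> B" for \<zeta>
  proof -
    have z: "norm \<zeta> = 1" "\<zeta> \<notin> \<real>\<^sub>\<ge>\<^sub>0" "Arg2pi \<zeta> \<notin> N'" using that unfolding B_def by auto
    have "\<zeta> = cis (Arg2pi \<zeta>)" using Arg2pi_eq[of \<zeta>] z by (simp add: cis_conv_exp mult.commute)
    moreover have "Arg2pi \<zeta> \<in> {0<..<2*pi}"
      using z Arg2pi_lt_2pi[of \<zeta>] by (simp add: Arg2pi_gt_0)
    ultimately show ?thesis using Q z N' by (metis subsetD)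
  qed
  moreover have "AE t in lborel. t \<in> {0..2*pi} \<longrightarrow> cis t \<notin> B"
  proof -
    have "AE t in lborel. t \<notin> N'" using N'(1) by (rule AE_not_in)
    moreover have "AE t in lborel. t \<noteq> 0" "AE t in lborel. t \<noteq> 2*pi" by (rule AE_lborel_singleton)+
    ultimately show ?thesis
    proof eventually_elim
      fix t assume t: "t \<notin> N'" "t \<noteq> 0" "t \<noteq> 2*pi"
      show "t \<in> {0..2*pi} \<longrightarrow> cis t \<notin> B"
      proof
        assume "t \<in> {0..2*pi}"
        then have t': "t \<in> {0<..<2*pi}" using t by auto
        then have "cis t \<notin> \<real>\<^sub>\<ge>\<^sub>0"
          using arg[OF t'] Arg2pi_eq_0[of "cis t"] by (auto simp: complex_nonneg_Reals_iff complex_is_Real_iff)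
        then show "cis t \<notin> B" using t arg[OF t'] by (simp add: B_def)
      qed
    qed
  qed
  then have "AE \<zeta> in circle_measure. \<zeta> \<notin> B"
    unfolding circle_measure_def using Bm
    by (subst AE_distr_iff) (auto intro!: AE_uniform_measureI simp: Compl_eq[symmetric])
  ultimately show ?thesis by (auto elim: eventually_mono)
qed

lemma AE_circle_norm: "AE \<zeta> in circle_measure. cmod \<zeta> = 1"
  by (rule AE_circleI[of "{}"]) auto

lemma integrable_circle_iff:
  fixes f :: "complex \<Rightarrow> 'a::{banach, second_countable_topology}"
  assumes [measurable]: "f \<in> borel_measurable borel"
  shows "integrable circle_measure f \<longleftrightarrow> set_integrable lborel {0..2*pi} (\<lambda>t. f (cis t))"
proof -
  have "(\<integral>\<^sup>+\<zeta>. norm (f \<zeta>) \<partial>circle_measure)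
      = (\<integral>\<^sup>+t. norm (indicator {0..2*pi} t *\<^sub>R f (cis t)) \<partial>lborel) / ennreal (2*pi)"
    by (subst nn_integral_circle)
      (auto simp: indicator_def intro!: arg_cong2[where f="(/)"] nn_integral_cong)
  then have "(\<integral>\<^sup>+\<zeta>. norm (f \<zeta>) \<partial>circle_measure) < \<infinity>
      \<longleftrightarrow> (\<integral>\<^sup>+t. norm (indicator {0..2*pi} t *\<^sub>R f (cis t)) \<partial>lborel) < \<infinity>"
    by (simp only: less_top[symmetric] infinity_ennreal_def) (simp add: ennreal_divide_eq_top_iff)
  then show ?thesis unfolding set_integrable_def integrable_iff_bounded by simp
qed

lemma integral_circle:
  fixes f :: "complex \<Rightarrow> 'a::{banach, second_countable_topology}"
  assumes [measurable]: "f \<in> borel_measurable borel"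
  shows "integral\<^sup>L circle_measure f = (1 / (2*pi)) *\<^sub>R (LINT t:{0..2*pi}|lborel. f (cis t))"
proof -
  have "integral\<^sup>L circle_measure f = (\<integral>t. f (cis t) \<partial>uniform_measure lborel {0..2*pi})"
    unfolding circle_measure_def by (rule integral_distr) simp_all
  also have "uniform_measure lborel {0..2*pi} = density lborel (\<lambda>t. ennreal (indicator {0..2*pi} t / (2*pi)))"
    unfolding uniform_measure_def
    by (intro density_cong) (auto simp: divide_ennreal split: split_indicator simp flip: ennreal_1)
  also have "(\<integral>t. f (cis t) \<partial>\<dots>) = (\<integral>t. (indicator {0..2*pi} t / (2*pi)) *\<^sub>R f (cis t) \<partial>lborel)"
    by (rule integral_density) auto
  also have "\<dots> = (\<integral>t. (1/(2*pi)) *\<^sub>R (indicator {0..2*pi} t *\<^sub>R f (cis t)) \<partial>lborel)"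
    by (intro Bochner_Integration.integral_cong) auto
  also have "\<dots> = (1/(2*pi)) *\<^sub>R (\<integral>t. indicator {0..2*pi} t *\<^sub>R f (cis t) \<partial>lborel)"
    by (rule integral_scaleR_right)
  finally show ?thesis by (simp only: set_lebesgue_integral_def)
qed

lemma integrable_circle_bounded:
  fixes f :: "complex \<Rightarrow> 'a::{banach, second_countable_topology}"
  assumes "f \<in> borel_measurable borel" "AE \<zeta> in circle_measure. norm (f \<zeta>) \<le> B"
  shows "integrable circle_measure f"
  by (rule circle.integrable_const_bound[of _ B]) (use assms in auto)

text \<open>Negative frequencies are written with \<open>cnj\<close>, the inverse on the circle, so
  that natural exponents suffice.\<close>

lemma integral_circle_power_cis:
  "(\<integral>\<zeta>. \<zeta> ^ n * cnj \<zeta> ^ m \<partial>circle_measure) = (if n = m then 1 else 0)"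
proof -
  have "(\<integral>\<zeta>. \<zeta> ^ n * cnj \<zeta> ^ m \<partial>circle_measure)
    = (1 / (2*pi)) *\<^sub>R (LINT t:{0..2*pi}|lborel. cis t ^ n * cnj (cis t) ^ m)"
    by (rule integral_circle) measurable
  also have "(\<lambda>t. cis t ^ n * cnj (cis t) ^ m) = (\<lambda>t. cis (real_of_int (int n - int m) * t))"
    by (auto simp: fun_eq_iff Complex.DeMoivre cis_cnj cis_mult algebra_simps)
  also have "(LINT t:{0..2*pi}|lborel. cis (real_of_int (int n - int m) * t)) = (if n = m then 2*pi else 0)"
  proof (cases "n = m")
    case True then show ?thesis by (simp add: set_lebesgue_integral_def scaleR_conv_of_real)
  next
    case False
    define k where "k = int n - int m"
    have k: "real_of_int k \<noteq> 0" using False by (auto simp: k_def)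
    define F where "F = (\<lambda>t. cis (real_of_int k * t) / (\<i> * of_int k))"
    have "(LINT t:{0..2*pi}|lborel. cis (real_of_int k * t)) = F (2*pi) - F 0"
      unfolding set_lebesgue_integral_def
    proof (rule integral_FTC_Icc)
      fix x :: real assume "0 \<le> x" "x \<le> 2*pi"
      show "(F has_vector_derivative cis (real_of_int k * x)) (at x within {0..2*pi})"
        unfolding F_def cis_conv_exp using k
        by (auto intro!: derivative_eq_intros has_vector_derivative_real_field simp: field_simps)
    qed (auto intro!: continuous_intros)
    also have "cis (real_of_int k * (2*pi)) = 1"
      using cis_multiple_2pi[of "of_int k"] by (simp add: mult_ac)
    then have "F (2*pi) - F 0 = 0" by (simp add: F_def)
    finally show ?thesis using False by (simp add: k_def)
  qed
  finally show ?thesis by (auto simp: scaleR_conv_of_real)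
qed

section \<open>Herglotz and Poisson integrals\<close>

lemma integrable_circle_mult_bounded:
  fixes w k :: "complex \<Rightarrow> complex"
  assumes k: "integrable circle_measure k" and w: "w \<in> borel_measurable borel"
    and b: "AE \<zeta> in circle_measure. norm (w \<zeta>) \<le> B"
  shows "integrable circle_measure (\<lambda>\<zeta>. w \<zeta> * k \<zeta>)"
proof (rule Bochner_Integration.integrable_bound)
  show "integrable circle_measure (\<lambda>\<zeta>. of_real B * k \<zeta>)" using k by simp
  have "k \<in> borel_measurable circle_measure" using k by (rule borel_measurable_integrable)
  then show "(\<lambda>\<zeta>. w \<zeta> * k \<zeta>) \<in> borel_measurable circle_measure" using w by simp
  show "AE \<zeta> in circle_measure. norm (w \<zeta> * k \<zeta>) \<le> norm (of_real B * k \<zeta>)"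
    using b by eventually_elim (auto simp: norm_mult intro!: mult_right_mono order_trans[OF _ abs_ge_self])
qed

definition herglotz :: "(complex \<Rightarrow> complex) \<Rightarrow> complex \<Rightarrow> complex" where
  "herglotz k z = (\<integral>\<zeta>. (\<zeta> + z) / (\<zeta> - z) * k \<zeta> \<partial>circle_measure)"

lemma herglotz_kernel_sums:
  fixes w :: complex
  assumes "cmod w < 1"
  shows "(\<lambda>n. (if n = 0 then 1 else 2) * w ^ n) sums ((1 + w) / (1 - w))"
proof -
  have "(\<lambda>n. 2 * w ^ n - (if n = 0 then 1 else 0)) sums (2 * (1 / (1 - w)) - 1)"
    by (intro sums_diff sums_mult geometric_sums assms) (use sums_single[of 0 "\<lambda>_. 1"] in simp)
  moreover have "w \<noteq> 1" using assms by auto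
  then have "2 * (1 / (1 - w)) - 1 = (1 + w) / (1 - w)" by (simp add: field_simps)
  moreover have "(\<lambda>n. 2 * w ^ n - (if n = 0 then 1 else 0)) = (\<lambda>n. (if n = 0 then 1 else 2) * w ^ n)"
    by auto
  ultimately show ?thesis by simp
qed

lemma herglotz_kernel_circle:
  assumes "cmod \<zeta> = 1"
  shows "(\<zeta> + z) / (\<zeta> - z) = (1 + z * cnj \<zeta>) / (1 - z * cnj \<zeta>)"
proof -
  have 1: "\<zeta> * cnj \<zeta> = 1" using assms by (simp add: complex_norm_square[symmetric])
  have "cnj \<zeta> \<noteq> 0" using assms by auto
  then have "(\<zeta> + z) / (\<zeta> - z) = (\<zeta> + z) * cnj \<zeta> / ((\<zeta> - z) * cnj \<zeta>)" by simp
  also have "\<dots> = (1 + z * cnj \<zeta>) / (1 - z * cnj \<zeta>)"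
    by (simp only: distrib_right left_diff_distrib 1)
  finally show ?thesis .
qed

text \<open>On the circle the kernel is (1 + w) / (1 - w) with w = z * cnj \<zeta>, a power series
  whose terms have modulus at most 2 * cmod z ^ n, so sum and integral may be exchanged. Holomorphy
  and the explicit values in \<open>poisson_power\<close> both come from this expansion.\<close>

lemma herglotz_sums:
  assumes k: "integrable circle_measure k" and z: "cmod z < 1"
  shows "(\<lambda>n. ((if n = 0 then 1 else 2) * (\<integral>\<zeta>. cnj \<zeta> ^ n * k \<zeta> \<partial>circle_measure)) * z ^ n)
    sums herglotz k z"
proof -
  define f where "f = (\<lambda>n \<zeta>. (if n = 0 then 1 else 2) * z ^ n * (cnj \<zeta> ^ n * k \<zeta>))"
  have i0: "integrable circle_measure (\<lambda>\<zeta>. cnj \<zeta> ^ n * k \<zeta>)" for n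
    by (rule integrable_circle_mult_bounded[OF k, of _ 1])
      (use AE_circle_norm in \<open>auto simp: norm_power elim!: eventually_mono\<close>)
  then have i: "integrable circle_measure (f n)" for n
    unfolding f_def by (intro integrable_mult_right)
  have nf: "AE \<zeta> in circle_measure. \<forall>n. norm (f n \<zeta>) = (if n = 0 then 1 else 2) * cmod z ^ n * norm (k \<zeta>)"
    using AE_circle_norm by eventually_elim (auto simp: f_def norm_mult norm_power)
  have geo: "summable (\<lambda>n. (if n = 0 then 1 else 2) * cmod z ^ n)"
    by (rule summable_comparison_test'[where g="\<lambda>n. 2 * cmod z ^ n" and N=0])
      (use z in \<open>auto simp: norm_power intro!: summable_mult summable_geometric\<close>)
  have 1: "AE \<zeta> in circle_measure. summable (\<lambda>n. norm (f n \<zeta>))"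
    using nf by eventually_elim (simp add: geo summable_mult2)
  have "(\<integral>\<zeta>. norm (f n \<zeta>) \<partial>circle_measure)
    = (if n = 0 then 1 else 2) * cmod z ^ n * (\<integral>\<zeta>. norm (k \<zeta>) \<partial>circle_measure)" for n
  proof -
    have "(\<integral>\<zeta>. norm (f n \<zeta>) \<partial>circle_measure) =
      (\<integral>\<zeta>. (if n = 0 then 1 else 2) * cmod z ^ n * norm (k \<zeta>) \<partial>circle_measure)"
      by (rule integral_cong_AE) (use i k nf in \<open>auto elim!: eventually_mono\<close>)
    then show ?thesis by simp
  qed
  then have 2: "summable (\<lambda>n. \<integral>\<zeta>. norm (f n \<zeta>) \<partial>circle_measure)"
    using geo by (simp add: summable_mult2)
  have "(\<lambda>n. integral\<^sup>L circle_measure (f n)) sums (\<integral>\<zeta>. (\<Sum>n. f n \<zeta>) \<partial>circle_measure)"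
    by (rule sums_integral[OF i 1 2])
  also have "(\<integral>\<zeta>. (\<Sum>n. f n \<zeta>) \<partial>circle_measure) = herglotz k z"
    unfolding herglotz_def
  proof (rule integral_cong_AE)
    show "(\<lambda>\<zeta>. (\<Sum>n. f n \<zeta>)) \<in> borel_measurable circle_measure" using i by measurable
    show "(\<lambda>\<zeta>. (\<zeta> + z) / (\<zeta> - z) * k \<zeta>) \<in> borel_measurable circle_measure"
      using k by measurable
    show "AE \<zeta> in circle_measure. (\<Sum>n. f n \<zeta>) = (\<zeta> + z) / (\<zeta> - z) * k \<zeta>"
      using AE_circle_norm
    proof eventually_elim
      fix \<zeta> :: complex assume "cmod \<zeta> = 1"
      then have "(\<lambda>n. (if n = 0 then 1 else 2) * (z * cnj \<zeta>) ^ n * k \<zeta>) sums ((\<zeta> + z) / (\<zeta> - z) * k \<zeta>)"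
        unfolding herglotz_kernel_circle[OF \<open>cmod \<zeta> = 1\<close>]
        by (intro sums_mult2 herglotz_kernel_sums) (use z in \<open>simp add: norm_mult\<close>)
      then show "(\<Sum>n. f n \<zeta>) = (\<zeta> + z) / (\<zeta> - z) * k \<zeta>"
        by (intro sums_unique[symmetric]) (simp add: f_def power_mult_distrib mult.assoc)
    qed
  qed
  also have "(\<lambda>n. integral\<^sup>L circle_measure (f n)) =
    (\<lambda>n. ((if n = 0 then 1 else 2) * (\<integral>\<zeta>. cnj \<zeta> ^ n * k \<zeta> \<partial>circle_measure)) * z ^ n)"
    unfolding f_def integral_mult_right_zero by (simp only: ac_simps)
  finally show ?thesis .
qed

lemma herglotz_holomorphic:
  assumes "integrable circle_measure k"
  shows "herglotz k holomorphic_on ball 0 1"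
  by (rule power_series_holomorphic) (use herglotz_sums[OF assms] in auto)

section \<open>The Poisson kernel as the real part of the Herglotz kernel\<close>

definition poisson :: "complex \<Rightarrow> complex \<Rightarrow> real" where
  "poisson z \<zeta> = (1 - (cmod z)\<^sup>2) / (cmod (\<zeta> - z))\<^sup>2"

lemma poisson_measurable [measurable]: "poisson z \<in> borel_measurable borel"
  unfolding poisson_def by measurable

lemma poisson_nonneg: "cmod z < 1 \<Longrightarrow> 0 \<le> poisson z \<zeta>"
  unfolding poisson_def by (simp add: abs_square_le_1)

lemma Re_herglotz_kernel:
  assumes "cmod \<zeta> = 1"
  shows "Re ((\<zeta> + z) / (\<zeta> - z)) = poisson z \<zeta>"
proof -
  have "Re ((\<zeta> + z) / (\<zeta> - z)) = Re ((\<zeta> + z) * cnj (\<zeta> - z)) / (cmod (\<zeta> - z))\<^sup>2"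
    by (subst complex_div_cnj) (simp only: Re_divide_of_real flip: of_real_power)
  also have "Re ((\<zeta> + z) * cnj (\<zeta> - z)) = (cmod \<zeta>)\<^sup>2 - (cmod z)\<^sup>2"
    unfolding cmod_power2 by (simp add: power2_eq_square algebra_simps)
  finally show ?thesis using assms by (simp add: poisson_def)
qed

lemma poisson_le:
  assumes "cmod z < 1" "cmod \<zeta> = 1"
  shows "poisson z \<zeta> \<le> 2 / (1 - cmod z)"
proof -
  define d where "d = 1 - cmod z"
  have d: "d > 0" "d \<le> cmod (\<zeta> - z)"
    using assms norm_triangle_ineq2[of \<zeta> z] by (auto simp: d_def)
  have "1 - (cmod z)\<^sup>2 = d * (1 + cmod z)" by (simp add: d_def power2_eq_square algebra_simps)
  also have "\<dots> \<le> d * 2" using assms d by (intro mult_left_mono) auto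
  finally have "poisson z \<zeta> \<le> (d * 2) / d\<^sup>2"
    unfolding poisson_def using d by (intro frac_le) auto
  then show ?thesis using d by (simp add: power2_eq_square d_def[symmetric])
qed

lemma integrable_poisson_mult:
  fixes k :: "complex \<Rightarrow> complex"
  assumes k: "integrable circle_measure k" and z: "cmod z < 1"
  shows "integrable circle_measure (\<lambda>\<zeta>. poisson z \<zeta> * k \<zeta>)"
  by (rule integrable_circle_mult_bounded[OF k, of _ "2 / (1 - cmod z)"])
    (use AE_circle_norm poisson_le[OF z] poisson_nonneg[OF z] in \<open>auto elim!: eventually_mono\<close>)

lemma integrable_poisson_mult_real:
  fixes k :: "complex \<Rightarrow> real"
  assumes k: "integrable circle_measure k" and z: "cmod z < 1"
  shows "integrable circle_measure (\<lambda>\<zeta>. poisson z \<zeta> * k \<zeta>)"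
  using integrable_Re[OF integrable_poisson_mult[OF integrable_of_real[OF k] z]] by simp

lemma integrable_herglotz_mult:
  assumes k: "integrable circle_measure k" and z: "cmod z < 1"
  shows "integrable circle_measure (\<lambda>\<zeta>. (\<zeta> + z) / (\<zeta> - z) * k \<zeta>)"
proof (rule integrable_circle_mult_bounded[OF k, of _ "2 / (1 - cmod z)"])
  show "AE \<zeta> in circle_measure. norm ((\<zeta> + z) / (\<zeta> - z)) \<le> 2 / (1 - cmod z)"
    using AE_circle_norm
  proof eventually_elim
    fix \<zeta> :: complex assume "cmod \<zeta> = 1"
    then show "norm ((\<zeta> + z) / (\<zeta> - z)) \<le> 2 / (1 - cmod z)"
      unfolding norm_divide using z norm_triangle_ineq[of \<zeta> z] norm_triangle_ineq2[of \<zeta> z]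
      by (intro frac_le) auto
  qed
qed simp

lemma Re_herglotz:
  fixes k :: "complex \<Rightarrow> real"
  assumes k: "integrable circle_measure k" and z: "cmod z < 1"
  shows "Re (herglotz (\<lambda>\<zeta>. of_real (k \<zeta>)) z) = (\<integral>\<zeta>. poisson z \<zeta> * k \<zeta> \<partial>circle_measure)"
proof -
  have i: "integrable circle_measure (\<lambda>\<zeta>. (\<zeta> + z) / (\<zeta> - z) * complex_of_real (k \<zeta>))"
    by (rule integrable_herglotz_mult[OF integrable_of_real[OF k] z])
  have "Re (herglotz (\<lambda>\<zeta>. of_real (k \<zeta>)) z)
      = (\<integral>\<zeta>. Re ((\<zeta> + z) / (\<zeta> - z) * complex_of_real (k \<zeta>)) \<partial>circle_measure)"
    unfolding herglotz_def by (rule integral_Re[OF i, symmetric])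
  also have "\<dots> = (\<integral>\<zeta>. poisson z \<zeta> * k \<zeta> \<partial>circle_measure)"
  proof (rule integral_cong_AE)
    have *: "Re (w * complex_of_real r) = Re w * r" for w r by simp
    show "AE \<zeta> in circle_measure.
        Re ((\<zeta> + z) / (\<zeta> - z) * complex_of_real (k \<zeta>)) = poisson z \<zeta> * k \<zeta>"
      using AE_circle_norm by eventually_elim (simp only: * Re_herglotz_kernel)
  qed (use i integrable_poisson_mult_real[OF k z] in measurable)
  finally show ?thesis .
qed

lemma integrable_circle_power [simp]:
  "integrable circle_measure (\<lambda>\<zeta>. \<zeta> ^ n)" "integrable circle_measure (\<lambda>\<zeta>. cnj \<zeta> ^ n)"
  by (rule integrable_circle_bounded[of _ 1], simp, use AE_circle_norm in \<open>auto simp: norm_power elim!: eventually_mono\<close>)+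

text \<open>The kernel is half the sum of the Herglotz kernel and its conjugate, so the integral is
  the mean of the Herglotz integral of \<zeta> ^ n and the conjugate of that of cnj \<zeta> ^ n. By
  orthogonality these are 2 * z ^ n and 0 for n > 0, and both 1 for n = 0.\<close>

lemma poisson_power:
  assumes z: "cmod z < 1"
  shows "(\<integral>\<zeta>. poisson z \<zeta> * \<zeta> ^ n \<partial>circle_measure) = z ^ n"
proof -
  have 1: "herglotz (\<lambda>\<zeta>. \<zeta> ^ n) z = (if n = 0 then 1 else 2) * z ^ n"
  proof -
    have "(\<lambda>m. ((if m = 0 then 1 else 2) * (\<integral>\<zeta>. cnj \<zeta> ^ m * \<zeta> ^ n \<partial>circle_measure)) * z ^ m)
      = (\<lambda>m. if m = n then (if n = 0 then 1 else 2) * z ^ n else 0)"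
      by (auto simp: integral_circle_power_cis mult.commute[of "cnj _ ^ _"])
    note e = this
    show ?thesis
      using herglotz_sums[OF integrable_circle_power(1)[of n] z] unfolding e
      by (rule sums_unique2[OF _ sums_single])
  qed
  have 2: "herglotz (\<lambda>\<zeta>. cnj \<zeta> ^ n) z = (if n = 0 then 1 else 0)"
  proof -
    have "(\<integral>\<zeta>. cnj \<zeta> ^ m * cnj \<zeta> ^ n \<partial>circle_measure) = (if m = 0 \<and> n = 0 then 1 else 0)" for m
      using integral_circle_power_cis[of 0 "m + n"] by (auto simp: power_add)
    then have "(\<lambda>m. ((if m = 0 then 1 else 2) * (\<integral>\<zeta>. cnj \<zeta> ^ m * cnj \<zeta> ^ n \<partial>circle_measure)) * z ^ m)
      = (\<lambda>m. if m = 0 then (if n = 0 then 1 else 0) else 0)"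
      by (simp add: fun_eq_iff)
    note e = this
    show ?thesis
      using herglotz_sums[OF integrable_circle_power(2)[of n] z] unfolding e
      by (rule sums_unique2[OF _ sums_single])
  qed
  have i1: "integrable circle_measure (\<lambda>\<zeta>. (\<zeta> + z) / (\<zeta> - z) * \<zeta> ^ n)"
    by (rule integrable_herglotz_mult[OF _ z]) simp
  have i2: "integrable circle_measure (\<lambda>\<zeta>. (\<zeta> + z) / (\<zeta> - z) * cnj \<zeta> ^ n)"
    by (rule integrable_herglotz_mult[OF _ z]) simp
  have "(\<integral>\<zeta>. poisson z \<zeta> * \<zeta> ^ n \<partial>circle_measure)
    = (\<integral>\<zeta>. ((\<zeta> + z) / (\<zeta> - z) * \<zeta> ^ n + cnj ((\<zeta> + z) / (\<zeta> - z) * cnj \<zeta> ^ n)) / 2 \<partial>circle_measure)"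
  proof (rule integral_cong_AE)
    show "AE \<zeta> in circle_measure. poisson z \<zeta> * \<zeta> ^ n
      = ((\<zeta> + z) / (\<zeta> - z) * \<zeta> ^ n + cnj ((\<zeta> + z) / (\<zeta> - z) * cnj \<zeta> ^ n)) / 2"
      using AE_circle_norm
    proof eventually_elim
      fix \<zeta> :: complex assume "cmod \<zeta> = 1"
      define w where "w = (\<zeta> + z) / (\<zeta> - z)"
      have "complex_of_real (poisson z \<zeta>) = (w + cnj w) / 2"
        unfolding Re_herglotz_kernel[OF \<open>cmod \<zeta> = 1\<close>, symmetric] w_def[symmetric]
        by (simp add: complex_add_cnj)
      then show "poisson z \<zeta> * \<zeta> ^ n = ((\<zeta> + z) / (\<zeta> - z) * \<zeta> ^ n + cnj ((\<zeta> + z) / (\<zeta> - z) * cnj \<zeta> ^ n)) / 2"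
        unfolding w_def[symmetric]
        by (simp only: complex_cnj_mult complex_cnj_power complex_cnj_cnj times_divide_eq_left distrib_right)
    qed
  qed (use i1 i2 in measurable)
  also have "\<dots> = (herglotz (\<lambda>\<zeta>. \<zeta> ^ n) z + cnj (herglotz (\<lambda>\<zeta>. cnj \<zeta> ^ n) z)) / 2"
    using i1 i2 unfolding herglotz_def
    by (simp only: integral_divide_zero Bochner_Integration.integral_cnj integrable_cnj Bochner_Integration.integral_add)
  finally show ?thesis unfolding 1 2 by (cases "n = 0") simp_all
qed

lemma poisson_integral_1:
  assumes "cmod z < 1"
  shows "(\<integral>\<zeta>. poisson z \<zeta> \<partial>circle_measure) = 1" "integrable circle_measure (poisson z)"
proof -
  have "complex_of_real (\<integral>\<zeta>. poisson z \<zeta> \<partial>circle_measure) = 1"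
    using poisson_power[OF assms, of 0] by simp
  then show "(\<integral>\<zeta>. poisson z \<zeta> \<partial>circle_measure) = 1" by (simp only: of_real_eq_1_iff)
  show "integrable circle_measure (poisson z)"
    using integrable_poisson_mult_real[of "\<lambda>_. 1", OF _ assms] by simp
qed

section \<open>Non-tangential limits of Poisson integrals\<close>

text \<open>
  The kernel \<open>d / (max d \<bar>s - x\<bar>)\<^sup>2\<close> is dominated by \<open>\<Sum>j. 4 / (4 ^ j * d)\<close> times the
  indicator of \<open>\<bar>s - x\<bar> \<le> 2 ^ j * d\<close>, so small averages of \<open>w\<close> give a small integral.
\<close>

lemma nn_integral_dyadic_kernel_le:
  fixes w :: "real \<Rightarrow> real" and x d \<delta> \<epsilon> :: real
  assumes [measurable]: "w \<in> borel_measurable borel" and w: "\<And>s. 0 \<le> w s"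
    and pos: "0 < d" "0 < \<delta>" "0 \<le> \<epsilon>"
    and avg: "\<And>h. 0 < h \<Longrightarrow> h \<le> \<delta> \<Longrightarrow> (\<integral>\<^sup>+s\<in>{x-h..x+h}. ennreal (w s) \<partial>lborel) \<le> ennreal (\<epsilon> * h)"
  shows "(\<integral>\<^sup>+s\<in>{x-\<delta>..x+\<delta>}. ennreal (d / (max d \<bar>s - x\<bar>)\<^sup>2 * w s) \<partial>lborel) \<le> ennreal (8 * \<epsilon>)"
proof -
  obtain J where J: "\<delta> / d < 2 ^ J" using real_arch_pow[of 2 "\<delta> / d"] by auto
  \<comment> \<open>Capping the radii at \<delta> keeps them in the range of \<open>avg\<close>;
    \<open>J\<close> is large enough for the uncapped ones to cover the interval.\<close>
  define h where "h = (\<lambda>j::nat. min \<delta> (2 ^ j * d))"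
  define c where "c = (\<lambda>j::nat. 4 / (4 ^ j * d))"
  have h: "0 < h j" "h j \<le> \<delta>" "h j \<le> 2 ^ j * d" for j using pos by (auto simp: h_def)
  have c: "0 \<le> c j" for j using pos by (simp add: c_def)
  have K: "ennreal (d / (max d \<bar>s - x\<bar>)\<^sup>2 * w s) * indicator {x-\<delta>..x+\<delta>} s
    \<le> (\<Sum>j\<le>J. ennreal (c j) * (ennreal (w s) * indicator {x-h j..x+h j} s))" for s
  proof (cases "s \<in> {x-\<delta>..x+\<delta>}")
    case True
    then have s: "\<bar>s - x\<bar> \<le> \<delta>" by auto
    have ex: "\<bar>s - x\<bar> \<le> 2 ^ J * d" using s J pos by (simp add: field_simps)
    define j where "j = (LEAST j. \<bar>s - x\<bar> \<le> 2 ^ j * d)"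
    have j: "\<bar>s - x\<bar> \<le> 2 ^ j * d" "j \<le> J"
      unfolding j_def using ex by (auto intro: LeastI Least_le)
    have "d / (max d \<bar>s - x\<bar>)\<^sup>2 \<le> c j"
    proof (cases j)
      case 0
      then have "max d \<bar>s - x\<bar> = d" using j by simp
      then show ?thesis using 0 pos by (simp add: c_def power2_eq_square divide_right_mono)
    next
      case (Suc i)
      then have "2 ^ i * d < \<bar>s - x\<bar>" using not_less_Least[of i "\<lambda>j. \<bar>s - x\<bar> \<le> 2 ^ j * d"] j_def by simp
      then have "(2 ^ i * d)\<^sup>2 \<le> (max d \<bar>s - x\<bar>)\<^sup>2" using pos by (intro power_mono) auto
      then have "d / (max d \<bar>s - x\<bar>)\<^sup>2 \<le> d / (2 ^ i * d)\<^sup>2" using pos by (intro divide_left_mono) auto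
      also have "\<dots> = c j" using pos Suc by (simp add: c_def power_mult_distrib power2_eq_square flip: power_mult_distrib)
      finally show ?thesis .
    qed
    then have "ennreal (d / (max d \<bar>s - x\<bar>)\<^sup>2 * w s) \<le> ennreal (c j) * (ennreal (w s) * indicator {x-h j..x+h j} s)"
    proof -
      have "s \<in> {x-h j..x+h j}" using j s by (auto simp: h_def)
      moreover have "d / (max d \<bar>s - x\<bar>)\<^sup>2 * w s \<le> c j * w s"
        using \<open>d / _ \<le> c j\<close> w by (rule mult_right_mono)
      ultimately show ?thesis using w[of s] c[of j] by (simp add: ennreal_leI flip: ennreal_mult)
    qed
    also have "\<dots> \<le> (\<Sum>j\<le>J. ennreal (c j) * (ennreal (w s) * indicator {x-h j..x+h j} s))"
      using j by (intro member_le_sum) auto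
    finally show ?thesis using True by simp
  qed simp
  have "(\<integral>\<^sup>+s\<in>{x-\<delta>..x+\<delta>}. ennreal (d / (max d \<bar>s - x\<bar>)\<^sup>2 * w s) \<partial>lborel)
      \<le> (\<integral>\<^sup>+s. (\<Sum>j\<le>J. ennreal (c j) * (ennreal (w s) * indicator {x-h j..x+h j} s)) \<partial>lborel)"
    by (intro nn_integral_mono K)
  also have "\<dots> = (\<Sum>j\<le>J. ennreal (c j) * (\<integral>\<^sup>+s\<in>{x-h j..x+h j}. ennreal (w s) \<partial>lborel))"
    by (simp add: nn_integral_sum nn_integral_cmult)
  also have "\<dots> \<le> (\<Sum>j\<le>J. ennreal (c j) * ennreal (\<epsilon> * h j))"
    using h by (intro sum_mono mult_left_mono avg) auto
  also have "\<dots> = ennreal (\<Sum>j\<le>J. c j * (\<epsilon> * h j))"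
    using c h pos by (subst sum_ennreal[symmetric]) (auto simp: ennreal_mult less_imp_le)
  \<comment> \<open>c j decays like 4 ^ - j while h j grows at most like 2 ^ j, which leaves a
    geometric series of ratio 1/2. Its sum 2 gives the constant 8 = 4 * 2.\<close>
  also have "(\<Sum>j\<le>J. c j * (\<epsilon> * h j)) \<le> (\<Sum>j\<le>J. 4 * \<epsilon> * (1/2) ^ j)"
  proof (rule sum_mono)
    fix j
    have "c j * (\<epsilon> * h j) \<le> c j * (\<epsilon> * (2 ^ j * d))" using h c pos by (intro mult_left_mono) auto
    also have "\<dots> = 4 * \<epsilon> * (2 ^ j / 4 ^ j)" using pos by (simp add: c_def)
    also have "2 ^ j / 4 ^ j = (1/2::real) ^ j" by (simp flip: power_divide)
    finally show "c j * (\<epsilon> * h j) \<le> 4 * \<epsilon> * (1/2) ^ j" .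
  qed
  also have "\<dots> = 4 * \<epsilon> * (\<Sum>j\<le>J. (1/2) ^ j)" by (simp add: sum_distrib_left)
  also have "\<dots> \<le> 4 * \<epsilon> * 2"
  proof (intro mult_left_mono)
    have "(\<Sum>j\<le>J. (1/2::real) ^ j) \<le> (\<Sum>j. (1/2) ^ j)" by (intro sum_le_suminf) auto
    then show "(\<Sum>j\<le>J. (1/2::real) ^ j) \<le> 2" by (simp add: suminf_geometric)
  qed (use pos in auto)
  finally show ?thesis by (simp add: ennreal_leI mult.commute)
qed

section \<open>Lebesgue points on the circle\<close>

text \<open>The average is multiplied out and the integral is a nonnegative one, so that the
  condition is literally the hypothesis on averages in
  \<open>nn_integral_dyadic_kernel_le\<close>.\<close>

definition lebesgue_point :: "(complex \<Rightarrow> complex) \<Rightarrow> real \<Rightarrow> bool" where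
  "lebesgue_point k t \<longleftrightarrow> (\<forall>\<epsilon>>0. \<exists>\<delta>>0. \<forall>h. 0 < h \<longrightarrow> h \<le> \<delta> \<longrightarrow>
     (\<integral>\<^sup>+s\<in>{t-h..t+h}. ennreal (norm (k (cis s) - k (cis t))) \<partial>lborel) \<le> ennreal (\<epsilon> * h))"

text \<open>\<open>integrable_ccontinuous_explicit\<close> concerns gauge integrals over boxes with
  lower corner x, hence averages to the right of x. Its upper half is transferred to nonnegative
  Lebesgue integrals.\<close>

lemma averages_right_negligible:
  fixes f :: "real \<Rightarrow> real"
  assumes f: "integrable lborel f" and nn: "\<And>x. 0 \<le> f x"
  obtains N where "negligible N"
    "\<And>x e. x \<notin> N \<Longrightarrow> 0 < e \<Longrightarrow> \<exists>d>0. \<forall>h. 0 < h \<longrightarrow> h < d \<longrightarrow>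
       (\<integral>\<^sup>+s\<in>{x..x+h}. ennreal (f s) \<partial>lborel) \<le> ennreal ((f x + e) * h)"
proof -
  have si: "set_integrable lborel {a..b} f" for a b
    unfolding set_integrable_def using f by (intro integrable_mult_indicator) auto
  have "f integrable_on cbox a b" for a b
    using set_borel_integral_eq_integral(1)[OF si] by simp
  from integrable_ccontinuous_explicit[OF this] obtain N where N: "negligible N"
    "\<And>x e. \<lbrakk>x \<notin> N; 0 < e\<rbrakk> \<Longrightarrow> \<exists>d>0. \<forall>h. 0 < h \<and> h < d \<longrightarrow>
         norm(integral (cbox x (x + h *\<^sub>R One)) f /\<^sub>R h ^ DIM(real) - f x) < e"
    by metis
  show ?thesis
  proof (rule that[OF N(1)])
    fix x e :: real assume "x \<notin> N" "0 < e"
    from N(2)[OF this] obtain d where d: "d > 0"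
      "\<And>h. 0 < h \<Longrightarrow> h < d \<Longrightarrow> \<bar>integral {x..x+h} f / h - f x\<bar> < e"
      by (auto simp: divide_inverse mult.commute)
    show "\<exists>d>0. \<forall>h. 0 < h \<longrightarrow> h < d \<longrightarrow>
       (\<integral>\<^sup>+s\<in>{x..x+h}. ennreal (f s) \<partial>lborel) \<le> ennreal ((f x + e) * h)"
    proof (intro exI[of _ d] conjI allI impI)
      fix h assume h: "0 < h" "h < d"
      have "(\<integral>\<^sup>+s\<in>{x..x+h}. ennreal (f s) \<partial>lborel) = (\<integral>\<^sup>+s. ennreal (indicator {x..x+h} s *\<^sub>R f s) \<partial>lborel)"
        by (intro nn_integral_cong) (auto simp: indicator_def)
      also have "\<dots> = ennreal (LINT s:{x..x+h}|lborel. f s)"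
        unfolding set_lebesgue_integral_def using si[of x "x+h"] nn
        by (intro nn_integral_eq_integral) (auto simp: set_integrable_def)
      also have "(LINT s:{x..x+h}|lborel. f s) = integral {x..x+h} f"
        by (rule set_borel_integral_eq_integral(2)[OF si])
      also have "integral {x..x+h} f / h \<le> f x + e" using d(2)[OF h] by auto
      then have "integral {x..x+h} f \<le> (f x + e) * h" using h by (simp add: field_simps)
      finally show "(\<integral>\<^sup>+s\<in>{x..x+h}. ennreal (f s) \<partial>lborel) \<le> ennreal ((f x + e) * h)"
        by (simp add: ennreal_leI)
    qed (use d in auto)
  qed
qed

text \<open>The left half of the interval is a right half for the reflected function, whose
  exceptional set is reflected back.\<close>

lemma averages_negligible:
  fixes f :: "real \<Rightarrow> real"
  assumes f: "integrable lborel f" and nn: "\<And>x. 0 \<le> f x"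
  shows "\<exists>N. negligible N \<and> (\<forall>x e. x \<notin> N \<longrightarrow> 0 < e \<longrightarrow> (\<exists>d>0. \<forall>h. 0 < h \<longrightarrow> h < d \<longrightarrow>
       (\<integral>\<^sup>+s\<in>{x-h..x+h}. ennreal (f s) \<partial>lborel) \<le> ennreal (2 * (f x + e) * h)))"
proof -
  have [measurable]: "f \<in> borel_measurable borel" using f by auto
  obtain N1 where N1: "negligible N1"
    "\<And>x e. x \<notin> N1 \<Longrightarrow> 0 < e \<Longrightarrow> \<exists>d>0. \<forall>h. 0 < h \<longrightarrow> h < d \<longrightarrow>
       (\<integral>\<^sup>+s\<in>{x..x+h}. ennreal (f s) \<partial>lborel) \<le> ennreal ((f x + e) * h)"
    using averages_right_negligible[OF f nn] by blast
  have f': "integrable lborel (\<lambda>x. f (- x))"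
    using lborel_integrable_real_affine[OF f, of "-1" 0] by simp
  obtain N2 where N2: "negligible N2"
    "\<And>x e. x \<notin> N2 \<Longrightarrow> 0 < e \<Longrightarrow> \<exists>d>0. \<forall>h. 0 < h \<longrightarrow> h < d \<longrightarrow>
       (\<integral>\<^sup>+s\<in>{x..x+h}. ennreal (f (- s)) \<partial>lborel) \<le> ennreal ((f (- x) + e) * h)"
    using averages_right_negligible[OF f' nn] by blast
  have "negligible (N1 \<union> uminus ` N2)"
    using N1(1) negligible_differentiable_image_negligible[OF order_refl N2(1), of uminus]
    by (auto simp: differentiable_on_def)
  moreover have "\<exists>d>0. \<forall>h. 0 < h \<longrightarrow> h < d \<longrightarrow>
       (\<integral>\<^sup>+s\<in>{x-h..x+h}. ennreal (f s) \<partial>lborel) \<le> ennreal (2 * (f x + e) * h)"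
    if x: "x \<notin> N1 \<union> uminus ` N2" and e: "0 < e" for x e
  proof -
    have "- x \<notin> N2" using x by force
    with N2(2)[OF this e] obtain d2 where d2: "d2 > 0" "\<And>h. 0 < h \<Longrightarrow> h < d2 \<Longrightarrow>
       (\<integral>\<^sup>+s\<in>{-x..-x+h}. ennreal (f (- s)) \<partial>lborel) \<le> ennreal ((f x + e) * h)" by auto
    obtain d1 where d1: "d1 > 0" "\<And>h. 0 < h \<Longrightarrow> h < d1 \<Longrightarrow>
       (\<integral>\<^sup>+s\<in>{x..x+h}. ennreal (f s) \<partial>lborel) \<le> ennreal ((f x + e) * h)" using N1(2)[of x e] x e by auto
    show ?thesis
    proof (intro exI[of _ "min d1 d2"] conjI allI impI)
      fix h assume h: "0 < h" "h < min d1 d2"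
      have "(\<integral>\<^sup>+s\<in>{x-h..x+h}. ennreal (f s) \<partial>lborel)
        \<le> (\<integral>\<^sup>+s. ennreal (f s) * indicator {x-h..x} s + ennreal (f s) * indicator {x..x+h} s \<partial>lborel)"
        by (intro nn_integral_mono) (auto simp: indicator_def)
      also have "\<dots> = (\<integral>\<^sup>+s\<in>{x-h..x}. ennreal (f s) \<partial>lborel) + (\<integral>\<^sup>+s\<in>{x..x+h}. ennreal (f s) \<partial>lborel)"
        by (rule nn_integral_add) auto
      also have "(\<integral>\<^sup>+s\<in>{x-h..x}. ennreal (f s) \<partial>lborel)
        = (\<integral>\<^sup>+s. ennreal (f (- s)) * indicator {x-h..x} (- s) \<partial>lborel)"
        using nn_integral_real_affine[of "\<lambda>s. ennreal (f s) * indicator {x-h..x} s" "-1" 0] by simp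
      also have "\<dots> = (\<integral>\<^sup>+s\<in>{-x..-x+h}. ennreal (f (- s)) \<partial>lborel)"
        by (intro nn_integral_cong) (auto simp: indicator_def)
      also have "\<dots> \<le> ennreal ((f x + e) * h)" using d2 h by auto
      also have "(\<integral>\<^sup>+s\<in>{x..x+h}. ennreal (f s) \<partial>lborel) \<le> ennreal ((f x + e) * h)" using d1 h by auto
      also have "ennreal ((f x + e) * h) + ennreal ((f x + e) * h) = ennreal (2 * (f x + e) * h)"
        using nn[of x] e h by (subst ennreal_plus[symmetric]) auto
      finally show "(\<integral>\<^sup>+s\<in>{x-h..x+h}. ennreal (f s) \<partial>lborel) \<le> ennreal (2 * (f x + e) * h)"
        by (simp add: add_mono)
    qed (use d1 d2 in auto)
  qed
  ultimately show ?thesis by blast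
qed

text \<open>Applying the averages lemma to the distance from k (cis t) would give a null set
  depending on t. Instead the distances from the points q of a countable dense set are used, with
  the union of their null sets; q is then chosen close to k (cis t).\<close>

lemma lebesgue_points_circle:
  fixes k :: "complex \<Rightarrow> complex"
  assumes k: "integrable circle_measure k"
  shows "\<exists>N. negligible N \<and> (\<forall>t\<in>{0<..<2*pi} - N. lebesgue_point k t)"
proof -
  have km [measurable]: "k \<in> borel_measurable borel"
    using borel_measurable_integrable[OF k] by simp
  obtain D :: "complex set" where D: "countable D" "\<And>X. open X \<Longrightarrow> X \<noteq> {} \<Longrightarrow> \<exists>d\<in>D. d \<in> X"
    using countable_dense_setE by metis
  define f where "f = (\<lambda>q s. indicator {0..2*pi} s * norm (k (cis s) - q))"
  have nn: "f q s \<ge> 0" for q s by (simp add: f_def)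
  have "integrable lborel (f q)" for q
  proof -
    have "integrable circle_measure (\<lambda>\<zeta>. norm (k \<zeta> - q))" using k by simp
    then show ?thesis by (subst (asm) integrable_circle_iff) (auto simp: set_integrable_def f_def)
  qed
  then have "\<forall>q. \<exists>N. negligible N \<and> (\<forall>x e. x \<notin> N \<longrightarrow> 0 < e \<longrightarrow> (\<exists>d>0. \<forall>h. 0 < h \<longrightarrow> h < d \<longrightarrow>
       (\<integral>\<^sup>+s\<in>{x-h..x+h}. ennreal (f q s) \<partial>lborel) \<le> ennreal (2 * (f q x + e) * h)))"
    using nn by (intro allI averages_negligible)
  from choice[OF this] obtain N where N: "\<And>q. negligible (N q)"
    "\<And>q x e. x \<notin> N q \<Longrightarrow> 0 < e \<Longrightarrow> \<exists>d>0. \<forall>h. 0 < h \<longrightarrow> h < d \<longrightarrow>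
       (\<integral>\<^sup>+s\<in>{x-h..x+h}. ennreal (f q s) \<partial>lborel) \<le> ennreal (2 * (f q x + e) * h)"
    by blast
  have "negligible (\<Union>q\<in>D. N q)"
    using D(1) N(1) by (intro negligible_countable_Union) auto
  moreover have "lebesgue_point k t" if t: "t \<in> {0<..<2*pi}" "t \<notin> (\<Union>q\<in>D. N q)" for t
    unfolding lebesgue_point_def
  proof (intro allI impI)
    fix \<epsilon> :: real assume \<epsilon>: "\<epsilon> > 0"
    \<comment> \<open>The averages of f q contribute at most 2 * (\<epsilon>/8 + \<epsilon>/8) * h
      and the replacement of k (cis t) by q another \<epsilon>/8 * 2 * h, together 3/4 * \<epsilon>
      * h.\<close>
    obtain q where q: "q \<in> D" "dist (k (cis t)) q < \<epsilon> / 8"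
      using D(2)[of "ball (k (cis t)) (\<epsilon>/8)"] \<epsilon> by auto
    obtain d where d: "d > 0" "\<And>h. 0 < h \<Longrightarrow> h < d \<Longrightarrow>
       (\<integral>\<^sup>+s\<in>{t-h..t+h}. ennreal (f q s) \<partial>lborel) \<le> ennreal (2 * (f q t + \<epsilon>/8) * h)"
      using N(2)[of t q "\<epsilon>/8"] t q \<epsilon> by auto
    \<comment> \<open>The last two bounds keep the interval inside [0, 2*pi], where the indicator in
      \<open>f\<close> is 1.\<close>
    define \<delta> where "\<delta> = min (d/2) (min (t/2) (pi - t/2))"
    have \<delta>: "0 < \<delta>" "\<delta> < d" "{t-\<delta>..t+\<delta>} \<subseteq> {0..2*pi}" using d t unfolding \<delta>_def by auto
    show "\<exists>\<delta>>0. \<forall>h. 0 < h \<longrightarrow> h \<le> \<delta> \<longrightarrow>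
     (\<integral>\<^sup>+s\<in>{t-h..t+h}. ennreal (norm (k (cis s) - k (cis t))) \<partial>lborel) \<le> ennreal (\<epsilon> * h)"
    proof (intro exI[of _ \<delta>] conjI allI impI)
      fix h assume h: "0 < h" "h \<le> \<delta>"
      have "(\<integral>\<^sup>+s\<in>{t-h..t+h}. ennreal (norm (k (cis s) - k (cis t))) \<partial>lborel)
        \<le> (\<integral>\<^sup>+s. ennreal (f q s) * indicator {t-h..t+h} s + ennreal (\<epsilon>/8) * indicator {t-h..t+h} s \<partial>lborel)"
      proof (rule nn_integral_mono)
        fix s
        have "norm (k (cis s) - k (cis t)) \<le> f q s + \<epsilon>/8" if "s \<in> {t-h..t+h}"
        proof -
          have "s \<in> {0..2*pi}" using that h \<delta> by fastforce
          then have "f q s = dist (k (cis s)) q" by (simp add: f_def dist_norm)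
          then show ?thesis using q(2) dist_triangle2[of "k (cis s)" "k (cis t)" q] by (simp add: dist_norm)
        qed
        then show "ennreal (norm (k (cis s) - k (cis t))) * indicator {t-h..t+h} s \<le>
          ennreal (f q s) * indicator {t-h..t+h} s + ennreal (\<epsilon>/8) * indicator {t-h..t+h} s"
          using nn[of q s] \<epsilon> by (auto simp: indicator_def simp flip: ennreal_plus intro!: ennreal_leI)
      qed
      also have "\<dots> = (\<integral>\<^sup>+s\<in>{t-h..t+h}. ennreal (f q s) \<partial>lborel) + ennreal (\<epsilon>/8) * ennreal (2 * h)"
        unfolding f_def using h by (subst nn_integral_add) (auto simp: nn_integral_cmult_indicator)
      also have "(\<integral>\<^sup>+s\<in>{t-h..t+h}. ennreal (f q s) \<partial>lborel) \<le> ennreal (2 * (f q t + \<epsilon>/8) * h)"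
        using d h \<delta> by auto
      also have "\<dots> \<le> ennreal (2 * (\<epsilon>/8 + \<epsilon>/8) * h)"
      proof -
        have "f q t \<le> \<epsilon>/8" using q t by (simp add: f_def dist_norm)
        then show ?thesis using h by (intro ennreal_leI mult_right_mono mult_left_mono) auto
      qed
      also have "ennreal (2 * (\<epsilon>/8 + \<epsilon>/8) * h) + ennreal (\<epsilon>/8) * ennreal (2 * h) = ennreal (3/4 * \<epsilon> * h)"
        using \<epsilon> h by (simp add: field_simps flip: ennreal_mult ennreal_plus)
      also have "\<dots> \<le> ennreal (\<epsilon> * h)" using \<epsilon> h by (intro ennreal_leI) auto
      finally show "(\<integral>\<^sup>+s\<in>{t-h..t+h}. ennreal (norm (k (cis s) - k (cis t))) \<partial>lborel) \<le> ennreal (\<epsilon> * h)"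
        by (simp add: add_mono)
    qed (use \<delta> in auto)
  qed
  ultimately show ?thesis by blast
qed

lemma has_nt_limitD:
  assumes "has_nt_limit f \<zeta> L"
  shows "(f \<longlongrightarrow> L) (at \<zeta> within Stolz 2 \<zeta>)"
  using assms unfolding has_nt_limit_def by simp

text \<open>The integral is split at |s - t| = \<delta>. Near t, the Stolz condition makes the
  Poisson kernel comparable to the dyadic kernel with d = 1 - cmod z; away from t it is of order d,
  because cis s stays at distance \<eta> from cis t.\<close>

lemma nn_integral_poisson_le:
  fixes w :: "complex \<Rightarrow> real" and t \<delta> \<eta> \<epsilon> B \<alpha> :: real
  assumes [measurable]: "w \<in> borel_measurable borel" and w: "\<And>\<zeta>. 0 \<le> w \<zeta>"
    and \<delta>: "0 < \<delta>" "\<delta> \<le> 1" "0 \<le> \<epsilon>"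
    and avg: "\<And>h. 0 < h \<Longrightarrow> h \<le> \<delta> \<Longrightarrow>
      (\<integral>\<^sup>+s\<in>{t-h..t+h}. ennreal (w (cis s)) \<partial>lborel) \<le> ennreal (\<epsilon> * h)"
    and \<eta>: "0 < \<eta>" "\<And>s. s \<in> {0..2*pi} \<Longrightarrow> \<delta> < \<bar>s - t\<bar> \<Longrightarrow> \<eta> \<le> cmod (cis s - cis t)"
    and B: "0 \<le> B" "(\<integral>\<^sup>+s\<in>{0..2*pi}. ennreal (w (cis s)) \<partial>lborel) \<le> ennreal B"
    and z: "z \<in> Stolz \<alpha> (cis t)" and \<alpha>: "\<alpha> > 1"
  shows "(\<integral>\<^sup>+s\<in>{0..2*pi}. ennreal (poisson z (cis s) * w (cis s)) \<partial>lborel)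
    \<le> ennreal (64 * (1 + \<alpha>)\<^sup>2 * \<epsilon> + 2 * (1 - cmod z) * (1 + \<alpha>)\<^sup>2 / \<eta>\<^sup>2 * B)"
proof -
  define d where "d = 1 - cmod z"
  have d: "d > 0" and zd: "cmod (z - cis t) < \<alpha> * d" using z by (auto simp: Stolz_def d_def)
  have far: "d \<le> cmod (cis s - z)" for s
    using norm_triangle_ineq2[of "cis s" z] by (simp add: d_def)
  have near: "cmod (cis s - cis t) \<le> (1 + \<alpha>) * cmod (cis s - z)" for s
  proof -
    have "cmod (cis s - cis t) \<le> cmod (cis s - z) + cmod (z - cis t)"
      using norm_triangle_ineq[of "cis s - z" "z - cis t"] by simp
    also have "\<dots> \<le> cmod (cis s - z) + \<alpha> * cmod (cis s - z)"
    proof -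
      have "\<alpha> * d \<le> \<alpha> * cmod (cis s - z)" using \<alpha> by (intro mult_left_mono far) auto
      then show ?thesis using zd by simp
    qed
    finally show ?thesis by (simp add: algebra_simps)
  qed
  have P: "poisson z (cis s) \<le> 2 * d / (cmod (cis s - z))\<^sup>2" for s
  proof -
    have "1 - (cmod z)\<^sup>2 = d * (1 + cmod z)" by (simp add: d_def power2_eq_square algebra_simps)
    also have "\<dots> \<le> d * 2" using d by (intro mult_left_mono) (auto simp: d_def)
    finally show ?thesis unfolding poisson_def using far[of s] d by (intro divide_right_mono) auto
  qed
  define K where "K = (\<lambda>s. d / (max d \<bar>s - t\<bar>)\<^sup>2)"
  have P1: "poisson z (cis s) \<le> 8 * (1 + \<alpha>)\<^sup>2 * K s" if s: "\<bar>s - t\<bar> \<le> \<delta>" for s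
  proof -
    \<comment> \<open>Rotation by cis (- t) gives the chord the imaginary part sin (s - t), and sin
      x \<ge> x - x^3 / 6 \<ge> x / 2 on [0, 1]. This is where \<delta> \<le> 1 enters.\<close>
    have "\<bar>s - t\<bar> / 2 \<le> cmod (cis s - cis t)"
    proof -
      have "\<bar>s - t\<bar> / 2 \<le> \<bar>sin (s - t)\<bar>"
      proof -
        define x where "x = \<bar>s - t\<bar>"
        have x: "0 \<le> x" "x \<le> 1" using s \<delta> by (auto simp: x_def)
        have "x / 2 \<le> sin x"
        proof -
          have "x - x ^ 3 / 6 \<le> sin x"
            using Maclaurin_sin_bound[of x 3] x by (simp add: numeral_3_eq_3 sin_coeff_def abs_if split: if_splits)
          moreover have "x ^ 3 \<le> x" using x power_decreasing[of 1 3 x] by simp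
          ultimately show ?thesis using x by simp
        qed
        moreover have "\<bar>sin (s - t)\<bar> = \<bar>sin x\<bar>" using sin_minus[of "s - t"] by (auto simp: x_def abs_if)
        ultimately show ?thesis by (simp add: x_def)
      qed
      also have "\<dots> = \<bar>Im ((cis s - cis t) * cis (- t))\<bar>"
        by (simp add: algebra_simps sin_diff)
      also have "\<dots> \<le> cmod ((cis s - cis t) * cis (- t))" by (rule abs_Im_le_cmod)
      finally show ?thesis by (simp add: norm_mult)
    qed
    also note near
    finally have "\<bar>s - t\<bar> \<le> 2 * (1 + \<alpha>) * cmod (cis s - z)" by (simp add: algebra_simps)
    moreover have "d \<le> 2 * (1 + \<alpha>) * cmod (cis s - z)"
      using far[of s] \<alpha> d mult_right_mono[of 1 "2 * (1 + \<alpha>)" "cmod (cis s - z)"] by simp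
    ultimately have m: "max d \<bar>s - t\<bar> \<le> 2 * (1 + \<alpha>) * cmod (cis s - z)" by simp
    have "(max d \<bar>s - t\<bar>)\<^sup>2 \<le> (2 * (1 + \<alpha>) * cmod (cis s - z))\<^sup>2" using d m by (intro power_mono) auto
    also have "\<dots> = 4 * (1 + \<alpha>)\<^sup>2 * (cmod (cis s - z))\<^sup>2"
      by (simp add: power2_eq_square algebra_simps)
    finally have m2: "(max d \<bar>s - t\<bar>)\<^sup>2 \<le> 4 * (1 + \<alpha>)\<^sup>2 * (cmod (cis s - z))\<^sup>2" .
    have p: "0 < cmod (cis s - z)" "0 < max d \<bar>s - t\<bar>" using far[of s] d by auto
    have "2 * d / (cmod (cis s - z))\<^sup>2 = 8 * (1 + \<alpha>)\<^sup>2 * (d / (4 * (1 + \<alpha>)\<^sup>2 * (cmod (cis s - z))\<^sup>2))"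
      using \<alpha> by (simp add: field_simps)
    also have "\<dots> \<le> 8 * (1 + \<alpha>)\<^sup>2 * (d / (max d \<bar>s - t\<bar>)\<^sup>2)"
      using m2 p d \<alpha> by (intro mult_left_mono divide_left_mono mult_pos_pos zero_less_power) auto
    finally show ?thesis using P[of s] by (simp add: K_def)
  qed
  have P2: "poisson z (cis s) \<le> 2 * d * (1 + \<alpha>)\<^sup>2 / \<eta>\<^sup>2" if "s \<in> {0..2*pi}" "\<delta> < \<bar>s - t\<bar>" for s
  proof -
    have "\<eta> \<le> (1 + \<alpha>) * cmod (cis s - z)" using \<eta>(2)[OF that] near[of s] by simp
    then have "\<eta>\<^sup>2 \<le> ((1 + \<alpha>) * cmod (cis s - z))\<^sup>2" using \<eta> by (intro power_mono) auto
    then have e: "\<eta>\<^sup>2 \<le> (1 + \<alpha>)\<^sup>2 * (cmod (cis s - z))\<^sup>2" by (simp add: power_mult_distrib)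
    have p: "0 < cmod (cis s - z)" using far[of s] d by auto
    have "2 * d / (cmod (cis s - z))\<^sup>2 = 2 * d * (1 + \<alpha>)\<^sup>2 / ((1 + \<alpha>)\<^sup>2 * (cmod (cis s - z))\<^sup>2)"
      using \<alpha> by simp
    also have "\<dots> \<le> 2 * d * (1 + \<alpha>)\<^sup>2 / \<eta>\<^sup>2"
      using e p d \<alpha> \<eta> by (intro divide_left_mono mult_pos_pos zero_less_power) auto
    finally show ?thesis using P[of s] by simp
  qed
  \<comment> \<open>The constant 64 of the conclusion is this 8 times the 8 of
    \<open>nn_integral_dyadic_kernel_le\<close>.\<close>
  define c where "c = 8 * (1 + \<alpha>)\<^sup>2"
  define c' where "c' = 2 * d * (1 + \<alpha>)\<^sup>2 / \<eta>\<^sup>2"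
  have c: "0 \<le> c" "0 \<le> c'" using d by (auto simp: c_def c'_def)
  have "(\<integral>\<^sup>+s\<in>{0..2*pi}. ennreal (poisson z (cis s) * w (cis s)) \<partial>lborel)
    \<le> (\<integral>\<^sup>+s. ennreal c * (ennreal (K s * w (cis s)) * indicator {t-\<delta>..t+\<delta>} s)
        + ennreal c' * (ennreal (w (cis s)) * indicator {0..2*pi} s) \<partial>lborel)"
  proof (rule nn_integral_mono)
    fix s
    show "ennreal (poisson z (cis s) * w (cis s)) * indicator {0..2*pi} s \<le>
      ennreal c * (ennreal (K s * w (cis s)) * indicator {t-\<delta>..t+\<delta>} s)
        + ennreal c' * (ennreal (w (cis s)) * indicator {0..2*pi} s)"
    proof (cases "s \<in> {0..2*pi}")
      case True
      have "ennreal (poisson z (cis s) * w (cis s)) \<le> ennreal c * (ennreal (K s * w (cis s)) * indicator {t-\<delta>..t+\<delta>} s)"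
        if "\<bar>s - t\<bar> \<le> \<delta>"
      proof -
        have "s \<in> {t-\<delta>..t+\<delta>}" using that by auto
        moreover have "poisson z (cis s) * w (cis s) \<le> c * (K s * w (cis s))"
          using mult_right_mono[OF P1[OF that] w[of "cis s"]] by (simp add: c_def mult.assoc)
        ultimately show ?thesis using c w[of "cis s"] by (simp add: ennreal_leI flip: ennreal_mult')
      qed
      moreover have "ennreal (poisson z (cis s) * w (cis s)) \<le> ennreal c' * ennreal (w (cis s))"
        if "\<delta> < \<bar>s - t\<bar>"
        using mult_right_mono[OF P2[OF True that] w[of "cis s"]] c w[of "cis s"]
        by (simp add: ennreal_leI c'_def flip: ennreal_mult')
      ultimately show ?thesis using True
        by (cases "\<bar>s - t\<bar> \<le> \<delta>") (auto intro: add_increasing add_increasing2)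
    qed simp
  qed
  also have "\<dots> = ennreal c * (\<integral>\<^sup>+s\<in>{t-\<delta>..t+\<delta>}. ennreal (K s * w (cis s)) \<partial>lborel)
      + ennreal c' * (\<integral>\<^sup>+s\<in>{0..2*pi}. ennreal (w (cis s)) \<partial>lborel)"
    unfolding K_def by (subst nn_integral_add) (simp_all add: nn_integral_cmult)
  also have "\<dots> \<le> ennreal c * ennreal (8 * \<epsilon>) + ennreal c' * ennreal B"
    unfolding K_def using d \<delta> w avg B by (intro add_mono mult_left_mono nn_integral_dyadic_kernel_le) auto
  also have "\<dots> = ennreal (c * (8 * \<epsilon>) + c' * B)"
    using c \<delta> B by (simp add: ennreal_mult ennreal_plus)
  also have "c * (8 * \<epsilon>) + c' * B = 64 * (1 + \<alpha>)\<^sup>2 * \<epsilon> + 2 * (1 - cmod z) * (1 + \<alpha>)\<^sup>2 / \<eta>\<^sup>2 * B"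
    by (simp add: c_def c'_def d_def)
  finally show ?thesis .
qed

lemma poisson_nt_limit_at:
  fixes k :: "complex \<Rightarrow> complex"
  assumes k: "integrable circle_measure k" and t: "t \<in> {0<..<2*pi}" and lp: "lebesgue_point k t"
  shows "has_nt_limit (\<lambda>z. \<integral>\<zeta>. poisson z \<zeta> * k \<zeta> \<partial>circle_measure) (cis t) (k (cis t))"
  unfolding has_nt_limit_def
proof (intro allI impI tendstoI)
  fix \<alpha> e :: real assume \<alpha>: "\<alpha> > 1" and e: "e > 0"
  have [measurable]: "k \<in> borel_measurable borel"
    using borel_measurable_integrable[OF k] by simp
  define w where "w = (\<lambda>\<zeta>. norm (k \<zeta> - k (cis t)))"
  have w: "0 \<le> w \<zeta>" for \<zeta> by (simp add: w_def)
  have [measurable]: "w \<in> borel_measurable borel" unfolding w_def by measurable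
  have wi: "integrable circle_measure w" unfolding w_def using k by simp
  \<comment> \<open>Chosen so that the near term 64 * (1 + \<alpha>)^2 * \<epsilon> equals e /
    2.\<close>
  define \<epsilon> where "\<epsilon> = e / (128 * (1 + \<alpha>)\<^sup>2)"
  have \<epsilon>: "\<epsilon> > 0" using e \<alpha> by (simp add: \<epsilon>_def)
  obtain \<delta>0 where \<delta>0: "\<delta>0 > 0" "\<And>h. 0 < h \<Longrightarrow> h \<le> \<delta>0 \<Longrightarrow>
     (\<integral>\<^sup>+s\<in>{t-h..t+h}. ennreal (w (cis s)) \<partial>lborel) \<le> ennreal (\<epsilon> * h)"
    using lp \<epsilon> unfolding lebesgue_point_def w_def by blast
  define \<delta> where "\<delta> = min \<delta>0 1"
  have \<delta>: "\<delta> > 0" "\<delta> \<le> 1" "\<delta> \<le> \<delta>0" using \<delta>0 by (auto simp: \<delta>_def)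
  \<comment> \<open>An interior angle t is the only preimage of cis t in [0, 2*pi], so cis t has
    positive distance from the compact image of the remaining angles.\<close>
  obtain \<eta> where \<eta>: "\<eta> > 0" "\<And>s. s \<in> {0..2*pi} \<Longrightarrow> \<delta> < \<bar>s - t\<bar> \<Longrightarrow> \<eta> \<le> cmod (cis s - cis t)"
  proof -
    define S where "S = {0..2*pi} \<inter> {s. \<delta> \<le> \<bar>s - t\<bar>}"
    have "compact S" unfolding S_def
      by (intro compact_Int_closed closed_Collect_le continuous_intros) auto
    then have "compact ((\<lambda>s. cis s) ` S)"
      by (intro compact_continuous_image continuous_intros)
    moreover have "cis t \<notin> cis ` S"
    proof
      assume "cis t \<in> cis ` S"
      then obtain s where s: "s \<in> S" "cis t = cis s" by auto
      have "s \<in> {0..2*pi}" "\<delta> \<le> \<bar>s - t\<bar>" using s by (auto simp: S_def)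
      then show False using cis_eq_cisD[OF s(2)] t \<delta> by (cases "t = s") auto
    qed
    ultimately obtain \<eta> where "\<eta> > 0" "\<And>y. y \<in> cis ` S \<Longrightarrow> \<eta> \<le> dist (cis t) y"
      using separate_point_closed[of "cis ` S" "cis t"] compact_imp_closed by blast
    then show ?thesis by (intro that[of \<eta>]) (auto simp: S_def dist_norm norm_minus_commute)
  qed
  have "(\<integral>\<^sup>+s\<in>{0..2*pi}. ennreal (w (cis s)) \<partial>lborel) < \<infinity>"
  proof -
    have "set_integrable lborel {0..2*pi} (\<lambda>s. w (cis s))" using wi by (subst (asm) integrable_circle_iff) auto
    then have "(\<integral>\<^sup>+s. ennreal (norm (indicator {0..2*pi} s *\<^sub>R w (cis s))) \<partial>lborel) < \<infinity>"
      unfolding set_integrable_def integrable_iff_bounded by blast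
    also have "(\<integral>\<^sup>+s. ennreal (norm (indicator {0..2*pi} s *\<^sub>R w (cis s))) \<partial>lborel)
      = (\<integral>\<^sup>+s\<in>{0..2*pi}. ennreal (w (cis s)) \<partial>lborel)"
      by (intro nn_integral_cong) (auto simp: indicator_def w)
    finally show ?thesis .
  qed
  then obtain B where B: "B \<ge> 0" "(\<integral>\<^sup>+s\<in>{0..2*pi}. ennreal (w (cis s)) \<partial>lborel) = ennreal B"
    unfolding infinity_ennreal_def less_top_ennreal by blast
  define c where "c = 2 * (1 + \<alpha>)\<^sup>2 / \<eta>\<^sup>2 * B"
  have c: "c \<ge> 0" using B by (simp add: c_def)
  \<comment> \<open>For 1 - cmod z < r the far term is at most e / 4; the added 1 keeps the
    denominator positive when c = 0.\<close>
  define r where "r = e / (4 * (c + 1))"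
  have r: "r > 0" using e c by (simp add: r_def)
  show "\<forall>\<^sub>F z in at (cis t) within Stolz \<alpha> (cis t).
      dist (\<integral>\<zeta>. poisson z \<zeta> * k \<zeta> \<partial>circle_measure) (k (cis t)) < e"
    unfolding eventually_at
  proof (intro exI[of _ r] conjI ballI impI r)
    fix z assume z: "z \<in> Stolz \<alpha> (cis t)" "z \<noteq> cis t \<and> dist z (cis t) < r"
    have z1: "cmod z < 1" using z by (simp add: Stolz_def)
    have "1 - cmod z < r" using z norm_triangle_ineq2[of "cis t" z] by (simp add: dist_norm norm_minus_commute)
    then have "(1 - cmod z) * c \<le> r * c" using c by (intro mult_right_mono) auto
    also have "\<dots> \<le> r * (c + 1)" using r by (intro mult_left_mono) auto
    also have "\<dots> = e / 4" using c by (simp add: r_def field_simps)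
    also have "\<dots> < e / 2" using e by simp
    finally have X: "64 * (1 + \<alpha>)\<^sup>2 * \<epsilon> + 2 * (1 - cmod z) * (1 + \<alpha>)\<^sup>2 / \<eta>\<^sup>2 * B < e" (is "?X < e")
      using \<alpha> by (simp add: \<epsilon>_def c_def field_simps)
    have X0: "0 \<le> ?X" using B \<epsilon> z1 by simp
    have pint: "integrable circle_measure (\<lambda>\<zeta>. poisson z \<zeta> * w \<zeta>)"
      by (rule integrable_poisson_mult_real[OF wi z1])
    have "ennreal (\<integral>\<zeta>. poisson z \<zeta> * w \<zeta> \<partial>circle_measure) = (\<integral>\<^sup>+\<zeta>. poisson z \<zeta> * w \<zeta> \<partial>circle_measure)"
      using pint w poisson_nonneg[OF z1] by (intro nn_integral_eq_integral[symmetric]) auto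
    also have "\<dots> = (\<integral>\<^sup>+s\<in>{0..2*pi}. ennreal (poisson z (cis s) * w (cis s)) \<partial>lborel) / ennreal (2*pi)"
      by (rule nn_integral_circle) measurable
    also have "\<dots> \<le> ennreal ?X / ennreal (2*pi)"
      by (intro divide_right_mono_ennreal nn_integral_poisson_le[where \<delta>=\<delta> and t=t] z \<alpha> w)
        (use \<epsilon> B \<delta> \<eta> in \<open>auto intro!: \<delta>0(2)\<close>)
    also have "\<dots> = ennreal (?X / (2*pi))" using X0 by (intro divide_ennreal) auto
    finally have "(\<integral>\<zeta>. poisson z \<zeta> * w \<zeta> \<partial>circle_measure) \<le> ?X / (2*pi)"
      using X0 by (subst (asm) ennreal_le_iff) auto
    also have "\<dots> \<le> ?X / 1" using X0 pi_ge_two by (intro divide_left_mono) auto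
    also have "\<dots> < e" using X by simp
    finally have less: "(\<integral>\<zeta>. poisson z \<zeta> * w \<zeta> \<partial>circle_measure) < e" .
    \<comment> \<open>The kernel has mass 1, so the constant k (cis t) is its own Poisson integral,
      and the difference has a density of modulus \<open>w\<close>.\<close>
    have "complex_of_real (\<integral>\<zeta>. poisson z \<zeta> \<partial>circle_measure) * k (cis t)
        = (\<integral>\<zeta>. complex_of_real (poisson z \<zeta>) * k (cis t) \<partial>circle_measure)" by simp
    then have "(\<integral>\<zeta>. poisson z \<zeta> * k \<zeta> \<partial>circle_measure) - k (cis t)
      = (\<integral>\<zeta>. poisson z \<zeta> * k \<zeta> \<partial>circle_measure) - (\<integral>\<zeta>. complex_of_real (poisson z \<zeta>) * k (cis t) \<partial>circle_measure)"
      by (simp add: poisson_integral_1[OF z1])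
    also have "\<dots> = (\<integral>\<zeta>. poisson z \<zeta> * k \<zeta> - complex_of_real (poisson z \<zeta>) * k (cis t) \<partial>circle_measure)"
      using integrable_poisson_mult[OF k z1] poisson_integral_1(2)[OF z1]
      by (intro Bochner_Integration.integral_diff[symmetric]) auto
    also have "norm \<dots> \<le> (\<integral>\<zeta>. norm (poisson z \<zeta> * k \<zeta> - complex_of_real (poisson z \<zeta>) * k (cis t)) \<partial>circle_measure)"
      by (rule integral_norm_bound)
    also have "\<dots> = (\<integral>\<zeta>. poisson z \<zeta> * w \<zeta> \<partial>circle_measure)"
      using poisson_nonneg[OF z1]
      by (intro Bochner_Integration.integral_cong) (auto simp: w_def norm_mult simp flip: right_diff_distrib)
    finally show "dist (\<integral>\<zeta>. poisson z \<zeta> * k \<zeta> \<partial>circle_measure) (k (cis t)) < e"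
      using less by (simp add: dist_norm)
  qed
qed

lemma poisson_nt_limit:
  fixes k :: "complex \<Rightarrow> complex"
  assumes k: "integrable circle_measure k"
  shows "AE \<zeta> in circle_measure. has_nt_limit (\<lambda>z. \<integral>\<zeta>. poisson z \<zeta> * k \<zeta> \<partial>circle_measure) \<zeta> (k \<zeta>)"
proof -
  obtain N where N: "negligible N" "\<forall>t\<in>{0<..<2*pi} - N. lebesgue_point k t"
    using lebesgue_points_circle[OF k] by blast
  show ?thesis
    by (rule AE_circleI[OF N(1)]) (use N(2) poisson_nt_limit_at[OF k] in auto)
qed

section \<open>Poisson representation of bounded holomorphic functions\<close>

lemma integral_circle_norm_poly:
  fixes c :: "nat \<Rightarrow> complex"
  assumes A: "finite A"
  shows "(\<integral>\<zeta>. (cmod (\<Sum>n\<in>A. c n * \<zeta> ^ n))\<^sup>2 \<partial>circle_measure) = (\<Sum>n\<in>A. (cmod (c n))\<^sup>2)"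
proof -
  have i: "integrable circle_measure (\<lambda>\<zeta>. \<zeta> ^ n * cnj \<zeta> ^ m)" for n m
    by (rule integrable_circle_bounded[of _ 1])
      (simp, use AE_circle_norm in \<open>auto simp: norm_mult norm_power elim!: eventually_mono\<close>)
  have "complex_of_real (\<integral>\<zeta>. (cmod (\<Sum>n\<in>A. c n * \<zeta> ^ n))\<^sup>2 \<partial>circle_measure)
    = (\<integral>\<zeta>. (\<Sum>n\<in>A. \<Sum>m\<in>A. c n * cnj (c m) * (\<zeta> ^ n * cnj \<zeta> ^ m)) \<partial>circle_measure)"
    unfolding integral_complex_of_real[symmetric] complex_norm_square cnj_sum sum_product
    by (intro Bochner_Integration.integral_cong sum.cong refl) (simp_all add: mult_ac)
  also have "\<dots> = (\<Sum>n\<in>A. \<Sum>m\<in>A. c n * cnj (c m) * (if n = m then 1 else 0))"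
    using i by (simp add: integral_circle_power_cis)
  also have "\<dots> = (\<Sum>n\<in>A. complex_of_real ((cmod (c n))\<^sup>2))"
    unfolding complex_norm_square
    by (intro sum.cong refl) (simp add: A if_distrib[of "\<lambda>x. _ * x"] cong: if_cong)
  finally show ?thesis by (simp only: of_real_sum[symmetric] of_real_eq_iff)
qed

lemma integrable_circle_poly [simp]:
  fixes c :: "nat \<Rightarrow> complex"
  shows "integrable circle_measure (\<lambda>\<zeta>. \<Sum>n\<in>A. c n * \<zeta> ^ n)"
  by (intro Bochner_Integration.integrable_sum integrable_mult_right) simp

lemma bounded_circle_poly:
  fixes c :: "nat \<Rightarrow> complex"
  assumes "cmod \<zeta> = 1"
  shows "cmod (\<Sum>n\<in>A. c n * \<zeta> ^ n) \<le> (\<Sum>n\<in>A. cmod (c n))"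
  by (rule order_trans[OF norm_sum]) (simp add: norm_mult norm_power assms)

text \<open>This is the Cauchy-Schwarz inequality on a probability space, obtained by integrating
  the pointwise bound q \<le> L / 2 + q^2 / (2 * L).\<close>

lemma integral_circle_norm_poly_le:
  fixes c :: "nat \<Rightarrow> complex"
  assumes A: "finite A" and le: "(\<Sum>n\<in>A. (cmod (c n))\<^sup>2) \<le> L\<^sup>2" and L: "L > 0"
  shows "(\<integral>\<zeta>. cmod (\<Sum>n\<in>A. c n * \<zeta> ^ n) \<partial>circle_measure) \<le> L"
proof -
  let ?q = "\<lambda>\<zeta>. cmod (\<Sum>n\<in>A. c n * \<zeta> ^ n)"
  have i2: "integrable circle_measure (\<lambda>\<zeta>. (?q \<zeta>)\<^sup>2)"
    by (rule integrable_circle_bounded[of _ "(\<Sum>n\<in>A. cmod (c n))\<^sup>2"])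
      (simp, use AE_circle_norm in \<open>auto intro!: power_mono bounded_circle_poly elim!: eventually_mono\<close>)
  have "(\<integral>\<zeta>. ?q \<zeta> \<partial>circle_measure) \<le> (\<integral>\<zeta>. L / 2 + (?q \<zeta>)\<^sup>2 / (2 * L) \<partial>circle_measure)"
  proof (rule integral_mono)
    fix \<zeta>
    have "0 \<le> (?q \<zeta> - L)\<^sup>2" by simp
    then show "?q \<zeta> \<le> L / 2 + (?q \<zeta>)\<^sup>2 / (2 * L)"
      using L by (simp add: field_simps power2_eq_square)
  qed (use i2 in auto)
  also have "\<dots> = L / 2 + (\<Sum>n\<in>A. (cmod (c n))\<^sup>2) / (2 * L)"
    using i2 by (simp add: integral_circle_norm_poly[OF A])
  also have "\<dots> \<le> L / 2 + L\<^sup>2 / (2 * L)" using le L by (intro add_left_mono divide_right_mono) auto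
  also have "\<dots> = L" using L by (simp add: power2_eq_square)
  finally show ?thesis .
qed

lemma poisson_poly:
  fixes c :: "nat \<Rightarrow> complex"
  assumes "cmod z < 1"
  shows "(\<integral>\<zeta>. poisson z \<zeta> * (\<Sum>n\<in>A. c n * \<zeta> ^ n) \<partial>circle_measure) = (\<Sum>n\<in>A. c n * z ^ n)"
proof -
  have "(\<integral>\<zeta>. poisson z \<zeta> * (\<Sum>n\<in>A. c n * \<zeta> ^ n) \<partial>circle_measure)
    = (\<integral>\<zeta>. (\<Sum>n\<in>A. c n * (poisson z \<zeta> * \<zeta> ^ n)) \<partial>circle_measure)"
    by (simp add: sum_distrib_left mult_ac)
  also have "\<dots> = (\<Sum>n\<in>A. c n * z ^ n)"
    using integrable_poisson_mult[OF integrable_circle_power(1) assms]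
    by (subst Bochner_Integration.integral_sum) (auto simp: poisson_power[OF assms])
  finally show ?thesis .
qed

text \<open>On the circle of radius r < 1 the Taylor polynomials converge uniformly, so one of high
  degree is bounded by C + e there, and its mean square is the coefficient sum. Then e tends to 0
  and r to 1.\<close>

lemma Bessel_coefficients:
  fixes a :: "nat \<Rightarrow> complex"
  assumes g: "\<And>z. cmod z < 1 \<Longrightarrow> (\<lambda>n. a n * z ^ n) sums g z"
    and C: "\<And>z. cmod z < 1 \<Longrightarrow> cmod (g z) \<le> C"
  shows "summable (\<lambda>n. (cmod (a n))\<^sup>2)"
proof (rule bounded_imp_summable)
  have 1: "(\<Sum>n<N. (cmod (a n))\<^sup>2 * (r\<^sup>2) ^ n) \<le> C\<^sup>2" if r: "0 < r" "r < 1" for N r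
  proof -
    have "(\<Sum>n<N. (cmod (a n))\<^sup>2 * (r\<^sup>2) ^ n) \<le> (C + e)\<^sup>2" if e: "e > 0" for e
    proof -
      define b where "b = (\<lambda>n. a n * of_real r ^ n)"
      have sb: "summable (\<lambda>n. norm (b n))"
      proof -
        \<comment> \<open>Convergence at a radius strictly between r and 1 gives absolute
          convergence at r.\<close>
        define \<rho> where "\<rho> = (r + 1) / 2"
        have "summable (\<lambda>n. a n * of_real \<rho> ^ n)"
          using g[of "of_real \<rho>"] r by (auto simp: \<rho>_def sums_iff norm_divide simp flip: of_real_add)
        then show ?thesis unfolding b_def
          by (rule powser_insidea) (use r in \<open>auto simp: \<rho>_def\<close>)
      qed
      have "uniform_limit (sphere 0 1) (\<lambda>n \<zeta>. \<Sum>i<n. b i * \<zeta> ^ i) (\<lambda>\<zeta>. \<Sum>i. b i * \<zeta> ^ i) sequentially"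
        by (rule Weierstrass_m_test[OF _ sb]) (auto simp: norm_mult norm_power)
      then have "\<forall>\<^sub>F n in sequentially. \<forall>\<zeta>\<in>sphere 0 1. dist (\<Sum>i<n. b i * \<zeta> ^ i) (\<Sum>i. b i * \<zeta> ^ i) < e"
        using e by (rule uniform_limitD)
      then obtain M0 where M0: "\<forall>n\<ge>M0. \<forall>\<zeta>\<in>sphere 0 1.
          dist (\<Sum>i<n. b i * \<zeta> ^ i) (\<Sum>i. b i * \<zeta> ^ i) < e"
        unfolding eventually_sequentially by blast
      \<comment> \<open>At least M0 for the uniform error, at least N so that the first N squares
        are part of the sum.\<close>
      define M where "M = max M0 N"
      have M: "M \<ge> N" "\<And>\<zeta>. cmod \<zeta> = 1 \<Longrightarrow> dist (\<Sum>i<M. b i * \<zeta> ^ i) (\<Sum>i. b i * \<zeta> ^ i) < e"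
        using M0 by (auto simp: M_def)
      have bd: "cmod (\<Sum>i<M. b i * \<zeta> ^ i) \<le> C + e" if "cmod \<zeta> = 1" for \<zeta>
      proof -
        have n: "cmod (of_real r * \<zeta>) < 1" using that r by (simp add: norm_mult)
        have "(\<Sum>i. b i * \<zeta> ^ i) = g (of_real r * \<zeta>)"
          using g[OF n] by (simp add: b_def sums_iff power_mult_distrib mult.assoc)
        then show ?thesis using M(2)[OF that] C[OF n]
          norm_triangle_sub[of "\<Sum>i<M. b i * \<zeta> ^ i" "\<Sum>i. b i * \<zeta> ^ i"] by (simp add: dist_norm)
      qed
      have "(\<Sum>n<N. (cmod (a n))\<^sup>2 * (r\<^sup>2) ^ n) \<le> (\<Sum>n<M. (cmod (a n))\<^sup>2 * (r\<^sup>2) ^ n)"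
        using M(1) by (intro sum_mono2) auto
      also have "\<dots> = (\<Sum>n<M. (cmod (b n))\<^sup>2)"
        using r by (simp add: b_def norm_mult norm_power power_mult_distrib power_mult[symmetric] mult.commute)
      also have "\<dots> = (\<integral>\<zeta>. (cmod (\<Sum>n<M. b n * \<zeta> ^ n))\<^sup>2 \<partial>circle_measure)"
        by (rule integral_circle_norm_poly[symmetric]) simp
      also have "\<dots> \<le> (\<integral>\<zeta>. (C + e)\<^sup>2 \<partial>circle_measure)"
      proof (rule integral_mono_AE)
        show "integrable circle_measure (\<lambda>\<zeta>. (cmod (\<Sum>n<M. b n * \<zeta> ^ n))\<^sup>2)"
          by (rule integrable_circle_bounded[of _ "(C + e)\<^sup>2"])
            (simp, use AE_circle_norm in \<open>auto intro!: power_mono bd elim!: eventually_mono\<close>)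
        show "AE \<zeta> in circle_measure. (cmod (\<Sum>n<M. b n * \<zeta> ^ n))\<^sup>2 \<le> (C + e)\<^sup>2"
          using AE_circle_norm by eventually_elim (auto intro!: power_mono bd)
      qed simp
      finally show ?thesis by simp
    qed
    moreover have "((\<lambda>e. (C + e)\<^sup>2) \<longlongrightarrow> (C + 0)\<^sup>2) (at_right 0)" by (intro tendsto_intros)
    ultimately show ?thesis
      by (intro tendsto_lowerbound[where F="at_right 0" and f="\<lambda>e. (C + e)\<^sup>2"])
        (auto simp: eventually_at_right_less intro: eventually_mono[OF eventually_at_right_less])
  qed
  show "(\<Sum>n\<le>N. (cmod (a n))\<^sup>2) \<le> C\<^sup>2" for N
  proof -
    have "((\<lambda>r. \<Sum>n<Suc N. (cmod (a n))\<^sup>2 * (r\<^sup>2) ^ n) \<longlongrightarrow> (\<Sum>n<Suc N. (cmod (a n))\<^sup>2 * (1\<^sup>2) ^ n)) (at_left 1)"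
      by (intro tendsto_intros)
    moreover have "\<forall>\<^sub>F r in at_left 1. (\<Sum>n<Suc N. (cmod (a n))\<^sup>2 * (r\<^sup>2) ^ n) \<le> C\<^sup>2"
      by (rule eventually_mono[OF eventually_at_left_real[of 0 "1::real"]])
        (auto intro: 1 simp del: sum.lessThan_Suc)
    ultimately have "(\<Sum>n<Suc N. (cmod (a n))\<^sup>2 * (1\<^sup>2) ^ n) \<le> C\<^sup>2"
      by (intro tendsto_upperbound) auto
    then show ?thesis by (simp add: lessThan_Suc_atMost)
  qed
qed simp

text \<open>
  By orthogonality the partial sums of the series on the circle are Cauchy in \<open>L\<^sup>2\<close>, so a lacunary
  subsequence \<open>N j\<close> converges absolutely a.e. and in \<open>L\<^sup>1\<close>; its limit is the density \<open>k\<close>.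
\<close>

lemma power_series_poisson:
  fixes a :: "nat \<Rightarrow> complex"
  assumes g: "\<And>z. cmod z < 1 \<Longrightarrow> (\<lambda>n. a n * z ^ n) sums g z"
    and a: "summable (\<lambda>n. (cmod (a n))\<^sup>2)"
  obtains k :: "complex \<Rightarrow> complex" where "integrable circle_measure k"
    "\<And>z. cmod z < 1 \<Longrightarrow> g z = (\<integral>\<zeta>. poisson z \<zeta> * k \<zeta> \<partial>circle_measure)"
proof -
  \<comment> \<open>The squared bound gives the block of terms after N j an L^2 norm, hence an L^1
    norm, of at most 2 ^ - j.\<close>
  have "\<exists>M. \<forall>m\<ge>M. \<forall>n. norm (\<Sum>i=m..<n. (cmod (a i))\<^sup>2) < ((1/2) ^ j)\<^sup>2" for j :: nat
    using a unfolding summable_Cauchy by simp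
  then obtain M :: "nat \<Rightarrow> nat" where M: "\<And>j m n. m \<ge> M j \<Longrightarrow> norm (\<Sum>i=m..<n. (cmod (a i))\<^sup>2) < ((1/2) ^ j)\<^sup>2"
    by metis
  \<comment> \<open>The sum makes \<open>N\<close> monotone and at least M j; the summand j makes it
    tend to infinity.\<close>
  define N where "N = (\<lambda>j. j + (\<Sum>i\<le>j. M i))"
  have NM: "N j \<ge> M j" for j by (simp add: N_def trans_le_add2 member_le_sum)
  have NS: "N j \<le> N (Suc j)" for j by (simp add: N_def)
  have Nj: "filterlim N sequentially sequentially"
    by (rule filterlim_at_top_mono[OF filterlim_ident]) (simp add: N_def)
  define u where "u = (\<lambda>j \<zeta>. \<Sum>n=N j..<N (Suc j). a n * \<zeta> ^ n)"
  have ui [simp]: "integrable circle_measure (u j)" for j by (simp add: u_def)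
  have um [measurable]: "u j \<in> borel_measurable borel" for j unfolding u_def by measurable
  have u1: "(\<integral>\<zeta>. cmod (u j \<zeta>) \<partial>circle_measure) \<le> (1/2) ^ j" for j
    unfolding u_def using M[OF NM, of j "N (Suc j)"]
    by (intro integral_circle_norm_poly_le) (auto simp: abs_less_iff)
  have su: "summable (\<lambda>j. \<integral>\<zeta>. cmod (u j \<zeta>) \<partial>circle_measure)"
    by (rule summable_comparison_test'[where g="\<lambda>j. (1/2) ^ j" and N=0])
      (use u1 in \<open>auto simp: summable_geometric\<close>)
  have AEs: "AE \<zeta> in circle_measure. summable (\<lambda>j. cmod (u j \<zeta>))"
  proof -
    have "(\<integral>\<^sup>+\<zeta>. (\<Sum>j. ennreal (cmod (u j \<zeta>))) \<partial>circle_measure) = (\<Sum>j. \<integral>\<^sup>+\<zeta>. ennreal (cmod (u j \<zeta>)) \<partial>circle_measure)"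
      by (rule nn_integral_suminf) measurable
    also have "\<dots> = (\<Sum>j. ennreal (\<integral>\<zeta>. cmod (u j \<zeta>) \<partial>circle_measure))"
      by (intro suminf_cong nn_integral_eq_integral) auto
    also have "\<dots> < \<infinity>" using su by (simp add: ennreal_suminf_neq_top less_top[symmetric])
    finally have "AE \<zeta> in circle_measure. (\<Sum>j. ennreal (cmod (u j \<zeta>))) \<noteq> \<infinity>"
      by (intro nn_integral_noteq_infinite) auto
    then show ?thesis
      by eventually_elim (auto intro!: summable_suminf_not_top simp: infinity_ennreal_def)
  qed
  define s where "s = (\<lambda>\<zeta>. \<Sum>n<N 0. a n * \<zeta> ^ n)"
  have si [simp]: "integrable circle_measure s" by (simp add: s_def)
  have ki: "integrable circle_measure (\<lambda>\<zeta>. \<Sum>j. u j \<zeta>)"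
    by (rule integrable_suminf[OF ui AEs su])
  show thesis
  proof (rule that[of "\<lambda>\<zeta>. s \<zeta> + (\<Sum>j. u j \<zeta>)"])
    show "integrable circle_measure (\<lambda>\<zeta>. s \<zeta> + (\<Sum>j. u j \<zeta>))" using ki by simp
    fix z :: complex assume z: "cmod z < 1"
    define B where "B = 2 / (1 - cmod z)"
    have B: "AE \<zeta> in circle_measure. norm (complex_of_real (poisson z \<zeta>)) \<le> B"
      using AE_circle_norm by eventually_elim (use poisson_le[OF z] poisson_nonneg[OF z] in \<open>auto simp: B_def\<close>)
    have pi: "integrable circle_measure (\<lambda>\<zeta>. poisson z \<zeta> * u j \<zeta>)" for j
      by (rule integrable_poisson_mult[OF ui z])
    have 1: "AE \<zeta> in circle_measure. summable (\<lambda>j. norm (poisson z \<zeta> * u j \<zeta>))"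
      using AEs by eventually_elim (simp add: norm_mult summable_mult)
    have 2: "summable (\<lambda>j. \<integral>\<zeta>. norm (poisson z \<zeta> * u j \<zeta>) \<partial>circle_measure)"
    proof (rule summable_comparison_test'[where N=0])
      show "summable (\<lambda>j. B * (\<integral>\<zeta>. cmod (u j \<zeta>) \<partial>circle_measure))" by (intro summable_mult su)
      show "norm (\<integral>\<zeta>. norm (poisson z \<zeta> * u j \<zeta>) \<partial>circle_measure) \<le> B * (\<integral>\<zeta>. cmod (u j \<zeta>) \<partial>circle_measure)" for j
      proof -
        have "(\<integral>\<zeta>. norm (poisson z \<zeta> * u j \<zeta>) \<partial>circle_measure) \<le> (\<integral>\<zeta>. B * cmod (u j \<zeta>) \<partial>circle_measure)"
          by (intro integral_mono_AE integrable_norm pi integrable_mult_right ui)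
            (use B in \<open>auto simp: norm_mult intro!: mult_right_mono elim!: eventually_mono\<close>)
        then show ?thesis by (simp add: integral_nonneg_AE)
      qed
    qed
    have "(\<lambda>j. \<integral>\<zeta>. poisson z \<zeta> * u j \<zeta> \<partial>circle_measure) sums (\<integral>\<zeta>. (\<Sum>j. poisson z \<zeta> * u j \<zeta>) \<partial>circle_measure)"
      by (rule sums_integral[OF pi 1 2])
    then have "(\<lambda>J. \<Sum>j<J. u j z) \<longlonglongrightarrow> (\<integral>\<zeta>. (\<Sum>j. poisson z \<zeta> * u j \<zeta>) \<partial>circle_measure)"
      unfolding sums_def by (simp add: u_def poisson_poly[OF z])
    then have "(\<lambda>J. s z + (\<Sum>j<J. u j z)) \<longlonglongrightarrow> s z + (\<integral>\<zeta>. (\<Sum>j. poisson z \<zeta> * u j \<zeta>) \<partial>circle_measure)"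
      by (intro tendsto_intros)
    also have "(\<lambda>J. s z + (\<Sum>j<J. u j z)) = (\<lambda>J. \<Sum>n<N J. a n * z ^ n)"
    proof
      fix J show "s z + (\<Sum>j<J. u j z) = (\<Sum>n<N J. a n * z ^ n)"
      proof (induction J)
        case (Suc J)
        have "(\<Sum>n<N (Suc J). a n * z ^ n) = (\<Sum>n<N J. a n * z ^ n) + u J z"
          using sum.atLeastLessThan_concat[of 0 "N J" "N (Suc J)" "\<lambda>n. a n * z ^ n"] NS[of J]
          by (simp add: u_def lessThan_atLeast0)
        then show ?case using Suc by (simp add: add.assoc[symmetric])
      qed (simp add: s_def)
    qed
    finally have "(\<lambda>J. \<Sum>n<N J. a n * z ^ n) \<longlonglongrightarrow> s z + (\<integral>\<zeta>. (\<Sum>j. poisson z \<zeta> * u j \<zeta>) \<partial>circle_measure)" .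
    moreover have "(\<lambda>J. \<Sum>n<N J. a n * z ^ n) \<longlonglongrightarrow> g z"
      using filterlim_compose[OF g[OF z, unfolded sums_def] Nj] .
    ultimately have "g z = s z + (\<integral>\<zeta>. (\<Sum>j. poisson z \<zeta> * u j \<zeta>) \<partial>circle_measure)"
      by (rule LIMSEQ_unique[rotated])
    also have "s z = (\<integral>\<zeta>. poisson z \<zeta> * s \<zeta> \<partial>circle_measure)"
      by (simp add: s_def poisson_poly[OF z])
    also have "(\<integral>\<zeta>. (\<Sum>j. poisson z \<zeta> * u j \<zeta>) \<partial>circle_measure) = (\<integral>\<zeta>. poisson z \<zeta> * (\<Sum>j. u j \<zeta>) \<partial>circle_measure)"
      by (rule integral_cong_AE)
        (measurable, use AEs in \<open>auto elim!: eventually_mono intro!: suminf_mult summable_norm_cancel\<close>)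
    also have "(\<integral>\<zeta>. poisson z \<zeta> * s \<zeta> \<partial>circle_measure) + \<dots> = (\<integral>\<zeta>. poisson z \<zeta> * (s \<zeta> + (\<Sum>j. u j \<zeta>)) \<partial>circle_measure)"
      using integrable_poisson_mult[OF ki z] integrable_poisson_mult[OF si z]
      by (simp add: distrib_left)
    finally show "g z = (\<integral>\<zeta>. poisson z \<zeta> * (s \<zeta> + (\<Sum>j. u j \<zeta>)) \<partial>circle_measure)" .
  qed
qed

lemma Hinf_poisson:
  assumes "g \<in> Hinf"
  shows "\<exists>k :: complex \<Rightarrow> complex. integrable circle_measure k \<and>
    (\<forall>z. cmod z < 1 \<longrightarrow> g z = (\<integral>\<zeta>. poisson z \<zeta> * k \<zeta> \<partial>circle_measure))"
proof -
  have hol: "g holomorphic_on ball 0 1" and "bounded (g ` ball 0 1)"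
    using assms by (auto simp: Hinf_def Hol_disk_def)
  then obtain C where C: "\<And>z. cmod z < 1 \<Longrightarrow> cmod (g z) \<le> C"
    unfolding bounded_iff by (fastforce simp: dist_norm)
  define a where "a = (\<lambda>n. (deriv ^^ n) g 0 / fact n)"
  have s: "(\<lambda>n. a n * z ^ n) sums g z" if "cmod z < 1" for z
    using holomorphic_power_series[OF hol, of z] that by (simp add: a_def)
  show ?thesis
    using power_series_poisson[OF s Bessel_coefficients[OF s C]] by blast
qed

section \<open>Boundary values in the Smirnov class\<close>

text \<open>The radius lies in every Stolz region with \<alpha> > 1, as its points satisfy cmod (r *
  \<zeta> - \<zeta>) = 1 - r. Sampling it gives nontriviality of the filter, uniqueness of the limit
  and measurability of boundary values. The offset 2 keeps all radii strictly between 0 and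
  1.\<close>

lemma nt_radial:
  assumes "cmod \<zeta> = 1" "\<alpha> > 1"
  shows "filterlim (\<lambda>n. of_real (1 - 1 / real (n + 2)) * \<zeta>) (at \<zeta> within Stolz \<alpha> \<zeta>) sequentially"
  unfolding filterlim_at
proof (intro conjI always_eventually allI)
  have "(\<lambda>n. 1 - 1 / real (n + 2)) \<longlonglongrightarrow> 1" by real_asymp
  then have "(\<lambda>n. of_real (1 - 1 / real (n + 2)) * \<zeta>) \<longlonglongrightarrow> of_real 1 * \<zeta>"
    by (intro tendsto_intros)
  then show "(\<lambda>n. of_real (1 - 1 / real (n + 2)) * \<zeta>) \<longlonglongrightarrow> \<zeta>" by simp
  fix n
  define r where "r = 1 - 1 / real (n + 2)"
  have r: "0 < r" "r < 1" by (auto simp: r_def field_simps)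
  have "of_real r * \<zeta> - \<zeta> = - (of_real (1 - r) * \<zeta>)" by (simp add: algebra_simps)
  then have 1: "cmod (of_real r * \<zeta> - \<zeta>) = 1 - r"
    using assms r by (simp only: norm_minus_cancel norm_mult norm_of_real) simp
  have 2: "cmod (of_real r * \<zeta>) = r" using assms r by (simp add: norm_mult)
  show "of_real (1 - 1 / real (n + 2)) * \<zeta> \<noteq> \<zeta>" using 1 r unfolding r_def[symmetric] by auto
  show "of_real (1 - 1 / real (n + 2)) * \<zeta> \<in> Stolz \<alpha> \<zeta>"
    using r assms unfolding r_def[symmetric] Stolz_def by (simp add: 1 2)
qed

lemma nt_nontrivial: "cmod \<zeta> = 1 \<Longrightarrow> \<alpha> > 1 \<Longrightarrow> at \<zeta> within Stolz \<alpha> \<zeta> \<noteq> bot"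
  using nt_radial[of \<zeta> \<alpha>] by (auto simp: filterlim_def filtermap_bot_iff bot_unique)

lemma has_nt_limit_radial:
  assumes "has_nt_limit f \<zeta> L" "cmod \<zeta> = 1"
  shows "(\<lambda>n. f (of_real (1 - 1 / real (n + 2)) * \<zeta>)) \<longlonglongrightarrow> L"
  by (rule filterlim_compose[OF has_nt_limitD[OF assms(1)] nt_radial[OF assms(2)]]) simp

lemma bdry_eq:
  assumes "has_nt_limit f \<zeta> L" "cmod \<zeta> = 1"
  shows "bdry f \<zeta> = L"
proof -
  have "(THE L. has_nt_limit f \<zeta> L) = L"
    by (rule the_equality, rule assms)
      (rule LIMSEQ_unique[OF has_nt_limit_radial[OF _ assms(2)] has_nt_limit_radial[OF assms]])
  then show ?thesis using assms(1) by (auto simp: bdry_def)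
qed

lemma tendsto_Stolz_cong:
  assumes "\<And>z. cmod z < 1 \<Longrightarrow> f z = g z"
  shows "(f \<longlongrightarrow> L) (at \<zeta> within Stolz \<alpha> \<zeta>) \<longleftrightarrow> (g \<longlongrightarrow> L) (at \<zeta> within Stolz \<alpha> \<zeta>)"
  by (intro tendsto_cong) (auto simp: eventually_at_filter Stolz_def assms)

lemma has_nt_limit_cong:
  assumes "\<And>z. cmod z < 1 \<Longrightarrow> f z = g z"
  shows "has_nt_limit f \<zeta> L \<longleftrightarrow> has_nt_limit g \<zeta> L"
  unfolding has_nt_limit_def using tendsto_Stolz_cong[OF assms] by simp

lemma has_nt_limit_mult:
  "has_nt_limit f \<zeta> L \<Longrightarrow> has_nt_limit g \<zeta> M \<Longrightarrow> has_nt_limit (\<lambda>z. f z * g z) \<zeta> (L * M)"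
  unfolding has_nt_limit_def by (auto intro: tendsto_mult)

lemma has_nt_limit_divide:
  "has_nt_limit f \<zeta> L \<Longrightarrow> has_nt_limit g \<zeta> M \<Longrightarrow> M \<noteq> 0 \<Longrightarrow> has_nt_limit (\<lambda>z. f z / g z) \<zeta> (L / M)"
  unfolding has_nt_limit_def by (auto intro: tendsto_divide)

lemma Hinf_bounded:
  assumes "g \<in> Hinf"
  shows "\<exists>C. \<forall>z. cmod z < 1 \<longrightarrow> cmod (g z) \<le> C"
  using assms unfolding Hinf_def bounded_iff by fastforce

lemma HinfI:
  assumes "g holomorphic_on ball 0 1" "\<And>z. cmod z < 1 \<Longrightarrow> cmod (g z) \<le> C"
  shows "g \<in> Hinf"
  using assms unfolding Hinf_def Hol_disk_def bounded_iff by (auto simp: dist_norm intro!: exI[of _ C])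

lemma Fatou:
  assumes "g \<in> Hinf"
  shows "AE \<zeta> in circle_measure. has_nt_limit g \<zeta> (bdry g \<zeta>)"
proof -
  obtain k :: "complex \<Rightarrow> complex" where k: "integrable circle_measure k"
    "\<And>z. cmod z < 1 \<Longrightarrow> g z = (\<integral>\<zeta>. poisson z \<zeta> * k \<zeta> \<partial>circle_measure)"
    using Hinf_poisson[OF assms] by auto
  show ?thesis using poisson_nt_limit[OF k(1)] AE_circle_norm
  proof eventually_elim
    fix \<zeta> :: complex
    assume a: "has_nt_limit (\<lambda>z. \<integral>\<zeta>. poisson z \<zeta> * k \<zeta> \<partial>circle_measure) \<zeta> (k \<zeta>)" "cmod \<zeta> = 1"
    then have "has_nt_limit g \<zeta> (k \<zeta>)" by (subst has_nt_limit_cong[OF k(2)])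
    then show "has_nt_limit g \<zeta> (bdry g \<zeta>)" using bdry_eq[OF _ a(2)] by simp
  qed
qed

text \<open>The density of the Poisson representation agrees with the boundary values almost
  everywhere, so g z is an average of values of modulus at most C.\<close>

lemma Hinf_bound_bdry:
  assumes g: "g \<in> Hinf" and C: "AE \<zeta> in circle_measure. cmod (bdry g \<zeta>) \<le> C" and z: "cmod z < 1"
  shows "cmod (g z) \<le> C"
proof -
  obtain k :: "complex \<Rightarrow> complex" where k: "integrable circle_measure k"
    "\<And>z. cmod z < 1 \<Longrightarrow> g z = (\<integral>\<zeta>. poisson z \<zeta> * k \<zeta> \<partial>circle_measure)"
    using Hinf_poisson[OF g] by auto
  have kC: "AE \<zeta> in circle_measure. cmod (k \<zeta>) \<le> C"
    using poisson_nt_limit[OF k(1)] AE_circle_norm C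
  proof eventually_elim
    fix \<zeta> :: complex
    assume a: "has_nt_limit (\<lambda>z. \<integral>\<zeta>. poisson z \<zeta> * k \<zeta> \<partial>circle_measure) \<zeta> (k \<zeta>)" "cmod \<zeta> = 1" "cmod (bdry g \<zeta>) \<le> C"
    have "bdry g \<zeta> = k \<zeta>" using a by (intro bdry_eq) (simp_all add: has_nt_limit_cong[OF k(2)])
    then show "cmod (k \<zeta>) \<le> C" using a by simp
  qed
  have "cmod (g z) \<le> (\<integral>\<zeta>. norm (poisson z \<zeta> * k \<zeta>) \<partial>circle_measure)"
    unfolding k(2)[OF z] by (rule integral_norm_bound)
  also have "\<dots> \<le> (\<integral>\<zeta>. poisson z \<zeta> * C \<partial>circle_measure)"
    by (intro integral_mono_AE integrable_norm integrable_poisson_mult k z integrable_mult_left poisson_integral_1)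
      (use kC poisson_nonneg[OF z] in \<open>auto simp: norm_mult intro!: mult_left_mono elim!: eventually_mono\<close>)
  also have "\<dots> = C" using poisson_integral_1[OF z] by simp
  finally show ?thesis .
qed

section \<open>Outer functions and their boundary moduli\<close>

definition outer_fun :: "(complex \<Rightarrow> real) \<Rightarrow> complex \<Rightarrow> complex" where
  "outer_fun k z = exp (herglotz (\<lambda>\<zeta>. of_real (k \<zeta>)) z)"

lemma outer_iff:
  "outer h \<longleftrightarrow> (\<exists>c k. cmod c = 1 \<and> integrable circle_measure k \<and> (\<forall>z\<in>ball 0 1. h z = c * outer_fun k z))"
  unfolding outer_def outer_fun_def herglotz_def by simp

lemma outer_fun_minus: "outer_fun (\<lambda>\<zeta>. - k \<zeta>) z = inverse (outer_fun k z)"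
  by (simp add: outer_fun_def herglotz_def exp_minus)

lemma outer_fun_holomorphic:
  "integrable circle_measure k \<Longrightarrow> outer_fun k holomorphic_on ball 0 1"
  unfolding outer_fun_def by (intro holomorphic_intros herglotz_holomorphic) simp

lemma cmod_outer_fun:
  assumes "integrable circle_measure k" "cmod z < 1"
  shows "cmod (outer_fun k z) = exp (\<integral>\<zeta>. poisson z \<zeta> * k \<zeta> \<partial>circle_measure)"
  by (simp add: outer_fun_def Re_herglotz[OF assms])

lemma outer_fun_Hinf:
  assumes k: "integrable circle_measure k" and b: "\<And>\<zeta>. k \<zeta> \<le> b"
  shows "outer_fun k \<in> Hinf"
proof -
  have "cmod (outer_fun k z) \<le> exp b" if z: "cmod z < 1" for z
  proof -
    have "(\<integral>\<zeta>. poisson z \<zeta> * k \<zeta> \<partial>circle_measure) \<le> (\<integral>\<zeta>. poisson z \<zeta> * b \<partial>circle_measure)"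
      by (intro integral_mono mult_left_mono b poisson_nonneg z integrable_poisson_mult_real k
        integrable_mult_left poisson_integral_1)
    then show ?thesis unfolding cmod_outer_fun[OF k z] using poisson_integral_1[OF z] by simp
  qed
  then show ?thesis using outer_fun_holomorphic[OF k] by (intro HinfI)
qed

text \<open>Only the modulus is treated: its logarithm is the Poisson integral of k, whereas the
  argument is a conjugate function. Limits of the function itself come from \<open>Fatou\<close> or
  \<open>Smirnov_nt_limit\<close>.\<close>

lemma cmod_outer_fun_nt_limit:
  assumes k: "integrable circle_measure k"
  shows "AE \<zeta> in circle_measure. \<forall>\<alpha>>1.
    ((\<lambda>z. cmod (outer_fun k z)) \<longlongrightarrow> exp (k \<zeta>)) (at \<zeta> within Stolz \<alpha> \<zeta>)"
proof -
  have "integrable circle_measure (\<lambda>\<zeta>. complex_of_real (k \<zeta>))" using k by simp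
  from poisson_nt_limit[OF this] show ?thesis
  proof eventually_elim
    fix \<zeta>
    assume a: "has_nt_limit (\<lambda>z. \<integral>\<zeta>. poisson z \<zeta> * complex_of_real (k \<zeta>) \<partial>circle_measure) \<zeta> (complex_of_real (k \<zeta>))"
    have "(\<lambda>z. \<integral>\<zeta>. poisson z \<zeta> * complex_of_real (k \<zeta>) \<partial>circle_measure)
      = (\<lambda>z. complex_of_real (\<integral>\<zeta>. poisson z \<zeta> * k \<zeta> \<partial>circle_measure))"
      by (simp only: of_real_mult[symmetric] integral_complex_of_real)
    with a have "((\<lambda>z. exp (\<integral>\<zeta>. poisson z \<zeta> * k \<zeta> \<partial>circle_measure)) \<longlongrightarrow> exp (k \<zeta>)) (at \<zeta> within Stolz \<alpha> \<zeta>)"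
      if "\<alpha> > 1" for \<alpha>
      using that unfolding has_nt_limit_def by (intro tendsto_exp) (simp only: tendsto_of_real_iff)
    then show "\<forall>\<alpha>>1. ((\<lambda>z. cmod (outer_fun k z)) \<longlongrightarrow> exp (k \<zeta>)) (at \<zeta> within Stolz \<alpha> \<zeta>)"
      by (subst tendsto_Stolz_cong[OF cmod_outer_fun[OF k]]) auto
  qed
qed

lemma outer_bdry:
  assumes h: "h \<in> Hinf" and k: "integrable circle_measure k"
    and c: "cmod c = 1" "\<And>z. cmod z < 1 \<Longrightarrow> h z = c * outer_fun k z"
  shows "AE \<zeta> in circle_measure. cmod (bdry h \<zeta>) = exp (k \<zeta>)"
  using Fatou[OF h] cmod_outer_fun_nt_limit[OF k] AE_circle_norm
proof eventually_elim
  fix \<zeta> :: complex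
  assume a: "has_nt_limit h \<zeta> (bdry h \<zeta>)" "\<forall>\<alpha>>1. ((\<lambda>z. cmod (outer_fun k z)) \<longlongrightarrow> exp (k \<zeta>)) (at \<zeta> within Stolz \<alpha> \<zeta>)"
    "cmod \<zeta> = 1"
  have "((\<lambda>z. cmod (h z)) \<longlongrightarrow> cmod (bdry h \<zeta>)) (at \<zeta> within Stolz 2 \<zeta>)"
    by (intro tendsto_norm has_nt_limitD a)
  moreover have "((\<lambda>z. cmod (h z)) \<longlongrightarrow> exp (k \<zeta>)) (at \<zeta> within Stolz 2 \<zeta>)"
    using a(2) by (subst tendsto_Stolz_cong[where g="\<lambda>z. cmod (outer_fun k z)"]) (auto simp: c norm_mult)
  ultimately show "cmod (bdry h \<zeta>) = exp (k \<zeta>)"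
    by (rule tendsto_unique[OF nt_nontrivial[OF a(3)], rotated]) simp
qed

section \<open>Quotients with outer denominator\<close>

lemma Smirnov_quotient:
  assumes "f \<in> Smirnov"
  shows "\<exists>g\<in>Hinf. \<exists>h\<in>Hinf. \<exists>c k. cmod c = 1 \<and> integrable circle_measure k \<and>
    (\<forall>z. cmod z < 1 \<longrightarrow> h z = c * outer_fun k z) \<and> (\<forall>z. cmod z < 1 \<longrightarrow> f z = g z / h z)"
  using assms unfolding Smirnov_def outer_iff Ball_def mem_ball_0 by blast

text \<open>The boundary modulus exp (k \<zeta>) of the outer denominator is nonzero almost
  everywhere, so the limits of numerator and denominator can be divided.\<close>

lemma Smirnov_nt_limit:
  assumes "f \<in> Smirnov"
  shows "AE \<zeta> in circle_measure. has_nt_limit f \<zeta> (bdry f \<zeta>)"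
proof -
  obtain g h c k where *: "g \<in> Hinf" "h \<in> Hinf" "cmod c = 1" "integrable circle_measure k"
    and hk: "\<And>z. cmod z < 1 \<Longrightarrow> h z = c * outer_fun k z" and f: "\<And>z. cmod z < 1 \<Longrightarrow> f z = g z / h z"
    using Smirnov_quotient[OF assms] by auto
  have "AE \<zeta> in circle_measure. cmod (bdry h \<zeta>) = exp (k \<zeta>)"
    by (rule outer_bdry[OF *(2,4,3)]) (rule hk)
  with Fatou[OF *(1)] Fatou[OF *(2)] AE_circle_norm show ?thesis
  proof eventually_elim
    fix \<zeta> :: complex
    assume a: "has_nt_limit g \<zeta> (bdry g \<zeta>)" "has_nt_limit h \<zeta> (bdry h \<zeta>)"
      "cmod \<zeta> = 1" "cmod (bdry h \<zeta>) = exp (k \<zeta>)"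
    have "bdry h \<zeta> \<noteq> 0" using a(4) by auto
    then have "has_nt_limit f \<zeta> (bdry g \<zeta> / bdry h \<zeta>)"
      using a by (subst has_nt_limit_cong[OF f]) (auto intro: has_nt_limit_divide)
    then show "has_nt_limit f \<zeta> (bdry f \<zeta>)" using bdry_eq[OF _ a(3)] by simp
  qed
qed

lemma Smirnov_bdry_mult:
  assumes "f \<in> Smirnov" "g \<in> Smirnov"
  shows "AE \<zeta> in circle_measure. bdry (\<lambda>z. f z * g z) \<zeta> = bdry f \<zeta> * bdry g \<zeta>"
  using Smirnov_nt_limit[OF assms(1)] Smirnov_nt_limit[OF assms(2)] AE_circle_norm
  by eventually_elim (intro bdry_eq has_nt_limit_mult)

text \<open>\<open>bdry\<close> is defined by description and a default value, so a Borel version is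
  produced instead, as a limit of radial dilates.\<close>

lemma Smirnov_bdry_measurable:
  assumes f: "f \<in> Smirnov"
  obtains b where "b \<in> borel_measurable borel" "AE \<zeta> in circle_measure. bdry f \<zeta> = b \<zeta>"
proof
  define r where "r = (\<lambda>n. 1 - 1 / real (n + 2))"
  have r: "\<bar>r n\<bar> < 1" for n by (simp add: r_def field_simps)
  \<comment> \<open>Off the circle the dilated point may leave the disk, where nothing is known
    about f; the value there is set to 0.\<close>
  define F where "F = (\<lambda>n \<zeta>. if \<zeta> \<in> sphere 0 1 then f (of_real (r n) * \<zeta>) else 0)"
  have cf: "continuous_on (ball 0 1) f"
    using f by (auto simp: Smirnov_def Hol_disk_def intro: holomorphic_on_imp_continuous_on)
  have "F n \<in> borel_measurable borel" for n
    unfolding F_def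
  proof (rule borel_measurable_continuous_on_if)
    show "continuous_on (sphere 0 1) (\<lambda>\<zeta>. f (of_real (r n) * \<zeta>))"
      by (rule continuous_on_compose2[OF cf]) (auto intro!: continuous_intros simp: norm_mult r)
  qed (auto intro: borel_closed)
  then show "(\<lambda>\<zeta>. lim (\<lambda>n. F n \<zeta>)) \<in> borel_measurable borel"
    by (rule borel_measurable_lim_metric)
  show "AE \<zeta> in circle_measure. bdry f \<zeta> = lim (\<lambda>n. F n \<zeta>)"
    using Smirnov_nt_limit[OF f] AE_circle_norm
  proof eventually_elim
    fix \<zeta> :: complex assume a: "has_nt_limit f \<zeta> (bdry f \<zeta>)" "cmod \<zeta> = 1"
    have "(\<lambda>n. F n \<zeta>) \<longlonglongrightarrow> bdry f \<zeta>" using has_nt_limit_radial[OF a] a(2) by (simp add: F_def r_def)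
    then show "bdry f \<zeta> = lim (\<lambda>n. F n \<zeta>)" by (simp add: limI)
  qed
qed

lemma Hinf_mult: "f \<in> Hinf \<Longrightarrow> g \<in> Hinf \<Longrightarrow> (\<lambda>z. f z * g z) \<in> Hinf"
proof -
  assume f: "f \<in> Hinf" and g: "g \<in> Hinf"
  obtain A where A: "\<And>z. cmod z < 1 \<Longrightarrow> cmod (f z) \<le> A" using Hinf_bounded[OF f] by auto
  obtain B where B: "\<And>z. cmod z < 1 \<Longrightarrow> cmod (g z) \<le> B" using Hinf_bounded[OF g] by auto
  have "cmod (f z * g z) \<le> A * B" if "cmod z < 1" for z
    unfolding norm_mult using A[OF that] B[OF that] order_trans[OF norm_ge_zero A[OF that]]
    by (intro mult_mono) auto
  then show ?thesis using f g
    by (intro HinfI) (auto simp: Hinf_def Hol_disk_def intro!: holomorphic_intros)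
qed

lemma Smirnov_mult_Hinf:
  assumes "g \<in> Hinf" "f \<in> Smirnov"
  shows "(\<lambda>z. g z * f z) \<in> Smirnov"
proof -
  obtain u h where u: "u \<in> Hinf" "h \<in> Hinf" "outer h" "\<forall>z\<in>ball 0 1. f z = u z / h z" "f \<in> Hol_disk"
    using assms(2) by (auto simp: Smirnov_def)
  have "(\<lambda>z. g z * f z) \<in> Hol_disk"
    using assms u by (auto simp: Hinf_def Hol_disk_def intro!: holomorphic_intros)
  moreover have "(\<lambda>z. g z * u z) \<in> Hinf" by (intro Hinf_mult assms u)
  ultimately show ?thesis unfolding Smirnov_def using u by (intro CollectI conjI bexI[of _ "\<lambda>z. g z * u z"] bexI[of _ h]) auto
qed

text \<open>The lower bound on k makes the outer function of - k bounded, and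
  \<open>outer_fun k\<close> is its reciprocal.\<close>

lemma outer_fun_Smirnov:
  assumes k: "integrable circle_measure k" and b: "\<And>\<zeta>. b \<le> k \<zeta>"
  shows "outer_fun k \<in> Smirnov"
proof -
  let ?h = "outer_fun (\<lambda>\<zeta>. - k \<zeta>)"
  have h: "?h \<in> Hinf" by (rule outer_fun_Hinf[where b="-b"]) (use k b in auto)
  have 1: "(\<lambda>_. 1) \<in> Hinf" by (auto simp: Hinf_def Hol_disk_def bounded_iff)
  have o: "outer ?h" unfolding outer_iff using k by (intro exI[of _ 1] exI[of _ "\<lambda>\<zeta>. - k \<zeta>"]) simp
  show ?thesis unfolding Smirnov_def
    using h o 1 outer_fun_holomorphic[OF k] outer_fun_minus[of k]
    by (intro CollectI conjI bexI[of _ "\<lambda>_. 1"] bexI[of _ ?h]) (auto simp: Hol_disk_def divide_inverse)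
qed

lemma outer_fun_bdry:
  assumes k: "integrable circle_measure k" and b: "\<And>\<zeta>. b \<le> k \<zeta>"
  shows "AE \<zeta> in circle_measure. cmod (bdry (outer_fun k) \<zeta>) = exp (k \<zeta>)"
  using Smirnov_nt_limit[OF outer_fun_Smirnov[OF k b]] cmod_outer_fun_nt_limit[OF k] AE_circle_norm
proof eventually_elim
  fix \<zeta> :: complex
  assume a: "has_nt_limit (outer_fun k) \<zeta> (bdry (outer_fun k) \<zeta>)"
    "\<forall>\<alpha>>1. ((\<lambda>z. cmod (outer_fun k z)) \<longlongrightarrow> exp (k \<zeta>)) (at \<zeta> within Stolz \<alpha> \<zeta>)" "cmod \<zeta> = 1"
  have "((\<lambda>z. cmod (outer_fun k z)) \<longlongrightarrow> cmod (bdry (outer_fun k) \<zeta>)) (at \<zeta> within Stolz 2 \<zeta>)"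
    by (intro tendsto_norm has_nt_limitD a)
  moreover have "((\<lambda>z. cmod (outer_fun k z)) \<longlongrightarrow> exp (k \<zeta>)) (at \<zeta> within Stolz 2 \<zeta>)"
    using a(2) by simp
  ultimately show "cmod (bdry (outer_fun k) \<zeta>) = exp (k \<zeta>)"
    by (rule tendsto_unique[OF nt_nontrivial[OF a(3)], rotated]) simp
qed

text \<open>
  Replacing \<open>k\<close> by \<open>max k (- n)\<close> in the outer denominator makes the quotient bounded, which reduces
  the claim to \<open>Hinf_bound_bdry\<close>; dominated convergence then removes the truncation.
\<close>

lemma Smirnov_bound_bdry:
  assumes f: "f \<in> Smirnov" and C: "AE \<zeta> in circle_measure. cmod (bdry f \<zeta>) \<le> C" and z: "cmod z < 1"
  shows "cmod (f z) \<le> C"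
proof -
  obtain g h c k where *: "g \<in> Hinf" "h \<in> Hinf" "cmod c = 1" and k: "integrable circle_measure k"
    and hk: "\<And>z. cmod z < 1 \<Longrightarrow> h z = c * outer_fun k z" and fgh: "\<And>z. cmod z < 1 \<Longrightarrow> f z = g z / h z"
    using Smirnov_quotient[OF f] by auto
  define kn where "kn = (\<lambda>n \<zeta>. max (k \<zeta>) (- real n))"
  have kni: "integrable circle_measure (kn n)" for n
    unfolding kn_def by (rule Bochner_Integration.integrable_max[OF k]) simp
  have kni': "integrable circle_measure (\<lambda>\<zeta>. - kn n \<zeta>)" for n using kni by simp
  have oH: "outer_fun (\<lambda>\<zeta>. - kn n \<zeta>) \<in> Hinf" for n
    by (rule outer_fun_Hinf[where b="real n", OF kni']) (simp add: kn_def)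
  have ob: "AE \<zeta> in circle_measure. cmod (bdry h \<zeta>) = exp (k \<zeta>)"
    by (rule outer_bdry[OF *(2) k *(3)]) (rule hk)
  have ob': "AE \<zeta> in circle_measure. cmod (bdry (outer_fun (\<lambda>\<zeta>. - kn n \<zeta>)) \<zeta>) = exp (- kn n \<zeta>)" for n
    by (rule outer_bdry[OF oH kni', of 1]) auto
  have bound: "cmod (g z) \<le> C * exp (\<integral>\<zeta>. poisson z \<zeta> * kn n \<zeta> \<partial>circle_measure)" for n
  proof -
    let ?B = "\<lambda>z. g z * outer_fun (\<lambda>\<zeta>. - kn n \<zeta>) z"
    have B: "?B \<in> Hinf" by (intro Hinf_mult * oH)
    have "AE \<zeta> in circle_measure. cmod (bdry ?B \<zeta>) \<le> C"
      using Fatou[OF *(1)] Fatou[OF *(2)] Fatou[OF oH[of n]] ob ob'[of n] AE_circle_norm C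
    proof eventually_elim
      fix \<zeta> :: complex
      assume a: "has_nt_limit g \<zeta> (bdry g \<zeta>)" "has_nt_limit h \<zeta> (bdry h \<zeta>)"
        "has_nt_limit (outer_fun (\<lambda>\<zeta>. - kn n \<zeta>)) \<zeta> (bdry (outer_fun (\<lambda>\<zeta>. - kn n \<zeta>)) \<zeta>)"
        "cmod (bdry h \<zeta>) = exp (k \<zeta>)" "cmod (bdry (outer_fun (\<lambda>\<zeta>. - kn n \<zeta>)) \<zeta>) = exp (- kn n \<zeta>)"
        "cmod \<zeta> = 1" "cmod (bdry f \<zeta>) \<le> C"
      have h0: "bdry h \<zeta> \<noteq> 0" using a(4) by auto
      have "bdry f \<zeta> = bdry g \<zeta> / bdry h \<zeta>"
        using a h0 by (intro bdry_eq) (auto simp: has_nt_limit_cong[OF fgh] intro: has_nt_limit_divide)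
      then have 1: "cmod (bdry g \<zeta>) \<le> C * exp (k \<zeta>)"
        using a by (simp add: norm_divide field_simps)
      have "bdry ?B \<zeta> = bdry g \<zeta> * bdry (outer_fun (\<lambda>\<zeta>. - kn n \<zeta>)) \<zeta>"
        using a by (intro bdry_eq has_nt_limit_mult)
      then have "cmod (bdry ?B \<zeta>) = cmod (bdry g \<zeta>) * exp (- kn n \<zeta>)"
        using a by (simp add: norm_mult)
      also have "\<dots> \<le> C * exp (k \<zeta>) * exp (- kn n \<zeta>)" using 1 by (intro mult_right_mono) auto
      also have "\<dots> = C * exp (k \<zeta> - kn n \<zeta>)" by (simp add: mult_exp_exp)
      \<comment> \<open>The truncation only raises k, so the exponent is nonpositive; C is
        nonnegative because it bounds a modulus.\<close>
      also have "\<dots> \<le> C * 1" using order_trans[OF norm_ge_zero a(7)] by (intro mult_left_mono) (auto simp: kn_def)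
      finally show "cmod (bdry ?B \<zeta>) \<le> C" by simp
    qed
    from Hinf_bound_bdry[OF B this z]
    show ?thesis using z by (simp add: norm_mult cmod_outer_fun[OF kni'] exp_minus field_simps)
  qed
  have [measurable]: "k \<in> borel_measurable circle_measure" "kn n \<in> borel_measurable circle_measure" for n
    using k kni by (auto intro: borel_measurable_integrable)
  have "(\<lambda>n. \<integral>\<zeta>. poisson z \<zeta> * kn n \<zeta> \<partial>circle_measure) \<longlonglongrightarrow> (\<integral>\<zeta>. poisson z \<zeta> * k \<zeta> \<partial>circle_measure)"
  proof (rule integral_dominated_convergence)
    show "integrable circle_measure (\<lambda>\<zeta>. poisson z \<zeta> * \<bar>k \<zeta>\<bar>)"
      using k by (intro integrable_poisson_mult_real z integrable_abs)
    show "AE \<zeta> in circle_measure. (\<lambda>n. poisson z \<zeta> * kn n \<zeta>) \<longlonglongrightarrow> poisson z \<zeta> * k \<zeta>"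
    proof (intro AE_I2 tendsto_intros)
      fix \<zeta>
      have "\<forall>\<^sub>F n in sequentially. kn n \<zeta> = k \<zeta>"
        using eventually_ge_at_top[of "nat \<lceil>- k \<zeta>\<rceil>"] by eventually_elim (auto simp: kn_def max_def; linarith)
      then show "(\<lambda>n. kn n \<zeta>) \<longlonglongrightarrow> k \<zeta>" by (rule tendsto_eventually)
    qed
    show "AE \<zeta> in circle_measure. norm (poisson z \<zeta> * kn n \<zeta>) \<le> poisson z \<zeta> * \<bar>k \<zeta>\<bar>" for n
      using poisson_nonneg[OF z] by (intro AE_I2) (auto simp: abs_mult kn_def intro!: mult_left_mono)
  qed measurable
  then have "(\<lambda>n. C * exp (\<integral>\<zeta>. poisson z \<zeta> * kn n \<zeta> \<partial>circle_measure)) \<longlonglongrightarrow> C * exp (\<integral>\<zeta>. poisson z \<zeta> * k \<zeta> \<partial>circle_measure)"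
    by (intro tendsto_intros)
  then have "cmod (g z) \<le> C * exp (\<integral>\<zeta>. poisson z \<zeta> * k \<zeta> \<partial>circle_measure)"
    using bound by (intro LIMSEQ_le_const) auto
  then show ?thesis
    by (simp add: fgh[OF z] hk[OF z] norm_divide norm_mult *(3) cmod_outer_fun[OF k z] field_simps)
qed

section \<open>The function phi\<close>

text \<open>
  \<open>phi\<close> is piecewise linear with \<open>phi (knot n) = 4 ^ 2 ^ n\<close>, and this value is also its slope on
  \<open>[knot n, knot (n + 1)]\<close>.  Since the slope never exceeds the value, shifts by a constant cost only a
  constant factor, while the super-exponential spacing keeps \<open>phi\<close> below a cubic polynomial.
\<close>

primrec knot :: "nat \<Rightarrow> real" where
  "knot 0 = 0"
| "knot (Suc n) = knot n + 4 ^ 2 ^ n - 1"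

text \<open>The supporting line of \<open>phi\<close> at the knot, with zero at knot n - 1. Taking
  \<open>phi\<close> as the supremum of these lines and 0, not by cases, makes convexity,
  monotonicity and lower bounds immediate; only upper bounds require comparing lines.\<close>

definition seg :: "nat \<Rightarrow> real \<Rightarrow> real" where
  "seg n t = 4 ^ 2 ^ n * (1 + t - knot n)"

definition phi :: "real \<Rightarrow> real" where
  "phi t = (SUP n. max 0 (seg n t))"

lemma four_le_pow: "(4::real) \<le> 4 ^ 2 ^ n"
  using power_increasing[of 1 "2 ^ n" "4::real"] by simp

lemma pow_Suc_square: "(4::real) ^ 2 ^ Suc n = (4 ^ 2 ^ n)\<^sup>2"
  by (simp add: power2_eq_square mult_2 power_add)

lemma knot_Suc_ge: "knot n + 3 \<le> knot (Suc n)"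
  using four_le_pow[of n] by simp

lemma knot_ge: "real n \<le> knot n"
proof (induction n)
  case (Suc n)
  then show ?case using knot_Suc_ge[of n] by simp
qed simp

lemma knot_mono: "m \<le> n \<Longrightarrow> knot m \<le> knot n"
proof (rule lift_Suc_mono_le)
  show "knot n \<le> knot (Suc n)" for n using knot_Suc_ge[of n] by linarith
qed

text \<open>Consecutive lines cross exactly at knot (Suc n): the choice of the gap in
  \<open>knot\<close> makes the steeper one start at the square of the previous slope.\<close>

lemma seg_Suc_diff: "seg (Suc n) t - seg n t = (4 ^ 2 ^ Suc n - 4 ^ 2 ^ n) * (t - knot (Suc n))"
  unfolding seg_def pow_Suc_square by (simp add: algebra_simps power2_eq_square)

text \<open>Since knot n \<ge> n, all but finitely many lines are nonpositive at t. The resulting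
  bound makes the supremum in \<open>phi\<close> a genuine one.\<close>

lemma seg_le_max: "max 0 (seg n t) \<le> 4 ^ 2 ^ (nat \<lceil>\<bar>t\<bar>\<rceil> + 1) * (1 + \<bar>t\<bar>)"
proof (cases "n \<le> nat \<lceil>\<bar>t\<bar>\<rceil> + 1")
  case True
  have "0 \<le> knot n" using knot_ge[of n] by linarith
  then have "seg n t \<le> 4 ^ 2 ^ n * (1 + \<bar>t\<bar>)" unfolding seg_def by (intro mult_left_mono) auto
  also have "\<dots> \<le> 4 ^ 2 ^ (nat \<lceil>\<bar>t\<bar>\<rceil> + 1) * (1 + \<bar>t\<bar>)"
    using True by (intro mult_right_mono power_increasing) auto
  finally show ?thesis by simp
next
  case False
  then have "1 + t \<le> real n" by linarith
  then have "seg n t \<le> 0" using knot_ge[of n] unfolding seg_def by (intro mult_nonneg_nonpos) auto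
  then show ?thesis by simp
qed

lemma bdd_above_seg: "bdd_above (range (\<lambda>n. max 0 (seg n t)))"
  by (rule bdd_aboveI2[OF seg_le_max])

lemma seg_le_phi: "seg n t \<le> phi t"
  unfolding phi_def by (rule order_trans[OF max.cobounded2 cSUP_upper[OF UNIV_I bdd_above_seg]])

lemma phi_nonneg: "0 \<le> phi t"
  unfolding phi_def by (rule order_trans[OF max.cobounded1 cSUP_upper[OF UNIV_I bdd_above_seg]])

lemma phi_leI: "0 \<le> c \<Longrightarrow> (\<And>n. seg n t \<le> c) \<Longrightarrow> phi t \<le> c"
  unfolding phi_def by (rule cSUP_least) auto

lemma phi_mono: "s \<le> t \<Longrightarrow> phi s \<le> phi t"
proof (rule phi_leI[OF phi_nonneg])
  fix n assume "s \<le> t"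
  then have "seg n s \<le> seg n t" unfolding seg_def by (intro mult_left_mono) auto
  then show "seg n s \<le> phi t" using seg_le_phi by (rule order_trans)
qed

lemma phi_measurable [measurable]: "phi \<in> borel_measurable borel"
  by (rule borel_measurable_mono) (simp add: mono_def phi_mono)

lemma phi_convex: "convex_on UNIV phi"
proof (rule convex_onI)
  fix u x y :: real assume u: "0 < u" "u < 1"
  show "phi ((1 - u) *\<^sub>R x + u *\<^sub>R y) \<le> (1 - u) * phi x + u * phi y"
  proof (rule phi_leI)
    show "0 \<le> (1 - u) * phi x + u * phi y" using u phi_nonneg by simp
    fix n
    have "seg n ((1 - u) *\<^sub>R x + u *\<^sub>R y) = (1 - u) * seg n x + u * seg n y"
      by (simp add: seg_def algebra_simps)
    also have "\<dots> \<le> (1 - u) * phi x + u * phi y"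
      using u by (intro add_mono mult_left_mono seg_le_phi) auto
    finally show "seg n ((1 - u) *\<^sub>R x + u *\<^sub>R y) \<le> (1 - u) * phi x + u * phi y" .
  qed
qed simp

text \<open>Turns integrability of phi (k) into that of k, as needed to form the outer
  function.\<close>

lemma phi_ge_self: "t \<le> phi t"
proof (cases "t \<ge> 0")
  case True
  then have "t \<le> seg 0 t" by (simp add: seg_def)
  then show ?thesis using seg_le_phi by (rule order_trans)
qed (use phi_nonneg[of t] in linarith)

lemma phi_superlinear: "filterlim (\<lambda>t. phi t / t) at_top at_top"
  unfolding filterlim_at_top
proof
  fix Z :: real
  obtain n where n: "max Z 0 + 1 \<le> 4 ^ 2 ^ n"
  proof -
    obtain m :: nat where m: "max Z 0 + 1 < 2 ^ m" using real_arch_pow[of 2 "max Z 0 + 1"] by auto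
    have "(2::real) ^ m \<le> 2 ^ 2 ^ m" by (intro power_increasing less_imp_le[OF less_exp]) auto
    also have "\<dots> \<le> 4 ^ 2 ^ m" by (intro power_mono) auto
    finally show ?thesis using m that[of m] by simp
  qed
  \<comment> \<open>A line of slope at least max Z 0 + 1 has one unit of slope to spare, and beyond
    \<open>T\<close> this surplus absorbs the offset (max Z 0 + 1) * knot n.\<close>
  define T where "T = max 1 ((max Z 0 + 1) * knot n)"
  have k0: "0 \<le> knot n" using knot_ge[of n] by linarith
  have "Z \<le> phi t / t" if "t \<ge> T" for t
  proof -
    have t: "t \<ge> 1" "(max Z 0 + 1) * knot n \<le> t" using that by (auto simp: T_def)
    have "0 \<le> t - knot n"
      using t(2) mult_right_mono[of 1 "max Z 0 + 1" "knot n"] k0 by simp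
    then have "(max Z 0 + 1) * (t - knot n) \<le> 4 ^ 2 ^ n * (1 + t - knot n)"
      using n by (intro mult_mono) auto
    also have "\<dots> \<le> phi t" using seg_le_phi[of n t] by (simp add: seg_def)
    finally have "max Z 0 * t \<le> phi t" using t by (simp add: algebra_simps)
    moreover have "Z * t \<le> max Z 0 * t" using t by (intro mult_right_mono) auto
    ultimately have "Z * t \<le> phi t" by linarith
    then show ?thesis using t by (simp add: field_simps)
  qed
  then show "\<forall>\<^sub>F t in at_top. Z \<le> phi t / t"
    unfolding eventually_at_top_linorder by blast
qed

lemma phi_strongly_convex: "strongly_convex phi"
  unfolding strongly_convex_def mono_def
  by (intro conjI allI impI phi_nonneg phi_convex phi_mono phi_superlinear)

text \<open>By \<open>seg_Suc_diff\<close> the values of the lines at knot m decrease as the index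
  moves away from m in either direction, so the line m attains the supremum.\<close>

lemma phi_knot_le: "phi (knot m) \<le> 4 ^ 2 ^ m"
proof (rule phi_leI)
  have "seg n (knot m) \<le> seg m (knot m)" for n
  proof (induction "nat \<bar>int n - int m\<bar>" arbitrary: n)
    case 0 then show ?case by simp
  next
    case (Suc k)
    show ?case
    proof (cases "n < m")
      case True
      then have "seg (Suc n) (knot m) \<le> seg m (knot m)" using Suc by (intro Suc(1)) auto
      moreover have "0 \<le> seg (Suc n) (knot m) - seg n (knot m)"
        unfolding seg_Suc_diff using True knot_mono[of "Suc n" m]
        by (intro mult_nonneg_nonneg) (auto intro: power_increasing)
      ultimately show ?thesis by simp
    next
      case False
      with Suc(2) obtain n' where n': "n = Suc n'" "n' \<ge> m" by (cases n) auto
      then have "seg n' (knot m) \<le> seg m (knot m)" using Suc by (intro Suc(1)) auto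
      moreover have "seg (Suc n') (knot m) - seg n' (knot m) \<le> 0"
        unfolding seg_Suc_diff using n' knot_mono[of m "Suc n'"]
        by (intro mult_nonneg_nonpos) (auto intro: power_increasing)
      ultimately show ?thesis using n' by simp
    qed
  qed
  then show "seg n (knot m) \<le> 4 ^ 2 ^ m" for n by (simp add: seg_def)
qed simp

lemma phi_knot_add: "4 ^ 2 ^ m * (1 + a) \<le> phi (knot m + a)"
  using seg_le_phi[of m "knot m + a"] by (simp add: seg_def)

text \<open>Each line is compared with phi t. To the right of its knot the shift at most triples it.
  To the left its shifted value is at most 3 * p with p = 4 ^ 2 ^ n, and nonpositive if t is at
  least 3 before the knot. In between, the previous line, of slope q with q^2 = p, has already
  reached q * (q - 3), which is at least p / 4 because q \<ge> 4. The additive 12 = 3 * 4 covers the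
  line n = 0, which has no predecessor.\<close>

lemma phi_Delta2: "phi (t + 2) \<le> 12 * phi t + 12"
proof (rule phi_leI)
  show "0 \<le> 12 * phi t + 12" using phi_nonneg[of t] by simp
  fix n
  let ?p = "4 ^ 2 ^ n :: real"
  show "seg n (t + 2) \<le> 12 * phi t + 12"
  proof (cases "knot n \<le> t")
    case True
    then have "?p * (1 + (t + 2) - knot n) \<le> ?p * (3 * (1 + t - knot n))" by (intro mult_left_mono) auto
    then have "seg n (t + 2) \<le> 3 * seg n t" by (simp add: seg_def)
    then show ?thesis using seg_le_phi[of n t] phi_nonneg[of t] by linarith
  next
    case False
    have le3: "seg n (t + 2) \<le> ?p * 3" unfolding seg_def using False by (intro mult_left_mono) auto
    show ?thesis
    proof (cases n)
      case 0
      then show ?thesis using le3 phi_nonneg[of t] by simp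
    next
      case (Suc m)
      let ?q = "4 ^ 2 ^ m :: real"
      show ?thesis
      proof (cases "t \<le> knot n - 3")
        case True
        then have "seg n (t + 2) \<le> 0" unfolding seg_def by (intro mult_nonneg_nonpos) auto
        then show ?thesis using phi_nonneg[of t] by simp
      next
        case False
        then have "?q - 3 \<le> 1 + t - knot m" using Suc by simp
        then have "?q * (?q - 3) \<le> seg m t" unfolding seg_def by (intro mult_left_mono) auto
        then have "?q * (?q - 3) \<le> phi t" using seg_le_phi[of m t] by linarith
        moreover have "?q * (?q * 1) \<le> ?q * (4 * (?q - 3))"
          using four_le_pow[of m] by (intro mult_left_mono) auto
        moreover have "?q * (4 * (?q - 3)) = 4 * (?q * (?q - 3))" by simp
        ultimately have "?q\<^sup>2 \<le> 4 * phi t" unfolding power2_eq_square by linarith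
        then have "?p * 3 \<le> 12 * phi t" unfolding Suc pow_Suc_square by simp
        then show ?thesis using le3 by linarith
      qed
    qed
  qed
qed

text \<open>The last gap alone places knot (Suc m) at q - 1 or beyond, where q^2 is the new slope.
  The factor 4 is for n = 0, with slope 4 at knot 0.\<close>

lemma pow_le_knot: "4 ^ 2 ^ n \<le> 4 * (1 + knot n)\<^sup>2"
proof (cases n)
  case (Suc m)
  have "(4 ^ 2 ^ m)\<^sup>2 \<le> (1 + knot n)\<^sup>2"
    using knot_ge[of m] Suc by (intro power_mono) auto
  also have "\<dots> \<le> 4 * (1 + knot n)\<^sup>2" by simp
  finally show ?thesis unfolding Suc pow_Suc_square .
qed simp

text \<open>A line positive at t has its knot at most at t + 1, so its slope is quadratic in t;
  multiplication by the distance from its zero gives the cube.\<close>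

lemma phi_le_cube:
  assumes "0 \<le> t"
  shows "phi t \<le> 4 * (t + 2) ^ 3"
proof (rule phi_leI)
  fix n
  have k0: "0 \<le> knot n" using knot_ge[of n] by linarith
  show "seg n t \<le> 4 * (t + 2) ^ 3"
  proof (cases "knot n \<le> t + 1")
    case True
    have "seg n t \<le> 4 * (1 + knot n)\<^sup>2 * (1 + t - knot n)"
      unfolding seg_def using True by (intro mult_right_mono pow_le_knot) auto
    also have "\<dots> \<le> 4 * (t + 2)\<^sup>2 * (t + 2)"
      using True k0 assms by (intro mult_mono power_mono) auto
    finally show ?thesis by (simp add: power3_eq_cube power2_eq_square)
  next
    case False
    then have "seg n t \<le> 0" unfolding seg_def by (intro mult_nonneg_nonpos) auto
    also have "0 \<le> 4 * (t + 2) ^ 3" using assms by simp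
    finally show ?thesis .
  qed
qed (use assms in simp)

lemma phi_tilde_Delta2: "tilde_Delta2 phi"
  unfolding tilde_Delta2_def
  by (rule exI[of _ 12], intro conjI, simp, rule exI[of _ 12]) (simp add: phi_Delta2)

lemma phi_add_le: "\<exists>M\<ge>0. \<forall>t. phi (t + a) \<le> M * (phi t + 1)"
proof -
  have "\<exists>M\<ge>0. \<forall>t. phi (t + 2 * real n) \<le> M * (phi t + 1)" for n
  proof (induction n)
    case 0 then show ?case by (intro exI[of _ 1]) auto
  next
    case (Suc n)
    then obtain M where M: "M \<ge> 0" "\<And>t. phi (t + 2 * real n) \<le> M * (phi t + 1)" by auto
    have "phi (t + 2 * real (Suc n)) \<le> (12 * M + 12) * (phi t + 1)" for t
    proof -
      have "phi (t + 2 * real (Suc n)) \<le> 12 * phi (t + 2 * real n) + 12"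
        using phi_Delta2[of "t + 2 * real n"] by (simp add: algebra_simps)
      also have "\<dots> \<le> 12 * (M * (phi t + 1)) + 12 * (phi t + 1)"
        using M(2)[of t] phi_nonneg[of t] by simp
      finally show ?thesis by (simp add: algebra_simps)
    qed
    then show ?case using M by (intro exI[of _ "12 * M + 12"]) auto
  qed
  note * = this
  obtain n where "a / 2 \<le> real n" using real_arch_simple[of "a / 2"] by auto
  then have "a \<le> 2 * real n" by simp
  then show ?thesis using *[of n] by (meson phi_mono add_left_mono order_trans)
qed

text \<open>The cubic is eventually below the prescribed values of \<psi>. For smaller t, where
  \<psi> is only known to be nonnegative, monotonicity bounds \<open>phi\<close> by a
  constant.\<close>

lemma phi_le_phi_beta:
  assumes \<beta>: "\<beta> > 1" and \<psi>: "is_phi_beta \<beta> \<psi>"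
  shows "\<exists>K\<ge>0. \<forall>t. phi t \<le> \<psi> t + K"
proof -
  have "\<forall>\<^sub>F t in at_top. 4 * (t + 2) ^ 3 \<le> exp (ln t powr \<beta>)"
    using \<beta> by real_asymp
  moreover have "\<forall>\<^sub>F t in at_top. \<psi> t = exp (ln t powr \<beta>)" using \<psi> by (simp add: is_phi_beta_def)
  ultimately have "\<forall>\<^sub>F t in at_top. phi t \<le> \<psi> t"
    using eventually_ge_at_top[of 0] by eventually_elim (metis phi_le_cube order_trans)
  then obtain T where T: "\<And>t. t \<ge> T \<Longrightarrow> phi t \<le> \<psi> t" by (auto simp: eventually_at_top_linorder)
  have "phi t \<le> \<psi> t + phi T" for t
  proof (cases "t \<ge> T")
    case True then show ?thesis using T[OF True] phi_nonneg[of T] by simp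
  next
    case False
    then have "phi t \<le> phi T" by (intro phi_mono) simp
    moreover have "0 \<le> \<psi> t" using \<psi> by (simp add: is_phi_beta_def strongly_convex_def)
    ultimately show ?thesis by simp
  qed
  then show ?thesis using phi_nonneg by blast
qed

section \<open>Multipliers\<close>

lemma cis_arc_sets: "cis ` {a..b} \<in> sets borel"
  by (intro borel_compact compact_continuous_image continuous_intros) auto

text \<open>The exact value is (b - a) / (2*pi); the cruder bound gives the Lipschitz continuity
  used in \<open>circle_subset_of_measure\<close>.\<close>

lemma emeasure_circle_arc:
  assumes "0 \<le> a" "a \<le> b" "b \<le> 2*pi"
  shows "emeasure circle_measure (cis ` {a..b}) \<le> ennreal (b - a)"
proof -
  have "emeasure circle_measure (cis ` {a..b}) = (\<integral>\<^sup>+\<zeta>. indicator (cis ` {a..b}) \<zeta> \<partial>circle_measure)"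
    using cis_arc_sets by simp
  also have "\<dots> = (\<integral>\<^sup>+t. indicator (cis ` {a..b}) (cis t) * indicator {0..2*pi} t \<partial>lborel) / ennreal (2*pi)"
    using cis_arc_sets by (intro nn_integral_circle) auto
  also have "\<dots> \<le> (\<integral>\<^sup>+t. indicator {a..b} t \<partial>lborel) / ennreal (2*pi)"
  proof (intro divide_right_mono_ennreal nn_integral_mono_AE)
    \<comment> \<open>The angles 0 and 2*pi share one image, so only off them does membership of cis
      t in the arc force t into the interval.\<close>
    have "AE t in lborel. t \<noteq> 0" "AE t in lborel. t \<noteq> 2*pi" by (rule AE_lborel_singleton)+
    then show "AE t in lborel. indicator (cis ` {a..b}) (cis t) * indicator {0..2*pi} t \<le> (indicator {a..b} t :: ennreal)"
    proof eventually_elim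
      fix t :: real assume t: "t \<noteq> 0" "t \<noteq> 2*pi"
      have "t \<in> {a..b}" if h: "t \<in> {0..2*pi}" "cis t \<in> cis ` {a..b}"
      proof -
        obtain s where s: "s \<in> {a..b}" "cis t = cis s" using h(2) by auto
        then have "s \<in> {0..2*pi}" using assms by auto
        then have "t = s" using cis_eq_cisD[OF s(2) h(1)] t by auto
        then show ?thesis using s by simp
      qed
      then show "indicator (cis ` {a..b}) (cis t) * indicator {0..2*pi} t \<le> (indicator {a..b} t :: ennreal)"
        by (cases "t \<in> {0..2*pi}"; cases "cis t \<in> cis ` {a..b}") simp_all
    qed
  qed
  also have "\<dots> = ennreal ((b - a) / (2*pi))" using assms by (simp add: divide_ennreal)
  also have "\<dots> \<le> ennreal ((b - a) / 1)"
    using assms pi_ge_two by (intro ennreal_leI divide_left_mono) auto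
  finally show ?thesis by simp
qed

text \<open>The measure has no atoms: the part of A in an arc of growing angle has a measure that is
  Lipschitz in the angle, and the intermediate value theorem finds v.\<close>

lemma circle_subset_of_measure:
  assumes A [measurable]: "A \<in> sets borel" and v: "0 \<le> v" "v \<le> measure circle_measure A"
  shows "\<exists>B. B \<subseteq> A \<and> B \<in> sets borel \<and> measure circle_measure B = v"
proof -
  note cis_arc_sets [measurable]
  define q where "q = (\<lambda>\<theta>. measure circle_measure (A \<inter> cis ` {0..\<theta>}))"
  have inc: "q b \<le> q a + (b - a)" if ab: "0 \<le> a" "a \<le> b" "b \<le> 2*pi" for a b
  proof -
    have "{0..b} = {0..a} \<union> {a..b}" using ab by auto
    then have "A \<inter> cis ` {0..b} \<subseteq> (A \<inter> cis ` {0..a}) \<union> cis ` {a..b}" by auto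
    then have "q b \<le> measure circle_measure ((A \<inter> cis ` {0..a}) \<union> cis ` {a..b})"
      unfolding q_def by (rule circle.finite_measure_mono) measurable
    also have "\<dots> \<le> q a + measure circle_measure (cis ` {a..b})"
      unfolding q_def by (rule measure_Un_le) measurable
    also have "measure circle_measure (cis ` {a..b}) \<le> b - a"
      using emeasure_circle_arc[OF ab] ab by (simp add: circle.emeasure_eq_measure)
    finally show ?thesis by simp
  qed
  have mono: "q a \<le> q b" if "a \<le> b" for a b
    unfolding q_def using that by (intro circle.finite_measure_mono) auto
  have "continuous_on {0..2*pi} q"
  proof (rule continuous_onI)
    fix x e :: real assume x: "x \<in> {0..2*pi}" "e > 0"
    show "\<exists>d>0. \<forall>x'\<in>{0..2*pi}. dist x' x < d \<longrightarrow> dist (q x') (q x) \<le> e"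
    proof (intro exI[of _ e] conjI ballI impI x)
      fix y assume y: "y \<in> {0..2*pi}" "dist y x < e"
      show "dist (q y) (q x) \<le> e"
        using inc[of x y] inc[of y x] mono[of x y] mono[of y x] x y
        by (cases "x \<le> y") (auto simp: dist_real_def)
    qed
  qed
  moreover have "q 0 \<le> v"
  proof -
    have "q 0 \<le> measure circle_measure (cis ` {0..0})"
      unfolding q_def by (intro circle.finite_measure_mono) auto
    also have "\<dots> \<le> 0" using emeasure_circle_arc[of 0 0] by (simp add: circle.emeasure_eq_measure)
    finally show ?thesis using v by simp
  qed
  moreover have "v \<le> q (2*pi)"
  proof -
    have "measure circle_measure A = q (2*pi)" unfolding q_def
    proof (rule measure_eq_AE)
      show "AE x in circle_measure. (x \<in> A) = (x \<in> A \<inter> cis ` {0..2*pi})"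
        using AE_circle_norm
      proof eventually_elim
        fix x :: complex assume "cmod x = 1"
        then have "x = cis (Arg2pi x)" using Arg2pi_eq[of x] by (simp add: cis_conv_exp mult.commute)
        moreover have "Arg2pi x \<in> {0..2*pi}" using Arg2pi_ge_0[of x] Arg2pi_lt_2pi[of x] by auto
        ultimately show "(x \<in> A) = (x \<in> A \<inter> cis ` {0..2*pi})" by blast
      qed
    qed measurable
    then show ?thesis using v by simp
  qed
  ultimately obtain \<theta> where "q \<theta> = v" using IVT'[of q 0 v "2*pi"] by auto
  then show ?thesis unfolding q_def by (intro exI[of _ "A \<inter> cis ` {0..\<theta>}"]) auto
qed

lemma ennreal_suminf_ge_1_eq_top:
  fixes f :: "nat \<Rightarrow> ennreal"
  assumes "\<And>j. 1 \<le> f j"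
  shows "(\<Sum>j. f j) = \<infinity>"
proof (rule ccontr)
  assume "(\<Sum>j. f j) \<noteq> \<infinity>"
  then have "(\<Sum>j. f j) < top" by (simp add: less_top)
  then obtain r where r: "(\<Sum>j. f j) = ennreal r" "r \<ge> 0" unfolding less_top_ennreal by blast
  obtain N :: nat where N: "r < real N" using reals_Archimedean2 by blast
  have "of_nat N = (\<Sum>j<N. 1 :: ennreal)" by simp
  also have "\<dots> \<le> (\<Sum>j<N. f j)" by (intro sum_mono assms)
  also have "\<dots> \<le> (\<Sum>j. f j)" by (intro sum_le_suminf) auto
  finally have "ennreal (real N) \<le> ennreal r" using r by (simp add: ennreal_of_nat_eq_real_of_nat)
  then show False using N r by (simp add: ennreal_le_iff)
qed

text \<open>With finitely many non-null layers, u would be bounded almost everywhere. The layers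
  supply the disjoint places for the sets \<open>G j\<close>.\<close>

lemma infinite_levels:
  assumes [measurable]: "u \<in> borel_measurable borel"
    and u: "\<And>C. \<not> (AE \<zeta> in circle_measure. u \<zeta> \<le> C)"
  shows "infinite {i::nat. 0 < measure circle_measure {\<zeta>. real i \<le> u \<zeta> \<and> u \<zeta> < real i + 1}}"
proof
  define F where "F = (\<lambda>i::nat. {\<zeta>. real i \<le> u \<zeta> \<and> u \<zeta> < real i + 1})"
  have Fm: "F i \<in> sets circle_measure" for i unfolding F_def by measurable
  assume "finite {i::nat. 0 < measure circle_measure {\<zeta>. real i \<le> u \<zeta> \<and> u \<zeta> < real i + 1}}"
  then have "finite {i. 0 < measure circle_measure (F i)}" by (simp only: F_def)
  then obtain B where B: "\<forall>i\<in>{i. 0 < measure circle_measure (F i)}. i < B"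
    unfolding finite_nat_set_iff_bounded ..
  have "AE \<zeta> in circle_measure. B \<le> i \<longrightarrow> \<zeta> \<notin> F i" for i
  proof (cases "B \<le> i")
    case True
    then have "\<not> 0 < measure circle_measure (F i)" using B by auto
    then have "measure circle_measure (F i) = 0" using measure_nonneg[of circle_measure "F i"] by linarith
    then have "F i \<in> null_sets circle_measure"
      using Fm by (simp add: null_sets_def circle.emeasure_eq_measure)
    then have "AE \<zeta> in circle_measure. \<zeta> \<notin> F i" by (rule AE_not_in)
    then show ?thesis by eventually_elim simp
  qed simp
  then have "AE \<zeta> in circle_measure. \<forall>i. B \<le> i \<longrightarrow> \<zeta> \<notin> F i"
    by (subst AE_all_countable) simp
  then have "AE \<zeta> in circle_measure. u \<zeta> \<le> real B"
  proof eventually_elim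
    fix \<zeta> assume a: "\<forall>i. B \<le> i \<longrightarrow> \<zeta> \<notin> F i"
    show "u \<zeta> \<le> real B"
    proof (rule ccontr)
      assume "\<not> u \<zeta> \<le> real B"
      then have "B \<le> nat \<lfloor>u \<zeta>\<rfloor>" "real (nat \<lfloor>u \<zeta>\<rfloor>) \<le> u \<zeta>" "u \<zeta> < real (nat \<lfloor>u \<zeta>\<rfloor>) + 1" by linarith+
      then have "\<zeta> \<in> F (nat \<lfloor>u \<zeta>\<rfloor>)" by (simp only: F_def mem_Collect_eq)
      with a \<open>B \<le> nat \<lfloor>u \<zeta>\<rfloor>\<close> show False by blast
    qed
  qed
  with u show False by blast
qed

text \<open>
  Since \<open>phi (knot n + a) \<ge> (1 + a) * phi (knot n)\<close>, it suffices to let \<open>k\<close> take the value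
  \<open>knot (n j)\<close> on disjoint sets \<open>G j\<close> on which \<open>u \<ge> 4 ^ j\<close> and for which \<open>phi (knot (n j))\<close> times the
  measure of \<open>G j\<close> is \<open>2 ^ - j\<close>.
\<close>

lemma unbounded_shift_diverges:
  assumes um [measurable]: "u \<in> borel_measurable borel"
    and u: "\<And>C. \<not> (AE \<zeta> in circle_measure. u \<zeta> \<le> C)"
  shows "\<exists>k \<in> borel_measurable borel. (\<forall>\<zeta>. 0 \<le> k \<zeta>) \<and>
    (\<integral>\<^sup>+\<zeta>. ennreal (phi (k \<zeta>)) \<partial>circle_measure) < \<infinity> \<and>
    (\<integral>\<^sup>+\<zeta>\<in>{\<zeta>. 0 < u \<zeta>}. ennreal (phi (k \<zeta> + u \<zeta>)) \<partial>circle_measure) = \<infinity>"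
proof -
  define F where "F = (\<lambda>i::nat. {\<zeta>. real i \<le> u \<zeta> \<and> u \<zeta> < real i + 1})"
  define J where "J = {i. 0 < measure circle_measure (F i)}"
  have Fm [measurable]: "F i \<in> sets borel" for i unfolding F_def by measurable
  have J: "infinite J" unfolding J_def F_def by (rule infinite_levels[OF um u])
  \<comment> \<open>Layer indices of at least 4 ^ j outweigh the factor 2 ^ - j and keep each term
    of the divergent series at least 1.\<close>
  define s where "s = (\<lambda>j::nat. enumerate J (4 ^ j))"
  have sJ: "s j \<in> J" for j unfolding s_def by (rule enumerate_in_set[OF J])
  have s4: "4 ^ j \<le> s j" for j unfolding s_def by (rule le_enumerate[OF J])
  have s_inj: "i = j" if "s i = s j" for i j
  proof -
    have "(4::nat) ^ i = 4 ^ j" using that strict_mono_enumerate[OF J] unfolding s_def by (simp add: strict_mono_eq)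
    then show ?thesis by simp
  qed
  have "\<exists>n G. G \<subseteq> F (s j) \<and> G \<in> sets borel \<and> measure circle_measure G = (1/2) ^ j / 4 ^ 2 ^ n" for j
  proof -
    have m: "0 < measure circle_measure (F (s j))" using sJ by (simp add: J_def)
    \<comment> \<open>However small the layer, a high enough knot makes the prescribed measure 2 ^ -
      j / 4 ^ 2 ^ n fit into it.\<close>
    obtain n :: nat where n: "(1/2) ^ j / measure circle_measure (F (s j)) < 2 ^ n"
      using real_arch_pow[of 2] by auto
    also have "(2::real) ^ n \<le> 2 ^ 2 ^ n" by (intro power_increasing less_imp_le[OF less_exp]) auto
    also have "\<dots> \<le> 4 ^ 2 ^ n" by (intro power_mono) auto
    finally have "(1/2) ^ j / 4 ^ 2 ^ n \<le> measure circle_measure (F (s j))"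
      using m by (simp add: field_simps)
    then show ?thesis using circle_subset_of_measure[OF Fm, of "(1/2) ^ j / 4 ^ 2 ^ n" "s j"] by auto
  qed
  then have "\<forall>j. \<exists>n G. G \<subseteq> F (s j) \<and> G \<in> sets borel \<and> measure circle_measure G = (1/2) ^ j / 4 ^ 2 ^ n" ..
  from choice[OF this] obtain n where
    "\<forall>j. \<exists>G. G \<subseteq> F (s j) \<and> G \<in> sets borel \<and> measure circle_measure G = (1/2) ^ j / 4 ^ 2 ^ n j" by blast
  from choice[OF this] obtain G where
    G: "\<And>j. G j \<subseteq> F (s j)" and Gm [measurable]: "\<And>j. G j \<in> sets borel"
    and mG: "\<And>j. measure circle_measure (G j) = (1/2) ^ j / 4 ^ 2 ^ n j" by blast
  have disj: "i = j" if "\<zeta> \<in> G i" "\<zeta> \<in> G j" for i j \<zeta>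
  proof (rule s_inj)
    have "real (s i) < real (s j) + 1" "real (s j) < real (s i) + 1"
      using that G[of i] G[of j] unfolding F_def by fastforce+
    then show "s i = s j" by linarith
  qed
  have single: "(\<Sum>j. c j * indicator (G j) \<zeta>) = c i" if "\<zeta> \<in> G i"
    for c :: "nat \<Rightarrow> 'c::{real_normed_algebra_1}" and \<zeta> i
  proof -
    have "(\<lambda>j. c j * indicator (G j) \<zeta>) = (\<lambda>j. if j = i then c i else 0)"
      using disj that by (auto simp: indicator_def fun_eq_iff)
    then show ?thesis using sums_single[of i "\<lambda>_. c i"] by (simp add: sums_iff)
  qed
  have single': "(\<Sum>j. c j * indicator (G j) \<zeta>) = c i" if "\<zeta> \<in> G i"
    for c :: "nat \<Rightarrow> ennreal" and \<zeta> i
  proof -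
    have "(\<lambda>j. c j * indicator (G j) \<zeta>) = (\<lambda>j. if j = i then c i else 0)"
      using disj that by (auto simp: indicator_def fun_eq_iff)
    then show ?thesis using sums_single[of i "\<lambda>_. c i"] by (simp add: sums_iff)
  qed
  define k where "k = (\<lambda>\<zeta>. \<Sum>j. knot (n j) * indicator (G j) \<zeta>)"
  have km [measurable]: "k \<in> borel_measurable borel" unfolding k_def by measurable
  have k1: "k \<zeta> = knot (n j)" if "\<zeta> \<in> G j" for \<zeta> j unfolding k_def by (rule single[OF that])
  have k0: "k \<zeta> = 0" if "\<zeta> \<notin> (\<Union>j. G j)" for \<zeta> using that by (simp add: k_def)
  have knot0: "0 \<le> knot m" for m using knot_ge[of m] by linarith
  have kn: "0 \<le> k \<zeta>" for \<zeta> using k1 k0 knot0 by (cases "\<zeta> \<in> (\<Union>j. G j)") auto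
  let ?p = "\<lambda>j. 4 ^ 2 ^ n j :: real"
  have fin: "(\<integral>\<^sup>+\<zeta>. ennreal (phi (k \<zeta>)) \<partial>circle_measure) < \<infinity>"
  proof -
    have "(\<integral>\<^sup>+\<zeta>. ennreal (phi (k \<zeta>)) \<partial>circle_measure)
      \<le> (\<integral>\<^sup>+\<zeta>. ennreal 4 + (\<Sum>j. ennreal (?p j) * indicator (G j) \<zeta>) \<partial>circle_measure)"
    proof (rule nn_integral_mono)
      fix \<zeta>
      show "ennreal (phi (k \<zeta>)) \<le> ennreal 4 + (\<Sum>j. ennreal (?p j) * indicator (G j) \<zeta>)"
      proof (cases "\<zeta> \<in> (\<Union>j. G j)")
        case True
        then obtain j where j: "\<zeta> \<in> G j" by auto
        have "ennreal (phi (k \<zeta>)) \<le> ennreal (?p j)" unfolding k1[OF j] by (intro ennreal_leI phi_knot_le)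
        then show ?thesis unfolding single'[OF j] by (rule add_increasing[rotated]) simp
      next
        case False
        \<comment> \<open>Off the sets \<open>G j\<close>, k = 0 = knot 0; this accounts for the
          summand 4.\<close>
        have "ennreal (phi (k \<zeta>)) \<le> ennreal 4" unfolding k0[OF False] using phi_knot_le[of 0] by (intro ennreal_leI) simp
        then show ?thesis by (rule add_increasing2[rotated]) simp
      qed
    qed
    also have "\<dots> = ennreal 4 + (\<Sum>j. ennreal (?p j) * emeasure circle_measure (G j))"
      by (subst nn_integral_add) (auto simp: nn_integral_suminf nn_integral_cmult_indicator)
    also have "(\<lambda>j. ennreal (?p j) * emeasure circle_measure (G j)) = (\<lambda>j. ennreal ((1/2) ^ j))"
      by (simp add: circle.emeasure_eq_measure mG fun_eq_iff flip: ennreal_mult)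
    also have "(\<Sum>j. ennreal ((1/2) ^ j)) \<noteq> top" by (intro ennreal_suminf_neq_top) (auto intro: summable_geometric)
    then have "ennreal 4 + (\<Sum>j. ennreal ((1/2) ^ j)) < \<infinity>" by (simp add: less_top)
    finally show ?thesis .
  qed
  have "\<infinity> = (\<Sum>j. ennreal (?p j * (1 + real (s j))) * emeasure circle_measure (G j))"
  proof (rule ennreal_suminf_ge_1_eq_top[symmetric])
    fix j
    have "?p j * (1 + real (s j)) * measure circle_measure (G j) = (1 + real (s j)) * (1/2) ^ j"
      by (simp add: mG)
    also have "1 \<le> (1 + real (s j)) * (1/2) ^ j"
    proof -
      have "(2::real) ^ j \<le> 4 ^ j" by (intro power_mono) auto
      also have "\<dots> = real (4 ^ j)" by simp
      also have "\<dots> \<le> 1 + real (s j)" using s4[of j] by linarith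
      finally show ?thesis by (simp add: field_simps power_one_over)
    qed
    finally have 1: "1 \<le> ?p j * (1 + real (s j)) * measure circle_measure (G j)" .
    have "(1::ennreal) = ennreal 1" by simp
    also have "\<dots> \<le> ennreal (?p j * (1 + real (s j)) * measure circle_measure (G j))" using 1 by (rule ennreal_leI)
    also have "\<dots> = ennreal (?p j * (1 + real (s j))) * emeasure circle_measure (G j)"
      by (simp add: circle.emeasure_eq_measure ennreal_mult)
    finally show "1 \<le> ennreal (?p j * (1 + real (s j))) * emeasure circle_measure (G j)" .
  qed
  also have "\<dots> = (\<integral>\<^sup>+\<zeta>. (\<Sum>j. ennreal (?p j * (1 + real (s j))) * indicator (G j) \<zeta>) \<partial>circle_measure)"
    by (subst nn_integral_suminf) (auto simp: nn_integral_cmult_indicator)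
  also have "\<dots> \<le> (\<integral>\<^sup>+\<zeta>\<in>{\<zeta>. 0 < u \<zeta>}. ennreal (phi (k \<zeta> + u \<zeta>)) \<partial>circle_measure)"
  proof (rule nn_integral_mono)
    fix \<zeta>
    show "(\<Sum>j. ennreal (?p j * (1 + real (s j))) * indicator (G j) \<zeta>)
      \<le> ennreal (phi (k \<zeta> + u \<zeta>)) * indicator {\<zeta>. 0 < u \<zeta>} \<zeta>"
    proof (cases "\<zeta> \<in> (\<Union>j. G j)")
      case True
      then obtain j where j: "\<zeta> \<in> G j" by auto
      have us: "real (s j) \<le> u \<zeta>" using j G[of j] by (auto simp: F_def)
      \<comment> \<open>The index is positive, so \<open>G j\<close> lies in the region u > 0 to
        which the integral is restricted.\<close>
      have "0 < s j" using s4[of j] by (metis gr0I le_zero_eq power_not_zero zero_neq_numeral)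
      then have pos: "0 < u \<zeta>" using us by linarith
      have "?p j * (1 + real (s j)) \<le> ?p j * (1 + u \<zeta>)" using us by (intro mult_left_mono) auto
      also have "\<dots> \<le> phi (k \<zeta> + u \<zeta>)" unfolding k1[OF j] by (rule phi_knot_add)
      finally show ?thesis unfolding single'[OF j] using pos by (simp add: ennreal_leI)
    qed simp
  qed
  finally have "(\<integral>\<^sup>+\<zeta>\<in>{\<zeta>. 0 < u \<zeta>}. ennreal (phi (k \<zeta> + u \<zeta>)) \<partial>circle_measure) = \<infinity>"
    by (simp add: top.extremum_unique)
  then show ?thesis using km kn fin by blast
qed

section \<open>Comparison of Hardy-Orlicz classes and the two multiplier inclusions\<close>

lemma comp_log_measurable:
  assumes "\<phi> \<in> borel_measurable borel"
  shows "comp_log \<phi> \<in> borel_measurable borel"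
  unfolding comp_log_def using assms by measurable

lemma strongly_convex_measurable: "strongly_convex \<psi> \<Longrightarrow> \<psi> \<in> borel_measurable borel"
  by (rule borel_measurable_mono) (simp add: strongly_convex_def)

text \<open>Serves both the inclusion of classes (f = g) and multiplication by bounded functions.
  The additive 1 is harmless on a space of mass 1, and the Borel version of \<open>bdry g\<close>
  makes the upper integral additive.\<close>

lemma Hardy_Orlicz_le:
  assumes f: "f \<in> Smirnov" and g: "g \<in> Hardy_Orlicz \<Psi>" and \<Psi>: "\<Psi> \<in> borel_measurable borel" "\<And>x. 0 \<le> \<Psi> x"
    and M: "0 \<le> M"
    and le: "AE \<zeta> in circle_measure. \<Phi> (cmod (bdry f \<zeta>)) \<le> M * (\<Psi> (cmod (bdry g \<zeta>)) + 1)"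
  shows "f \<in> Hardy_Orlicz \<Phi>"
proof -
  have gS: "g \<in> Smirnov" using g by (simp add: Hardy_Orlicz_def)
  obtain b where b: "b \<in> borel_measurable borel" "AE \<zeta> in circle_measure. bdry g \<zeta> = b \<zeta>"
    by (rule Smirnov_bdry_measurable[OF gS])
  note [measurable] = b(1) \<Psi>(1)
  have fin: "(\<integral>\<^sup>+\<zeta>. ennreal (\<Psi> (cmod (b \<zeta>))) \<partial>circle_measure) < \<infinity>"
  proof -
    have "(\<integral>\<^sup>+\<zeta>. ennreal (\<Psi> (cmod (b \<zeta>))) \<partial>circle_measure) = (\<integral>\<^sup>+\<zeta>. ennreal (\<Psi> (cmod (bdry g \<zeta>))) \<partial>circle_measure)"
      by (intro nn_integral_cong_AE) (use b(2) in \<open>auto elim: eventually_mono\<close>)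
    then show ?thesis using g by (simp add: Hardy_Orlicz_def)
  qed
  have "(\<integral>\<^sup>+\<zeta>. ennreal (\<Phi> (cmod (bdry f \<zeta>))) \<partial>circle_measure)
    \<le> (\<integral>\<^sup>+\<zeta>. ennreal M * (ennreal (\<Psi> (cmod (b \<zeta>))) + 1) \<partial>circle_measure)"
  proof (rule nn_integral_mono_AE)
    show "AE \<zeta> in circle_measure. ennreal (\<Phi> (cmod (bdry f \<zeta>))) \<le> ennreal M * (ennreal (\<Psi> (cmod (b \<zeta>))) + 1)"
      using le b(2)
    proof eventually_elim
      fix \<zeta> assume a: "\<Phi> (cmod (bdry f \<zeta>)) \<le> M * (\<Psi> (cmod (bdry g \<zeta>)) + 1)" "bdry g \<zeta> = b \<zeta>"
      have "ennreal (\<Phi> (cmod (bdry f \<zeta>))) \<le> ennreal (M * (\<Psi> (cmod (b \<zeta>)) + 1))"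
        using a by (intro ennreal_leI) simp
      also have "\<dots> = ennreal M * (ennreal (\<Psi> (cmod (b \<zeta>))) + 1)"
        using M \<Psi>(2) by (simp add: ennreal_mult ennreal_plus)
      finally show "ennreal (\<Phi> (cmod (bdry f \<zeta>))) \<le> ennreal M * (ennreal (\<Psi> (cmod (b \<zeta>))) + 1)" .
    qed
  qed
  also have "\<dots> = ennreal M * ((\<integral>\<^sup>+\<zeta>. ennreal (\<Psi> (cmod (b \<zeta>))) \<partial>circle_measure) + 1)"
    by (subst nn_integral_cmult) (auto simp: nn_integral_add)
  also have "\<dots> < \<infinity>" using fin by (simp add: ennreal_mult_less_top)
  finally show ?thesis using f by (simp add: Hardy_Orlicz_def)
qed

lemma one_Smirnov: "(\<lambda>_. 1) \<in> Smirnov"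
  using outer_fun_Smirnov[of "\<lambda>_. 0" 0] by (simp add: outer_fun_def[abs_def] herglotz_def)

lemma Hinf_Smirnov: "g \<in> Hinf \<Longrightarrow> g \<in> Smirnov"
  using Smirnov_mult_Hinf[OF _ one_Smirnov] by simp

text \<open>Under the logarithm the factor exp a becomes a shift by a, which
  \<open>phi_add_le\<close> controls; y = 0 is covered by the convention in
  \<open>comp_log\<close>.\<close>

lemma comp_log_phi_mult_le:
  "\<exists>M\<ge>0. \<forall>x y. 0 \<le> y \<longrightarrow> y \<le> exp a * x \<longrightarrow> comp_log phi y \<le> M * (comp_log phi x + 1)"
proof -
  obtain M where M: "M \<ge> 0" "\<And>t. phi (t + a) \<le> M * (phi t + 1)" using phi_add_le by blast
  have "comp_log phi y \<le> M * (comp_log phi x + 1)" if y: "0 \<le> y" "y \<le> exp a * x" for x y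
  proof (cases "y = 0")
    case True
    then show ?thesis using M phi_nonneg by (simp add: comp_log_def)
  next
    case False
    then have "0 < exp a * x" using y by linarith
    then have x: "0 < x" by (simp add: zero_less_mult_iff)
    have "ln y \<le> ln (exp a * x)" using y False by (intro ln_mono) auto
    also have "\<dots> = ln x + a" using x by (simp add: ln_mult)
    finally have "phi (ln y) \<le> phi (ln x + a)" by (rule phi_mono)
    also have "\<dots> \<le> M * (phi (ln x) + 1)" by (rule M)
    finally show ?thesis using x y False by (simp add: comp_log_def)
  qed
  then show ?thesis using M(1) by blast
qed

lemma Hinf_subset_Mult: "Hinf \<subseteq> Mult (Hardy_Orlicz (comp_log phi))"
proof
  fix g assume g: "g \<in> Hinf"
  obtain C0 where C0: "\<And>z. cmod z < 1 \<Longrightarrow> cmod (g z) \<le> C0" using Hinf_bounded[OF g] by auto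
  \<comment> \<open>The maximum with 1 makes the logarithm invertible by exp even if C0 is not
    positive.\<close>
  define a where "a = ln (max C0 1)"
  have C: "cmod (g z) \<le> exp a" if "cmod z < 1" for z using C0[OF that] by (simp add: a_def)
  obtain M where M: "M \<ge> 0" "\<And>x y. 0 \<le> y \<Longrightarrow> y \<le> exp a * x \<Longrightarrow> comp_log phi y \<le> M * (comp_log phi x + 1)"
    using comp_log_phi_mult_le by blast
  have gb: "AE \<zeta> in circle_measure. cmod (bdry g \<zeta>) \<le> exp a"
    using Fatou[OF g] AE_circle_norm
  proof eventually_elim
    fix \<zeta> :: complex assume z: "has_nt_limit g \<zeta> (bdry g \<zeta>)" "cmod \<zeta> = 1"
    show "cmod (bdry g \<zeta>) \<le> exp a"
    proof (rule tendsto_upperbound[OF tendsto_norm[OF has_nt_limitD[OF z(1)]] _ nt_nontrivial[OF z(2)]])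
      show "\<forall>\<^sub>F z in at \<zeta> within Stolz 2 \<zeta>. cmod (g z) \<le> exp a"
        by (auto simp: eventually_at_filter Stolz_def C)
    qed simp
  qed
  have "(\<lambda>z. g z * f z) \<in> Hardy_Orlicz (comp_log phi)" if f: "f \<in> Hardy_Orlicz (comp_log phi)" for f
  proof (rule Hardy_Orlicz_le[OF _ f _ _ M(1)])
    have fS: "f \<in> Smirnov" using f by (simp add: Hardy_Orlicz_def)
    show "(\<lambda>z. g z * f z) \<in> Smirnov" by (rule Smirnov_mult_Hinf[OF g fS])
    show "comp_log phi \<in> borel_measurable borel" by (rule comp_log_measurable) simp
    show "0 \<le> comp_log phi x" for x by (simp add: comp_log_def phi_nonneg)
    show "AE \<zeta> in circle_measure. comp_log phi (cmod (bdry (\<lambda>z. g z * f z) \<zeta>)) \<le> M * (comp_log phi (cmod (bdry f \<zeta>)) + 1)"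
      using Smirnov_bdry_mult[OF Hinf_Smirnov[OF g] fS] gb
      by eventually_elim (auto simp: norm_mult intro!: M(2) mult_right_mono)
  qed
  then show "g \<in> Mult (Hardy_Orlicz (comp_log phi))" using g by (auto simp: Mult_def Hinf_def)
qed

lemma outer_fun_Hardy_Orlicz:
  assumes k [measurable]: "k \<in> borel_measurable borel" and k0: "\<And>\<zeta>. 0 \<le> k \<zeta>"
    and fin: "(\<integral>\<^sup>+\<zeta>. ennreal (phi (k \<zeta>)) \<partial>circle_measure) < \<infinity>"
  shows "integrable circle_measure k" "outer_fun k \<in> Hardy_Orlicz (comp_log phi)"
proof -
  show ki: "integrable circle_measure k"
  proof (rule integrableI_bounded)
    have "(\<integral>\<^sup>+\<zeta>. ennreal (norm (k \<zeta>)) \<partial>circle_measure) \<le> (\<integral>\<^sup>+\<zeta>. ennreal (phi (k \<zeta>)) \<partial>circle_measure)"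
      using k0 by (intro nn_integral_mono ennreal_leI) (simp add: phi_ge_self)
    then show "(\<integral>\<^sup>+\<zeta>. ennreal (norm (k \<zeta>)) \<partial>circle_measure) < \<infinity>" using fin by (rule order_le_less_trans)
  qed simp
  have "(\<integral>\<^sup>+\<zeta>. ennreal (comp_log phi (cmod (bdry (outer_fun k) \<zeta>))) \<partial>circle_measure)
      = (\<integral>\<^sup>+\<zeta>. ennreal (phi (k \<zeta>)) \<partial>circle_measure)"
    by (intro nn_integral_cong_AE)
      (use outer_fun_bdry[OF ki k0] in \<open>auto simp: comp_log_def elim!: eventually_mono\<close>)
  then show "outer_fun k \<in> Hardy_Orlicz (comp_log phi)"
    using fin outer_fun_Smirnov[OF ki k0] by (simp add: Hardy_Orlicz_def)
qed

lemma Mult_subset_Hinf: "Mult (Hardy_Orlicz (comp_log phi)) \<subseteq> Hinf"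
proof
  fix g assume g: "g \<in> Mult (Hardy_Orlicz (comp_log phi))"
  then have mult: "(\<lambda>z. g z * f z) \<in> Hardy_Orlicz (comp_log phi)" if "f \<in> Hardy_Orlicz (comp_log phi)" for f
    using that by (simp add: Mult_def)
  \<comment> \<open>Membership in \<open>Mult\<close> provides only holomorphy; the test function 1
    shows that g itself is in the class, hence has boundary values.\<close>
  have "(\<lambda>_. 1) \<in> Hardy_Orlicz (comp_log phi)"
    using outer_fun_Hardy_Orlicz(2)[of "\<lambda>_. 0"] by (simp add: outer_fun_def[abs_def] herglotz_def ennreal_mult_less_top)
  from mult[OF this] have gS: "g \<in> Smirnov" by (simp add: Hardy_Orlicz_def)
  obtain b where bm [measurable]: "b \<in> borel_measurable borel" and b: "AE \<zeta> in circle_measure. bdry g \<zeta> = b \<zeta>"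
    by (rule Smirnov_bdry_measurable[OF gS])
  \<comment> \<open>Since ln 0 = 0, zeros of \<open>b\<close> give u = 0 and fall outside the region
    u > 0. There the identity with \<open>comp_log\<close>, which is 0 at 0, would break
    down.\<close>
  define u where "u = (\<lambda>\<zeta>. ln (cmod (b \<zeta>)))"
  have um: "u \<in> borel_measurable borel" unfolding u_def by measurable
  show "g \<in> Hinf"
  proof (rule ccontr)
    assume notin: "g \<notin> Hinf"
    have "\<not> (AE \<zeta> in circle_measure. u \<zeta> \<le> C)" for C
    proof
      assume "AE \<zeta> in circle_measure. u \<zeta> \<le> C"
      with b have "AE \<zeta> in circle_measure. cmod (bdry g \<zeta>) \<le> exp C"
      proof eventually_elim
        fix \<zeta> assume a: "bdry g \<zeta> = b \<zeta>" "u \<zeta> \<le> C"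
        have "cmod (b \<zeta>) \<le> exp (u \<zeta>)" by (cases "b \<zeta> = 0") (simp_all add: u_def)
        also have "\<dots> \<le> exp C" using a(2) by simp
        finally show "cmod (bdry g \<zeta>) \<le> exp C" by (simp only: a(1))
      qed
      then have "cmod (g z) \<le> exp C" if "cmod z < 1" for z using gS that by (intro Smirnov_bound_bdry)
      then have "g \<in> Hinf" using gS by (intro HinfI) (auto simp: Smirnov_def Hol_disk_def)
      with notin show False ..
    qed
    from unbounded_shift_diverges[OF um this] obtain k where
      k: "k \<in> borel_measurable borel" "\<And>\<zeta>. 0 \<le> k \<zeta>" "(\<integral>\<^sup>+\<zeta>. ennreal (phi (k \<zeta>)) \<partial>circle_measure) < \<infinity>"
      and div: "(\<integral>\<^sup>+\<zeta>\<in>{\<zeta>. 0 < u \<zeta>}. ennreal (phi (k \<zeta> + u \<zeta>)) \<partial>circle_measure) = \<infinity>" by auto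
    note ki = outer_fun_Hardy_Orlicz(1)[OF k] and f = outer_fun_Hardy_Orlicz(2)[OF k]
    have fS: "outer_fun k \<in> Smirnov" by (rule outer_fun_Smirnov[OF ki k(2)])
    have "(\<lambda>z. g z * outer_fun k z) \<in> Hardy_Orlicz (comp_log phi)" by (rule mult[OF f])
    then have "(\<integral>\<^sup>+\<zeta>. ennreal (comp_log phi (cmod (bdry (\<lambda>z. g z * outer_fun k z) \<zeta>))) \<partial>circle_measure) < \<infinity>"
      by (simp add: Hardy_Orlicz_def)
    moreover have "(\<integral>\<^sup>+\<zeta>\<in>{\<zeta>. 0 < u \<zeta>}. ennreal (phi (k \<zeta> + u \<zeta>)) \<partial>circle_measure)
      \<le> (\<integral>\<^sup>+\<zeta>. ennreal (comp_log phi (cmod (bdry (\<lambda>z. g z * outer_fun k z) \<zeta>))) \<partial>circle_measure)"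
    proof (rule nn_integral_mono_AE)
      show "AE \<zeta> in circle_measure. ennreal (phi (k \<zeta> + u \<zeta>)) * indicator {\<zeta>. 0 < u \<zeta>} \<zeta>
        \<le> ennreal (comp_log phi (cmod (bdry (\<lambda>z. g z * outer_fun k z) \<zeta>)))"
        using Smirnov_bdry_mult[OF gS fS] b outer_fun_bdry[OF ki k(2)]
      proof eventually_elim
        fix \<zeta>
        assume a: "bdry (\<lambda>z. g z * outer_fun k z) \<zeta> = bdry g \<zeta> * bdry (outer_fun k) \<zeta>" "bdry g \<zeta> = b \<zeta>"
          "cmod (bdry (outer_fun k) \<zeta>) = exp (k \<zeta>)"
        show "ennreal (phi (k \<zeta> + u \<zeta>)) * indicator {\<zeta>. 0 < u \<zeta>} \<zeta>
          \<le> ennreal (comp_log phi (cmod (bdry (\<lambda>z. g z * outer_fun k z) \<zeta>)))"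
        proof (cases "0 < u \<zeta>")
          case True
          then have "0 < cmod (b \<zeta>)" by (cases "b \<zeta> = 0") (auto simp: u_def)
          then have "comp_log phi (cmod (bdry (\<lambda>z. g z * outer_fun k z) \<zeta>)) = phi (k \<zeta> + u \<zeta>)"
            using a by (simp add: comp_log_def norm_mult ln_mult u_def add.commute)
          then show ?thesis using True by simp
        qed simp
      qed
    qed
    ultimately show False using div by simp
  qed
qed

theorem theorem4p2:
  fixes \<beta> :: real
  assumes "\<beta> > 1"
  shows "\<exists>\<phi> :: real \<Rightarrow> real. strongly_convex \<phi> \<and> tilde_Delta2 \<phi> \<and>
           (\<forall>\<phi>\<^sub>\<beta>. is_phi_beta \<beta> \<phi>\<^sub>\<beta> \<longrightarrow>
              Hardy_Orlicz (comp_log \<phi>\<^sub>\<beta>) \<subseteq> Hardy_Orlicz (comp_log \<phi>)) \<and>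
           Mult (Hardy_Orlicz (comp_log \<phi>)) = Hinf"
proof (intro exI[of _ phi] conjI allI impI)
  show "strongly_convex phi" by (rule phi_strongly_convex)
  show "tilde_Delta2 phi" by (rule phi_tilde_Delta2)
  show "Mult (Hardy_Orlicz (comp_log phi)) = Hinf"
    using Mult_subset_Hinf Hinf_subset_Mult by (rule equalityI)
  fix \<psi> assume \<psi>: "is_phi_beta \<beta> \<psi>"
  obtain K where K: "K \<ge> 0" "\<And>t. phi t \<le> \<psi> t + K" using phi_le_phi_beta[OF assms \<psi>] by auto
  have sc: "strongly_convex \<psi>" using \<psi> by (simp add: is_phi_beta_def)
  then have \<psi>0: "0 \<le> \<psi> t" for t by (simp add: strongly_convex_def)
  show "Hardy_Orlicz (comp_log \<psi>) \<subseteq> Hardy_Orlicz (comp_log phi)"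
  proof
    fix f assume f: "f \<in> Hardy_Orlicz (comp_log \<psi>)"
    show "f \<in> Hardy_Orlicz (comp_log phi)"
    proof (rule Hardy_Orlicz_le[OF _ f])
      show "f \<in> Smirnov" using f by (simp add: Hardy_Orlicz_def)
      show "comp_log \<psi> \<in> borel_measurable borel" by (intro comp_log_measurable strongly_convex_measurable sc)
      show "0 \<le> comp_log \<psi> x" for x by (simp add: comp_log_def \<psi>0)
      \<comment> \<open>The factor 1 + K brings phi \<le> \<psi> + K into the form required by
        \<open>Hardy_Orlicz_le\<close>.\<close>
      show "0 \<le> 1 + K" using K by simp
      show "AE \<zeta> in circle_measure. comp_log phi (cmod (bdry f \<zeta>)) \<le> (1 + K) * (comp_log \<psi> (cmod (bdry f \<zeta>)) + 1)"
      proof (rule AE_I2)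
        fix \<zeta>
        have "phi t \<le> (1 + K) * (\<psi> t + 1)" for t
          using K(2)[of t] mult_nonneg_nonneg[OF K(1) \<psi>0[of t]] by (simp add: algebra_simps)
        then show "comp_log phi (cmod (bdry f \<zeta>)) \<le> (1 + K) * (comp_log \<psi> (cmod (bdry f \<zeta>)) + 1)"
          using K(1) by (simp add: comp_log_def)
      qed
    qed
  qed
qed

end
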